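(* Let $\dot X$ be a symmetric pure jump Lévy white noise on a Borel set $S\subset\mathbb{R}^d$, with characteristic triplet $(0,0,\nu)$ and jump measure $J$. Let $f:S\times\mathbb{R}^n\to\mathbb{R}$ be measurable and such that for any $t\in\mathbb{R}^n$, $f(\cdot,t)\in L(\dot X,S)$, and let $\mu$ be a finite measure on $\mathbb{R}^n$. Suppose that $$\int_{\mathbb{R}^n}\left|\langle\dot X,f(\cdot,t)\rangle\right|\mu(\mathrm{d}t)<+\infty\qquad\text{a.s.}$$ Then, for almost all $s\in S$, $f(s,\cdot)\in L^1(\mu)$, the function $\mu\circledast f: s\mapsto\int_{\mathbb{R}^n}f(s,t)\,\mu(\mathrm{d}t)$ is in $L(\dot X,S)$, and $$\int_{\mathbb{R}^n}\langle\dot X,f(\cdot,t)\rangle\,\mu(\mathrm{d}t)=\langle\dot X,\mu\circledast f\rangle\qquad\text{a.s.}$$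
   Context: Symmetric pure jump Lévy white noise with characteristic triplet $(0,0,\nu)$ on $S$: $\nu$ is a nonzero symmetric Lévy measure on $\mathbb{R}$ (i.e. $\nu(\{0\})=0$, $\int_{\mathbb{R}}(z^2\wedge1)\,\nu(\mathrm{d}z)<\infty$), $J$ is a Poisson random measure on $S\times\mathbb{R}$ with intensity measure $\mathrm{d}s\,\nu(\mathrm{d}z)$, $\tilde J(\mathrm{d}s,\mathrm{d}z)=J(\mathrm{d}s,\mathrm{d}z)-\mathrm{d}s\,\nu(\mathrm{d}z)$ is its compensated version, and $$X(\mathrm{d}s)=\int_{|z|\le1}z\,\tilde J(\mathrm{d}s,\mathrm{d}z)+\int_{|z|>1}z\,J(\mathrm{d}s,\mathrm{d}z).$$ This is an independently scattered random measure in the sense of Rajput and Rosiński. The space of deterministic functions integrable with respect to it is $$L(\dot X,S)=\left\{f:S\to\mathbb{R}\text{ measurable}:\int_{S\times\mathbb{R}}\left(|f(s)z|^2\wedge1\right)\mathrm{d}s\,\nu(\mathrm{d}z)<+\infty\right\},$$ and for $f\in L(\dot X,S)$ the stochastic integral of $f$ with respect to $X$ is denoted $\langle\dot X,f\rangle$ (it is the extension, by limits in probability, of the integral of simple functions $\sum_ia_i\mathbf{1}_{A_i}\mapsto\sum_ia_iX(A_i)$; it is a.s. linear in $f$ and $\mathbb{E}(e^{iu\langle\dot X,f\rangle})=\exp(-\int_{S\times\mathbb{R}}(1-\cos(uf(s)z))\,\mathrm{d}s\,\nu(\mathrm{d}z))$). For measurable $f$ with $f(\cdot,t)\in L(\dot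 X,S)$ for all $t$, the random field $t\mapsto\langle\dot X,f(\cdot,t)\rangle$ has a jointly measurable version in $(t,\omega)$; such a version is used in the integrals over $t$. "Almost all $s\in S$" refers to Lebesgue measure. *)

theory Defs
  imports "HOL-Probability.Probability"
begin

section \<open>Poisson random measures and compensated integrals\<close>

definition symmetric_levy_measure :: "real measure \<Rightarrow> bool" where
  "symmetric_levy_measure \<nu> \<longleftrightarrow>
     sets \<nu> = sets borel \<and>
     emeasure \<nu> UNIV \<noteq> 0 \<and>
     emeasure \<nu> {0} = 0 \<and>
     (\<integral>\<^sup>+ z. ennreal (min (z\<^sup>2) 1) \<partial>\<nu>) < \<infinity> \<and>
     (\<forall>A \<in> sets borel. emeasure \<nu> (uminus ` A) = emeasure \<nu> A)"

text \<open>For sets of infinite intensity, the Poisson law with infinite mean is the point mass at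
  \<^term>\<open>\<infinity>\<close>.\<close>

definition poisson_random_measure ::
    "'w measure \<Rightarrow> 'c measure \<Rightarrow> ('w \<Rightarrow> 'c measure) \<Rightarrow> bool" where
  "poisson_random_measure M N J \<longleftrightarrow>
     (\<forall>\<omega> \<in> space M. sets (J \<omega>) = sets N) \<and>
     (\<forall>\<omega> \<in> space M. \<forall>B \<in> sets N. emeasure (J \<omega>) B \<in> insert \<infinity> (range of_nat)) \<and>
     (\<forall>B \<in> sets N. (\<lambda>\<omega>. emeasure (J \<omega>) B) \<in> borel_measurable M) \<and>
     (\<forall>B \<in> sets N. emeasure N B < \<infinity> \<longrightarrow>
        (\<forall>k. measure M {\<omega> \<in> space M. emeasure (J \<omega>) B = of_nat k} =
               exp (- measure N B) * measure N B ^ k / fact k)) \<and>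
     (\<forall>B \<in> sets N. emeasure N B = \<infinity> \<longrightarrow> (AE \<omega> in M. emeasure (J \<omega>) B = \<infinity>)) \<and>
     (\<forall>(I :: nat set) B. finite I \<and> (\<forall>i \<in> I. B i \<in> sets N) \<and> disjoint_family_on B I \<longrightarrow>
        prob_space.indep_vars M (\<lambda>_. borel) (\<lambda>i \<omega>. emeasure (J \<omega>) (B i)) I)"

text \<open>The integral of a square integrable \<^term>\<open>g\<close> against the compensated measure \<open>J - N\<close>:
  on functions in \<open>L\<^sup>1 \<inter> L\<^sup>2\<close> it is the difference of the two integrals, and it is extended to
  \<open>L\<^sup>2\<close> by continuity in mean square.  The random variable \<^term>\<open>Y\<close> is determined up to null
  sets.\<close>

definition has_compensated_integral ::
    "'w measure \<Rightarrow> 'c measure \<Rightarrow> ('w \<Rightarrow> 'c measure) \<Rightarrow> ('c \<Rightarrow> real) \<Rightarrow> ('w \<Rightarrow> real) \<Rightarrow> bool" where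
  "has_compensated_integral M N J g Y \<longleftrightarrow>
     g \<in> borel_measurable N \<and> integrable N (\<lambda>x. (g x)\<^sup>2) \<and> Y \<in> borel_measurable M \<and>
     (\<exists>h :: nat \<Rightarrow> 'c \<Rightarrow> real.
        (\<forall>k. integrable N (h k) \<and> integrable N (\<lambda>x. (h k x)\<^sup>2)) \<and>
        (\<lambda>k. \<integral>\<^sup>+ x. ennreal ((h k x - g x)\<^sup>2) \<partial>N) \<longlonglongrightarrow> 0 \<and>
        (\<lambda>k. \<integral>\<^sup>+ \<omega>. ennreal (((\<integral>x. h k x \<partial>J \<omega>) - (\<integral>x. h k x \<partial>N) - Y \<omega>)\<^sup>2) \<partial>M) \<longlonglongrightarrow> 0)"

section \<open>The symmetric pure jump noise\<close>

definition jump_intensity :: "'a::euclidean_space set \<Rightarrow> real measure \<Rightarrow> ('a \<times> real) measure" where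
  "jump_intensity S \<nu> = restrict_space lborel S \<Otimes>\<^sub>M \<nu>"

text \<open>The last conjunct says
  \<open>X(A) = \<integral>\<^sub>A \<integral>\<^bsub>|z| \<le> 1\<^esub> z (J - N)(ds, dz) + \<integral>\<^sub>A \<integral>\<^bsub>|z| > 1\<^esub> z J(ds, dz)\<close> almost surely, for
  every Borel set \<open>A \<subseteq> S\<close> of finite Lebesgue measure.  The values of \<^term>\<open>X\<close> on other sets are
  irrelevant.\<close>

definition symmetric_pure_jump_noise ::
    "'w measure \<Rightarrow> 'a::euclidean_space set \<Rightarrow> real measure \<Rightarrow> ('w \<Rightarrow> ('a \<times> real) measure) \<Rightarrow>
       ('a set \<Rightarrow> 'w \<Rightarrow> real) \<Rightarrow> bool" where
  "symmetric_pure_jump_noise M S \<nu> J X \<longleftrightarrow>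
     (prob_space M \<and> S \<in> sets borel \<and> symmetric_levy_measure \<nu> \<and>
      poisson_random_measure M (jump_intensity S \<nu>) J) \<and>
     (\<forall>A \<in> sets borel. A \<subseteq> S \<and> emeasure lborel A < \<infinity> \<longrightarrow>
        X A \<in> borel_measurable M \<and>
        (\<exists>Y. has_compensated_integral M (jump_intensity S \<nu>) J
               (\<lambda>(s, z). z * indicator (A \<times> {z. \<bar>z\<bar> \<le> 1}) (s, z)) Y \<and>
             (AE \<omega> in M. X A \<omega> =
                Y \<omega> + (\<integral>(s, z). z * indicator (A \<times> {z. \<bar>z\<bar> > 1}) (s, z) \<partial>J \<omega>))))"

section \<open>The stochastic integral\<close>

definition noise_L :: "'a::euclidean_space set \<Rightarrow> real measure \<Rightarrow> ('a \<Rightarrow> real) set" where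
  "noise_L S \<nu> = {f \<in> borel_measurable (restrict_space borel S).
     (\<integral>\<^sup>+ (s, z). ennreal (min (\<bar>f s * z\<bar>\<^sup>2) 1) \<partial>jump_intensity S \<nu>) < \<infinity>}"

definition conv_in_prob :: "'w measure \<Rightarrow> (nat \<Rightarrow> 'w \<Rightarrow> real) \<Rightarrow> ('w \<Rightarrow> real) \<Rightarrow> bool" where
  "conv_in_prob M Z Y \<longleftrightarrow>
     (\<forall>k. Z k \<in> borel_measurable M) \<and> Y \<in> borel_measurable M \<and>
     (\<forall>e > 0. (\<lambda>k. measure M {\<omega> \<in> space M. \<bar>Z k \<omega> - Y \<omega>\<bar> > e}) \<longlonglongrightarrow> 0)"

text \<open>The integral over \<^term>\<open>A\<close> of a simple function \<open>\<phi> = \<Sum>\<^sub>i a\<^sub>i 1\<^bsub>A\<^sub>i\<^esub>\<close>, in the canonical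
  representation by level sets.  The level set of the value 0 may have infinite measure, but its
  coefficient vanishes.\<close>

definition simple_noise_integral ::
    "'a set \<Rightarrow> ('a set \<Rightarrow> 'w \<Rightarrow> real) \<Rightarrow> 'a set \<Rightarrow> ('a \<Rightarrow> real) \<Rightarrow> 'w \<Rightarrow> real" where
  "simple_noise_integral S X A \<phi> \<omega> = (\<Sum>y \<in> \<phi> ` S. y * X (A \<inter> {s \<in> S. \<phi> s = y}) \<omega>)"

text \<open>The integral of Rajput and Rosinski: \<^term>\<open>f\<close> is the almost everywhere limit of simple
  functions whose integrals over every Borel subset of \<^term>\<open>S\<close> converge in probability, and
  \<^term>\<open>Y\<close> is the limit of the integrals over \<^term>\<open>S\<close>.\<close>

definition has_noise_integral ::
    "'w measure \<Rightarrow> 'a::euclidean_space set \<Rightarrow> ('a set \<Rightarrow> 'w \<Rightarrow> real) \<Rightarrow> ('a \<Rightarrow> real) \<Rightarrow>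
       ('w \<Rightarrow> real) \<Rightarrow> bool" where
  "has_noise_integral M S X f Y \<longleftrightarrow>
     f \<in> borel_measurable (restrict_space borel S) \<and>
     (\<exists>\<phi> :: nat \<Rightarrow> 'a \<Rightarrow> real.
        (\<forall>k. Bochner_Integration.simple_bochner_integrable (restrict_space lborel S) (\<phi> k)) \<and>
        (AE s in restrict_space lborel S. (\<lambda>k. \<phi> k s) \<longlonglongrightarrow> f s) \<and>
        (\<forall>A \<in> sets borel. A \<subseteq> S \<longrightarrow>
           (\<exists>Z. conv_in_prob M (\<lambda>k. simple_noise_integral S X A (\<phi> k)) Z)) \<and>
        conv_in_prob M (\<lambda>k. simple_noise_integral S X S (\<phi> k)) Y)"

text \<open>A representative of the almost sure equivalence class of the integral of \<^term>\<open>f\<close>.\<close>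

definition noise_integral ::
    "'w measure \<Rightarrow> 'a::euclidean_space set \<Rightarrow> ('a set \<Rightarrow> 'w \<Rightarrow> real) \<Rightarrow> ('a \<Rightarrow> real) \<Rightarrow>
       'w \<Rightarrow> real" where
  "noise_integral M S X f = (SOME Y. has_noise_integral M S X f Y)"

text \<open>\<^term>\<open>Y\<close> is a jointly measurable version of the field of integrals of the functions
  \<open>f(\<cdot>, t)\<close>.\<close>

definition measurable_version_noise_field ::
    "'w measure \<Rightarrow> 'a::euclidean_space set \<Rightarrow> ('a set \<Rightarrow> 'w \<Rightarrow> real) \<Rightarrow>
       ('a \<Rightarrow> 'b::euclidean_space \<Rightarrow> real) \<Rightarrow> ('b \<Rightarrow> 'w \<Rightarrow> real) \<Rightarrow> bool" where
  "measurable_version_noise_field M S X f Y \<longleftrightarrow>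
     (\<lambda>(t, \<omega>). Y t \<omega>) \<in> borel_measurable (borel \<Otimes>\<^sub>M M) \<and>
     (\<forall>t. AE \<omega> in M. Y t \<omega> = noise_integral M S X (\<lambda>s. f s t) \<omega>)"

end

theory Submission
  imports Defs
begin

text \<open>Write \<open>\<integral> g d\<tilde>J\<close> for the compensated integral of a function \<open>g(s, z)\<close> that is odd in \<open>z\<close>
  and \<open>N\<close> for the intensity of \<open>J\<close>.  Averaging
  \<open>E cos (u \<integral> g d\<tilde>J) = exp (- \<integral> (1 - cos (u g)) dN)\<close> over \<open>u \<in> [0, 1]\<close> shows that \<open>E min (\<bar>\<integral> g d\<tilde>J\<bar>\<^sup>2, 1)\<close>
  and \<open>\<integral> min (g\<^sup>2, 1) dN\<close> are comparable as long as the former is small.  Hence the integral is a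
  homeomorphism onto its range, and a sequence of integrals that converges in probability, with integrands
  that converge almost everywhere, converges to the integral of the limit.

  The integral over \<open>t\<close> is approximated by weighted sums over finitely many points, chosen
  simultaneously for the random field and for \<open>f\<close>.  Once \<open>f(s, \<cdot>) \<in> L\<^sup>1(\<mu>)\<close> for almost all \<open>s\<close> is
  known, linearity and the closure property above give the identity.

  For the integrability, let \<open>D\<close> be a set of finite measure of \<open>s\<close> with \<open>\<integral> \<bar>f(s, t)\<bar> \<mu>(dt) = \<infinity>\<close> and let
  \<open>C = D \<times> {\<bar>z\<bar> > e}\<close>.  The part of the field caused by jumps outside \<open>C\<close> is
  independent of the number of jumps in \<open>C\<close>, and it is in \<open>L\<^sup>1(\<mu>)\<close> since with positive
  probability there is no jump in \<open>C\<close>.  If there is exactly one jump \<open>(s, z)\<close> in \<open>C\<close>, the field is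
  this part plus \<open>z f(s, \<cdot>)\<close>, which is not in \<open>L\<^sup>1(\<mu>)\<close>; so this event has
  probability 0, and \<open>C\<close> and \<open>D\<close> are null sets.\<close>

section \<open>Truncated second moments\<close>

text \<open>The symmetry of \<open>\<nu>\<close> removes every compensator: an integrable function
  that is odd in \<open>z\<close> has \<open>N\<close>-integral 0, so on odd functions cut off near
  0 the compensated integral is the pathwise integral against \<open>J\<close>, and its
  characteristic function is real. The truncated square \<open>min (x^2) 1\<close> is used on both
  sides because it metrizes convergence in probability on \<open>M\<close> and at the same time
  describes the space of integrands on the infinite measure \<open>N\<close>. The main obstacle is
  that \<open>Y t\<close> is tied to the integral of \<open>f(., t)\<close> only for each fixed
  \<open>t\<close>, up to a null set depending on \<open>t\<close>. A jump can thus be removed from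
  the field at finitely many \<open>t\<close> at once, but not for all \<open>t\<close>
  simultaneously, which forces quantitative inequalities for finite weighted sums with a limit taken
  afterwards. A second obstacle is that these sums converge only for integrands in L1 of a product
  of finite measures, while merely the almost sure finiteness of the integral of
  \<open>\<bar>Y\<bar>\<close> is given and Lebesgue measure on \<open>S\<close> may be infinite;
  passing to equivalent finite measures with small densities repairs this. Where \<open>f\<close> is
  not yet known to be integrable in \<open>t\<close>, it is truncated at a growing level.\<close>

definition tmom :: "'a measure \<Rightarrow> ('a \<Rightarrow> real) \<Rightarrow> ennreal" where
  "tmom M g = (\<integral>\<^sup>+ x. ennreal (min ((g x)\<^sup>2) 1) \<partial>M)"

lemma tmom_cong_AE: "AE x in M. f x = g x \<Longrightarrow> tmom M f = tmom M g"
  unfolding tmom_def by (rule nn_integral_cong_AE) auto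

lemma tmom_mono_AE: "AE x in M. \<bar>f x\<bar> \<le> \<bar>g x\<bar> \<Longrightarrow> tmom M f \<le> tmom M g"
  unfolding tmom_def
  by (rule nn_integral_mono_AE) (auto elim!: eventually_mono intro!: ennreal_leI min.mono simp: abs_le_square_iff)

lemma tmom_uminus_commute: "tmom M (\<lambda>x. f x - g x) = tmom M (\<lambda>x. g x - f x)"
  unfolding tmom_def by (simp add: power2_commute)

lemma tmom_zero [simp]: "tmom M (\<lambda>x. 0) = 0"
  by (simp add: tmom_def)

lemma min_square_add: "min ((a + b)\<^sup>2) 1 \<le> 2 * min (a\<^sup>2) 1 + 2 * min (b\<^sup>2) (1::real)"
proof -
  have "(a + b)\<^sup>2 \<le> 2 * a\<^sup>2 + 2 * b\<^sup>2"
    using sum_squares_bound[of a b] by (simp add: power2_sum)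
  moreover have "min c 1 \<le> 2 * min x 1 + 2 * min y 1" if "c \<le> 2 * x + 2 * y" "0 \<le> x" "0 \<le> y" for c x y :: real
    using that by (auto simp: min_def)
  ultimately show ?thesis by simp
qed

lemma tmom_add:
  assumes [measurable]: "f \<in> borel_measurable M" "g \<in> borel_measurable M"
  shows "tmom M (\<lambda>x. f x + g x) \<le> 2 * tmom M f + 2 * tmom M g"
proof -
  have "tmom M (\<lambda>x. f x + g x) \<le> (\<integral>\<^sup>+ x. 2 * ennreal (min ((f x)\<^sup>2) 1) + 2 * ennreal (min ((g x)\<^sup>2) 1) \<partial>M)"
    unfolding tmom_def
  proof (rule nn_integral_mono)
    fix x
    have "ennreal (min ((f x + g x)\<^sup>2) 1) \<le> ennreal (2 * min ((f x)\<^sup>2) 1 + 2 * min ((g x)\<^sup>2) 1)"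
      by (rule ennreal_leI[OF min_square_add])
    also have "\<dots> = 2 * ennreal (min ((f x)\<^sup>2) 1) + 2 * ennreal (min ((g x)\<^sup>2) 1)"
      by (simp add: ennreal_plus ennreal_mult)
    finally show "ennreal (min ((f x + g x)\<^sup>2) 1) \<le> 2 * ennreal (min ((f x)\<^sup>2) 1) + 2 * ennreal (min ((g x)\<^sup>2) 1)" .
  qed
  also have "\<dots> = 2 * tmom M f + 2 * tmom M g"
    unfolding tmom_def by (simp add: nn_integral_add nn_integral_cmult)
  finally show ?thesis .
qed

lemma tmom_triangle:
  assumes [measurable]: "f \<in> borel_measurable M" "g \<in> borel_measurable M" "h \<in> borel_measurable M"
  shows "tmom M (\<lambda>x. f x - h x) \<le> 2 * tmom M (\<lambda>x. f x - g x) + 2 * tmom M (\<lambda>x. g x - h x)"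
  using tmom_add[of "\<lambda>x. f x - g x" M "\<lambda>x. g x - h x"] by simp

lemma tmom_le_add_diff:
  assumes [measurable]: "f \<in> borel_measurable M" "g \<in> borel_measurable M"
  shows "tmom M f \<le> 2 * tmom M g + 2 * tmom M (\<lambda>x. f x - g x)"
  using tmom_add[of g M "\<lambda>x. f x - g x"] by simp

lemma tmom_cmult:
  assumes [measurable]: "f \<in> borel_measurable M"
  shows "tmom M (\<lambda>x. c * f x) \<le> ennreal (max 1 (c\<^sup>2)) * tmom M f"
proof -
  have "tmom M (\<lambda>x. c * f x) \<le> (\<integral>\<^sup>+ x. ennreal (max 1 (c\<^sup>2)) * ennreal (min ((f x)\<^sup>2) 1) \<partial>M)"
    unfolding tmom_def
  proof (rule nn_integral_mono)
    fix x
    have "c\<^sup>2 * (f x)\<^sup>2 \<le> max 1 (c\<^sup>2) * (f x)\<^sup>2" by (intro mult_right_mono) auto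
    then have "min ((c * f x)\<^sup>2) 1 \<le> max 1 (c\<^sup>2) * min ((f x)\<^sup>2) 1"
      by (auto simp: min_def power_mult_distrib)
    then have "ennreal (min ((c * f x)\<^sup>2) 1) \<le> ennreal (max 1 (c\<^sup>2) * min ((f x)\<^sup>2) 1)"
      by (rule ennreal_leI)
    also have "\<dots> = ennreal (max 1 (c\<^sup>2)) * ennreal (min ((f x)\<^sup>2) 1)"
      by (rule ennreal_mult) auto
    finally show "ennreal (min ((c * f x)\<^sup>2) 1) \<le> ennreal (max 1 (c\<^sup>2)) * ennreal (min ((f x)\<^sup>2) 1)" .
  qed
  also have "\<dots> = ennreal (max 1 (c\<^sup>2)) * tmom M f"
    unfolding tmom_def by (simp add: nn_integral_cmult)
  finally show ?thesis .
qed

lemma tmom_0_iff: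
  assumes [measurable]: "f \<in> borel_measurable M"
  shows "tmom M f = 0 \<longleftrightarrow> (AE x in M. f x = 0)"
  unfolding tmom_def by (subst nn_integral_0_iff_AE) (auto simp: min_def ennreal_eq_0_iff)

lemma tmom_Fatou:
  assumes [measurable]: "\<And>k. g k \<in> borel_measurable M" "f \<in> borel_measurable M"
    and lim: "AE x in M. (\<lambda>k. g k x) \<longlonglongrightarrow> f x"
  shows "tmom M f \<le> liminf (\<lambda>k. tmom M (g k))"
proof -
  have "tmom M f = (\<integral>\<^sup>+ x. liminf (\<lambda>k. ennreal (min ((g k x)\<^sup>2) 1)) \<partial>M)"
    unfolding tmom_def
  proof (rule nn_integral_cong_AE)
    show "AE x in M. ennreal (min ((f x)\<^sup>2) 1) = liminf (\<lambda>k. ennreal (min ((g k x)\<^sup>2) 1))"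
      using lim
    proof eventually_elim
      fix x assume "(\<lambda>k. g k x) \<longlonglongrightarrow> f x"
      then have "(\<lambda>k. ennreal (min ((g k x)\<^sup>2) 1)) \<longlonglongrightarrow> ennreal (min ((f x)\<^sup>2) 1)"
        by (intro tendsto_intros)
      then show "ennreal (min ((f x)\<^sup>2) 1) = liminf (\<lambda>k. ennreal (min ((g k x)\<^sup>2) 1))"
        by (rule lim_imp_Liminf[OF trivial_limit_sequentially, symmetric])
    qed
  qed
  also have "\<dots> \<le> liminf (\<lambda>k. tmom M (g k))"
    unfolding tmom_def by (rule nn_integral_liminf) simp
  finally show ?thesis .
qed

lemma tmom_dominated:
  assumes [measurable]: "\<And>k. g k \<in> borel_measurable M" "f \<in> borel_measurable M" "h \<in> borel_measurable M"
    and lim: "AE x in M. (\<lambda>k. g k x) \<longlonglongrightarrow> f x"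
    and bound: "\<And>k. AE x in M. \<bar>g k x - f x\<bar> \<le> \<bar>h x\<bar>"
    and fin: "tmom M h < \<infinity>"
  shows "(\<lambda>k. tmom M (\<lambda>x. g k x - f x)) \<longlonglongrightarrow> 0"
proof -
  have "(\<lambda>k. \<integral>\<^sup>+ x. ennreal (min ((g k x - f x)\<^sup>2) 1) \<partial>M) \<longlonglongrightarrow> (\<integral>\<^sup>+ x. 0 \<partial>M)"
  proof (rule nn_integral_dominated_convergence[where w = "\<lambda>x. ennreal (min ((h x)\<^sup>2) 1)"])
    show "AE x in M. ennreal (min ((g j x - f x)\<^sup>2) 1) \<le> ennreal (min ((h x)\<^sup>2) 1)" for j
      using bound[of j] by eventually_elim (auto intro!: ennreal_leI min.mono simp: abs_le_square_iff)
    show "AE x in M. (\<lambda>k. ennreal (min ((g k x - f x)\<^sup>2) 1)) \<longlonglongrightarrow> 0"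
      using lim
    proof eventually_elim
      fix x assume "(\<lambda>k. g k x) \<longlonglongrightarrow> f x"
      then have "(\<lambda>k. ennreal (min ((g k x - f x)\<^sup>2) 1)) \<longlonglongrightarrow> ennreal (min ((f x - f x)\<^sup>2) 1)"
        by (intro tendsto_intros)
      then show "(\<lambda>k. ennreal (min ((g k x - f x)\<^sup>2) 1)) \<longlonglongrightarrow> 0" by simp
    qed
  qed (use fin in \<open>auto simp: tmom_def\<close>)
  then show ?thesis by (simp add: tmom_def)
qed

lemma (in finite_measure) tmom_tendsto_AE:
  assumes [measurable]: "\<And>k. g k \<in> borel_measurable M" "f \<in> borel_measurable M"
    and lim: "AE x in M. (\<lambda>k. g k x) \<longlonglongrightarrow> f x"
  shows "(\<lambda>k. tmom M (\<lambda>x. g k x - f x)) \<longlonglongrightarrow> 0"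
proof -
  have "(\<lambda>k. \<integral>\<^sup>+ x. ennreal (min ((g k x - f x)\<^sup>2) 1) \<partial>M) \<longlonglongrightarrow> (\<integral>\<^sup>+ x. 0 \<partial>M)"
  proof (rule nn_integral_dominated_convergence[where w = "\<lambda>x. 1"])
    show "AE x in M. (\<lambda>k. ennreal (min ((g k x - f x)\<^sup>2) 1)) \<longlonglongrightarrow> 0"
      using lim
    proof eventually_elim
      fix x assume "(\<lambda>k. g k x) \<longlonglongrightarrow> f x"
      then have "(\<lambda>k. ennreal (min ((g k x - f x)\<^sup>2) 1)) \<longlonglongrightarrow> ennreal (min ((f x - f x)\<^sup>2) 1)"
        by (intro tendsto_intros)
      then show "(\<lambda>k. ennreal (min ((g k x - f x)\<^sup>2) 1)) \<longlonglongrightarrow> 0" by simp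
    qed
    show "(\<integral>\<^sup>+ x. 1 \<partial>M) < \<infinity>" using emeasure_finite[of "space M"] by (simp add: less_top[symmetric])
  qed auto
  then show ?thesis by (simp add: tmom_def)
qed

text \<open>Markov's inequality; since \<open>e \<le> 1\<close>, the truncation at 1 does not hide
  the event \<open>\<bar>f x\<bar> > e\<close>.\<close>

lemma emeasure_gt_le_tmom:
  assumes [measurable]: "f \<in> borel_measurable M" and e: "0 < e" "e \<le> 1"
  shows "emeasure M {x \<in> space M. \<bar>f x\<bar> > e} \<le> ennreal (1 / e\<^sup>2) * tmom M f"
proof -
  have "emeasure M {x \<in> space M. \<bar>f x\<bar> > e} \<le>
    emeasure M {x \<in> space M. 1 \<le> ennreal (1 / e\<^sup>2) * ennreal (min ((f x)\<^sup>2) 1)}"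
  proof (rule emeasure_mono)
    show "{x \<in> space M. \<bar>f x\<bar> > e} \<subseteq> {x \<in> space M. 1 \<le> ennreal (1 / e\<^sup>2) * ennreal (min ((f x)\<^sup>2) 1)}"
    proof safe
      fix x assume "e < \<bar>f x\<bar>"
      then have "e\<^sup>2 \<le> min ((f x)\<^sup>2) 1"
        using e abs_le_square_iff[of e "f x"] by (auto simp: power_le_one)
      then have "1 \<le> 1 / e\<^sup>2 * min ((f x)\<^sup>2) 1" using e by (simp add: field_simps)
      then show "1 \<le> ennreal (1 / e\<^sup>2) * ennreal (min ((f x)\<^sup>2) 1)"
        by (subst ennreal_mult[symmetric]) auto
    qed
  qed measurable
  also have "\<dots> \<le> ennreal (1 / e\<^sup>2) * (\<integral>\<^sup>+ x. ennreal (min ((f x)\<^sup>2) 1) * indicator (space M) x \<partial>M)"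
    using nn_integral_Markov_inequality[of "\<lambda>x. ennreal (min ((f x)\<^sup>2) 1)" "space M" M "ennreal (1 / e\<^sup>2)"] by simp
  also have "(\<integral>\<^sup>+ x. ennreal (min ((f x)\<^sup>2) 1) * indicator (space M) x \<partial>M) = tmom M f"
    unfolding tmom_def by (intro nn_integral_cong) auto
  finally show ?thesis .
qed

lemma tendsto_0_le_ennreal:
  fixes f g :: "nat \<Rightarrow> ennreal"
  assumes "\<And>k. f k \<le> g k" "g \<longlonglongrightarrow> 0"
  shows "f \<longlonglongrightarrow> 0"
  by (rule tendsto_sandwich[of "\<lambda>_. 0" f sequentially g 0]) (use assms in auto)

lemma tendsto_0_cmult_ennreal:
  fixes f :: "nat \<Rightarrow> ennreal"
  assumes "f \<longlonglongrightarrow> 0" "c < \<infinity>"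
  shows "(\<lambda>k. c * f k) \<longlonglongrightarrow> 0"
  using ennreal_tendsto_cmult[OF _ assms(1), of c] assms(2) by (simp add: top.not_eq_extremum)

lemma (in prob_space) conv_in_prob_iff_tmom:
  "conv_in_prob M Z Y \<longleftrightarrow> (\<forall>k. Z k \<in> borel_measurable M) \<and> Y \<in> borel_measurable M \<and>
     (\<lambda>k. tmom M (\<lambda>\<omega>. Z k \<omega> - Y \<omega>)) \<longlonglongrightarrow> 0" (is "?L \<longleftrightarrow> ?R")
proof
  assume L: ?L
  then have [measurable]: "\<And>k. Z k \<in> borel_measurable M" "Y \<in> borel_measurable M"
    unfolding conv_in_prob_def by auto
  have "(\<lambda>k. tmom M (\<lambda>\<omega>. Z k \<omega> - Y \<omega>)) \<longlonglongrightarrow> 0"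
  proof (rule order_tendstoI)
    fix a :: ennreal assume "0 < a"
    then obtain b where b: "0 < b" "ennreal b < a"
      by (metis dense ennreal_cases ennreal_less_zero_iff infinity_ennreal_def less_top_ennreal top.not_eq_extremum order.strict_trans less_top)
    \<comment> \<open>Deviations of size at most \<open>e\<close> contribute at most
      \<open>e^2 \<le> b / 2\<close> to the truncated moment, and the remaining event contributes at
      most its probability, eventually below \<open>b / 2\<close>.\<close>
    define e where "e = min 1 (sqrt (b / 2))"
    have e: "e > 0" "e\<^sup>2 \<le> b / 2" using b by (auto simp: e_def min_def)
    have "(\<lambda>k. measure M {\<omega> \<in> space M. \<bar>Z k \<omega> - Y \<omega>\<bar> > e}) \<longlonglongrightarrow> 0"
      using L e unfolding conv_in_prob_def by auto
    then have "\<forall>\<^sub>F k in sequentially. measure M {\<omega> \<in> space M. \<bar>Z k \<omega> - Y \<omega>\<bar> > e} < b / 2"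
      by (rule order_tendstoD) (use b in auto)
    then show "\<forall>\<^sub>F k in sequentially. tmom M (\<lambda>\<omega>. Z k \<omega> - Y \<omega>) < a"
    proof eventually_elim
      fix k assume k: "measure M {\<omega> \<in> space M. \<bar>Z k \<omega> - Y \<omega>\<bar> > e} < b / 2"
      have "tmom M (\<lambda>\<omega>. Z k \<omega> - Y \<omega>) \<le>
        (\<integral>\<^sup>+ \<omega>. ennreal (e\<^sup>2) + indicator {\<omega> \<in> space M. \<bar>Z k \<omega> - Y \<omega>\<bar> > e} \<omega> \<partial>M)"
        unfolding tmom_def
      proof (rule nn_integral_mono)
        fix \<omega> assume w: "\<omega> \<in> space M"
        show "ennreal (min ((Z k \<omega> - Y \<omega>)\<^sup>2) 1) \<le> ennreal (e\<^sup>2) + indicator {\<omega> \<in> space M. \<bar>Z k \<omega> - Y \<omega>\<bar> > e} \<omega>"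
        proof (cases "\<bar>Z k \<omega> - Y \<omega>\<bar> > e")
          case True
          have "ennreal (min ((Z k \<omega> - Y \<omega>)\<^sup>2) 1) \<le> ennreal 1" by (rule ennreal_leI) auto
          also have "\<dots> \<le> ennreal (e\<^sup>2) + 1" by simp
          finally show ?thesis using True w by simp
        next
          case False
          then have "(Z k \<omega> - Y \<omega>)\<^sup>2 \<le> e\<^sup>2" using e abs_le_square_iff[of "Z k \<omega> - Y \<omega>" e] by auto
          then have "ennreal (min ((Z k \<omega> - Y \<omega>)\<^sup>2) 1) \<le> ennreal (e\<^sup>2)" by (intro ennreal_leI) auto
          then show ?thesis by (simp add: add_increasing2)
        qed
      qed
      also have "\<dots> = ennreal (e\<^sup>2) + emeasure M {\<omega> \<in> space M. \<bar>Z k \<omega> - Y \<omega>\<bar> > e}"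
        by (subst nn_integral_add) (auto simp: emeasure_space_1)
      also have "\<dots> = ennreal (e\<^sup>2 + measure M {\<omega> \<in> space M. \<bar>Z k \<omega> - Y \<omega>\<bar> > e})"
        by (simp add: emeasure_eq_measure)
      also have "\<dots> \<le> ennreal b" using e k by (intro ennreal_leI) auto
      finally show "tmom M (\<lambda>\<omega>. Z k \<omega> - Y \<omega>) < a" using b by simp
    qed
  qed auto
  then show ?R by simp
next
  assume R: ?R
  then have [measurable]: "\<And>k. Z k \<in> borel_measurable M" "Y \<in> borel_measurable M" by auto
  have "(\<lambda>k. measure M {\<omega> \<in> space M. \<bar>Z k \<omega> - Y \<omega>\<bar> > e}) \<longlonglongrightarrow> 0" if "e > 0" for e
  proof -
    define d where "d = min e 1"
    have d: "0 < d" "d \<le> 1" "d \<le> e" using that by (auto simp: d_def)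
    have "(\<lambda>k. ennreal (measure M {\<omega> \<in> space M. \<bar>Z k \<omega> - Y \<omega>\<bar> > e})) \<longlonglongrightarrow> 0"
    proof (rule tendsto_0_le_ennreal)
      fix k
      have "ennreal (measure M {\<omega> \<in> space M. \<bar>Z k \<omega> - Y \<omega>\<bar> > e}) \<le> emeasure M {\<omega> \<in> space M. \<bar>Z k \<omega> - Y \<omega>\<bar> > d}"
        unfolding emeasure_eq_measure[symmetric] by (rule emeasure_mono) (use d in auto)
      also have "\<dots> \<le> ennreal (1 / d\<^sup>2) * tmom M (\<lambda>\<omega>. Z k \<omega> - Y \<omega>)"
        by (rule emeasure_gt_le_tmom) (use d in auto)
      finally show "ennreal (measure M {\<omega> \<in> space M. \<bar>Z k \<omega> - Y \<omega>\<bar> > e}) \<le> ennreal (1 / d\<^sup>2) * tmom M (\<lambda>\<omega>. Z k \<omega> - Y \<omega>)" .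
    next
      show "(\<lambda>k. ennreal (1 / d\<^sup>2) * tmom M (\<lambda>\<omega>. Z k \<omega> - Y \<omega>)) \<longlonglongrightarrow> 0"
        by (rule tendsto_0_cmult_ennreal) (use R in auto)
    qed
    then show ?thesis by (simp flip: ennreal_0)
  qed
  then show ?L unfolding conv_in_prob_def by auto
qed

text \<open>The Riesz-Fischer argument: a rapidly Cauchy subsequence converges almost surely by
  Borel-Cantelli, and Fatou's lemma bounds the distance of the whole sequence from its
  limit.\<close>

lemma (in prob_space) tmom_complete:
  fixes Z :: "nat \<Rightarrow> 'a \<Rightarrow> real"
  assumes [measurable]: "\<And>k. Z k \<in> borel_measurable M"
    and Cauchy: "\<And>e. 0 < e \<Longrightarrow> \<exists>K. \<forall>k\<ge>K. \<forall>l\<ge>K. tmom M (\<lambda>\<omega>. Z k \<omega> - Z l \<omega>) \<le> ennreal e"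
  shows "\<exists>Y \<in> borel_measurable M. (\<lambda>k. tmom M (\<lambda>\<omega>. Z k \<omega> - Y \<omega>)) \<longlonglongrightarrow> 0"
proof -
  \<comment> \<open>The rate 1/8 leaves a summable bound: Markov's inequality at the threshold
    \<open>(1/2)^m\<close> costs a factor \<open>4^m\<close>, so that \<open>(1/2)^m\<close>
    remains.\<close>
  obtain K where K: "\<And>m k l. k \<ge> K m \<Longrightarrow> l \<ge> K m \<Longrightarrow> tmom M (\<lambda>\<omega>. Z k \<omega> - Z l \<omega>) \<le> ennreal ((1/8)^m)"
    using Cauchy[of "(1/8)^_"] by (metis zero_less_power zero_less_divide_1_iff zero_less_numeral)
  \<comment> \<open>The maximum makes \<open>r n\<close> exceed \<open>K m\<close> for every
    \<open>m \<le> n\<close>, although \<open>K\<close> itself may fail to be monotone.\<close>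
  define r where "r m = m + Max (K ` {..m})" for m
  have rK: "r n \<ge> K m" if "m \<le> n" for m n
    unfolding r_def using that by (intro trans_le_add2 Max_ge) auto
  have rn: "r n \<ge> n" for n by (simp add: r_def)
  define A where "A m = {\<omega> \<in> space M. \<bar>Z (r (Suc m)) \<omega> - Z (r m) \<omega>\<bar> > (1/2)^m}" for m
  have [measurable]: "A m \<in> sets M" for m unfolding A_def by measurable
  have A_le: "measure M (A m) \<le> (1/2)^m" for m
  proof -
    have "ennreal (measure M (A m)) \<le> ennreal (1 / ((1/2)^m)\<^sup>2) * tmom M (\<lambda>\<omega>. Z (r (Suc m)) \<omega> - Z (r m) \<omega>)"
      unfolding A_def emeasure_eq_measure[symmetric]
      by (rule emeasure_gt_le_tmom) (auto simp: power_le_one)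
    also have "\<dots> \<le> ennreal (1 / ((1/2)^m)\<^sup>2) * ennreal ((1/8)^m)"
      by (intro mult_left_mono K rK) auto
    also have "\<dots> = ennreal (1 / ((1/2)^m)\<^sup>2 * (1/8)^m)" by (rule ennreal_mult[symmetric]) auto
    also have "1 / ((1/2)^m)\<^sup>2 * (1/8)^m = (1/2::real)^m"
    proof -
      have "(8::real)^m = 2^m * (2^m)\<^sup>2" by (simp add: power2_eq_square flip: power_mult_distrib)
      then show ?thesis by (simp add: power_divide)
    qed
    finally show ?thesis by (simp add: ennreal_le_iff)
  qed
  have "AE \<omega> in M. eventually (\<lambda>m. \<omega> \<in> space M - A m) sequentially"
    by (rule borel_cantelli_AE1)
       (auto simp: less_top[symmetric] intro!: summable_comparison_test'[OF summable_geometric[of "1/2::real"]] A_le)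
  then have conv: "AE \<omega> in M. convergent (\<lambda>m. Z (r m) \<omega>)"
  proof eventually_elim
    fix \<omega> assume "eventually (\<lambda>m. \<omega> \<in> space M - A m) sequentially"
    then have ev: "\<forall>\<^sub>F m in sequentially. norm (Z (r (Suc m)) \<omega> - Z (r m) \<omega>) \<le> (1/2)^m"
      by eventually_elim (auto simp: A_def)
    have "summable (\<lambda>m. Z (r (Suc m)) \<omega> - Z (r m) \<omega>)"
      by (rule summable_comparison_test_ev[OF ev summable_geometric]) auto
    then have "convergent (\<lambda>n. \<Sum>m<n. Z (r (Suc m)) \<omega> - Z (r m) \<omega>)"
      by (simp add: summable_iff_convergent)
    then have "convergent (\<lambda>n. Z (r n) \<omega> - Z (r 0) \<omega>)" using sum_lessThan_telescope[of "\<lambda>m. Z (r m) \<omega>"] by simp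
    then show "convergent (\<lambda>m. Z (r m) \<omega>)"
      using convergent_diff_const_right_iff[of "\<lambda>m. Z (r m) \<omega>" "Z (r 0) \<omega>"] by simp
  qed
  define Y where "Y \<omega> = lim (\<lambda>m. Z (r m) \<omega>)" for \<omega>
  have [measurable]: "Y \<in> borel_measurable M" unfolding Y_def by measurable
  have lim: "AE \<omega> in M. (\<lambda>m. Z (r m) \<omega>) \<longlonglongrightarrow> Y \<omega>"
    using conv by eventually_elim (simp add: Y_def convergent_LIMSEQ_iff)
  have bound: "tmom M (\<lambda>\<omega>. Z k \<omega> - Y \<omega>) \<le> ennreal ((1/8)^m)" if "k \<ge> K m" for k m
  proof -
    have "tmom M (\<lambda>\<omega>. Z k \<omega> - Y \<omega>) \<le> liminf (\<lambda>l. tmom M (\<lambda>\<omega>. Z k \<omega> - Z (r l) \<omega>))"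
      by (rule tmom_Fatou) (use lim in \<open>auto elim!: eventually_mono intro!: tendsto_intros\<close>)
    also have "\<dots> \<le> liminf (\<lambda>l. ennreal ((1/8)^m))"
      by (rule Liminf_mono) (use K[OF that] rK[of m] in \<open>auto simp: eventually_sequentially intro!: exI[of _ m]\<close>)
    also have "\<dots> = ennreal ((1/8)^m)" by (rule Liminf_const) simp
    finally show ?thesis .
  qed
  have "(\<lambda>k. tmom M (\<lambda>\<omega>. Z k \<omega> - Y \<omega>)) \<longlonglongrightarrow> 0"
  proof (rule order_tendstoI)
    fix a :: ennreal assume a: "0 < a"
    have "(\<lambda>m. ennreal ((1/8)^m)) \<longlonglongrightarrow> ennreal 0"
      by (intro tendsto_ennrealI LIMSEQ_power_zero) auto
    then have "\<forall>\<^sub>F m in sequentially. ennreal ((1/8)^m) < a"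
      by (rule order_tendstoD) (use a in auto)
    then obtain m where "ennreal ((1/8)^m) < a" by (auto simp: eventually_sequentially)
    then show "\<forall>\<^sub>F k in sequentially. tmom M (\<lambda>\<omega>. Z k \<omega> - Y \<omega>) < a"
      unfolding eventually_sequentially using bound order.strict_trans1 by blast
  qed auto
  then show ?thesis by auto
qed

section \<open>Poisson random measures\<close>

locale poisson_measure = prob_space M for M :: "'w measure" +
  fixes N :: "'c measure" and J :: "'w \<Rightarrow> 'c measure"
  assumes prm: "poisson_random_measure M N J"
begin

lemmas prm_conjs =
  prm[unfolded poisson_random_measure_def, THEN conjunct1]
  prm[unfolded poisson_random_measure_def, THEN conjunct2, THEN conjunct1]
  prm[unfolded poisson_random_measure_def, THEN conjunct2, THEN conjunct2, THEN conjunct1]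
  prm[unfolded poisson_random_measure_def, THEN conjunct2, THEN conjunct2, THEN conjunct2, THEN conjunct1]
  prm[unfolded poisson_random_measure_def, THEN conjunct2, THEN conjunct2, THEN conjunct2, THEN conjunct2, THEN conjunct1]
  prm[unfolded poisson_random_measure_def, THEN conjunct2, THEN conjunct2, THEN conjunct2, THEN conjunct2, THEN conjunct2]

lemma sets_J: "\<omega> \<in> space M \<Longrightarrow> sets (J \<omega>) = sets N"
  using prm_conjs(1) by blast

lemma space_J: "\<omega> \<in> space M \<Longrightarrow> space (J \<omega>) = space N"
  using sets_J sets_eq_imp_space_eq by blast

lemma borel_measurable_J: "\<omega> \<in> space M \<Longrightarrow> borel_measurable (J \<omega>) = borel_measurable N"
  using sets_J by (intro measurable_cong_sets) auto

lemma emeasure_J_measurable [measurable]: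
  "B \<in> sets N \<Longrightarrow> (\<lambda>\<omega>. emeasure (J \<omega>) B) \<in> borel_measurable M"
  using prm_conjs(3) by blast

lemma emeasure_J_cases:
  assumes "\<omega> \<in> space M" "B \<in> sets N"
  obtains "emeasure (J \<omega>) B = \<infinity>" | k where "emeasure (J \<omega>) B = of_nat k"
  using prm_conjs(2) assms by blast

lemma poisson_prob:
  "B \<in> sets N \<Longrightarrow> emeasure N B < \<infinity> \<Longrightarrow>
   measure M {\<omega> \<in> space M. emeasure (J \<omega>) B = of_nat k} = exp (- measure N B) * measure N B ^ k / fact k"
  by (rule prm_conjs(4)[rule_format])

lemma indep_J:
  "finite (I :: nat set) \<Longrightarrow> (\<And>i. i \<in> I \<Longrightarrow> B i \<in> sets N) \<Longrightarrow> disjoint_family_on B I \<Longrightarrow>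
   indep_vars (\<lambda>_. borel) (\<lambda>i \<omega>. emeasure (J \<omega>) (B i)) I"
  by (rule prm_conjs(6)[rule_format]) blast

text \<open>A version of the number of jumps with values in the natural numbers, so that its law is
  a sum over a countable space. On the event of infinitely many jumps its value is 0, by the
  convention for \<open>enn2real\<close>.\<close>

definition count :: "'c set \<Rightarrow> 'w \<Rightarrow> nat" where
  "count B \<omega> = nat \<lfloor>enn2real (emeasure (J \<omega>) B)\<rfloor>"

lemma count_measurable [measurable]:
  "B \<in> sets N \<Longrightarrow> count B \<in> measurable M (count_space UNIV)"
  unfolding count_def[abs_def] by measurable

lemma poisson_sums: "(\<lambda>k. exp (- l) * l ^ k / fact k) sums (1::real)"
proof -
  have "(\<lambda>k. exp (- l) * (l ^ k / fact k)) sums (exp (- l) * exp l)"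
    by (intro sums_mult) (use exp_converges[of l] in \<open>simp add: field_simps\<close>)
  then show ?thesis by (simp flip: exp_add)
qed

text \<open>The Poisson weights of the finite values already add up to 1, which leaves probability 0
  for the value \<open>\<infinity>\<close>.\<close>

lemma AE_J_eq_count:
  assumes [measurable]: "B \<in> sets N" and fin: "emeasure N B < \<infinity>"
  shows "AE \<omega> in M. emeasure (J \<omega>) B = of_nat (count B \<omega>)"
proof -
  let ?A = "\<lambda>k::nat. {\<omega> \<in> space M. emeasure (J \<omega>) B = of_nat k}"
  have dis: "disjoint_family ?A"
    by (auto simp: disjoint_family_on_def)
  have "(\<lambda>k. measure M (?A k)) sums measure M (\<Union>k. ?A k)"
    by (rule finite_measure_UNION) (use dis in auto)
  moreover have "(\<lambda>k. measure M (?A k)) sums 1"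
    unfolding poisson_prob[OF assms] by (rule poisson_sums)
  ultimately have "measure M (\<Union>k. ?A k) = 1" by (rule sums_unique2)
  then have "AE \<omega> in M. \<omega> \<in> (\<Union>k. ?A k)"
    by (subst AE_in_set_eq_1) auto
  then show ?thesis
  proof eventually_elim
    fix \<omega> assume "\<omega> \<in> (\<Union>k. ?A k)"
    then show "emeasure (J \<omega>) B = of_nat (count B \<omega>)"
      by (auto simp: count_def ennreal_of_nat_eq_real_of_nat)
  qed
qed

lemma AE_J_finite:
  assumes "B \<in> sets N" "emeasure N B < \<infinity>"
  shows "AE \<omega> in M. emeasure (J \<omega>) B < \<infinity>"
  using AE_J_eq_count[OF assms] by eventually_elim (simp add: of_nat_less_top)

lemma distr_count:
  assumes [measurable]: "B \<in> sets N" and fin: "emeasure N B < \<infinity>"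
  shows "distr M (count_space UNIV) (count B) =
    density (count_space UNIV) (\<lambda>k. ennreal (exp (- measure N B) * measure N B ^ k / fact k))"
proof (rule measure_eqI_countable[where A = UNIV])
  fix k :: nat
  have "emeasure (distr M (count_space UNIV) (count B)) {k} = emeasure M {\<omega> \<in> space M. count B \<omega> = k}"
    by (subst emeasure_distr) (auto intro!: arg_cong[of _ _ "emeasure M"])
  also have "\<dots> = emeasure M {\<omega> \<in> space M. emeasure (J \<omega>) B = of_nat k}"
    by (rule emeasure_eq_AE) (use AE_J_eq_count[OF assms] in \<open>auto elim!: eventually_mono\<close>)
  also have "\<dots> = ennreal (exp (- measure N B) * measure N B ^ k / fact k)"
    unfolding emeasure_eq_measure poisson_prob[OF assms] ..
  also have "\<dots> = emeasure (density (count_space UNIV) (\<lambda>k. ennreal (exp (- measure N B) * measure N B ^ k / fact k))) {k}"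
    by (subst emeasure_density) (auto simp: nn_integral_count_space_indicator[symmetric] nn_integral_count_space_finite)
  finally show "emeasure (distr M (count_space UNIV) (count B)) {k} = \<dots>" .
qed auto

lemma nn_integral_J_set:
  assumes [measurable]: "B \<in> sets N"
  shows "(\<integral>\<^sup>+ \<omega>. emeasure (J \<omega>) B \<partial>M) = emeasure N B"
proof (cases "emeasure N B < \<infinity>")
  case True
  let ?l = "measure N B" and ?p = "\<lambda>k::nat. exp (- measure N B) * measure N B ^ k / fact k"
  have "(\<lambda>k. real k * ?p k) sums ?l"
  proof -
    \<comment> \<open>The Poisson mean by an index shift:
      \<open>(k + 1) * p (k + 1) = l * p k\<close>, and the term for 0 vanishes.\<close>
    have "(\<lambda>k. real (Suc k) * ?p (Suc k)) sums ?l"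
    proof -
      have "(\<lambda>k. ?l * ?p k) sums (?l * 1)" by (intro sums_mult poisson_sums)
      moreover have "real (Suc k) * ?p (Suc k) = ?l * ?p k" for k
        by (simp add: field_simps del: of_nat_Suc)
      ultimately show ?thesis by (simp only: mult_1_right)
    qed
    then show ?thesis using sums_Suc_iff[of "\<lambda>k. real k * ?p k" ?l] by simp
  qed
  then have suminf: "(\<Sum>k. ennreal (real k * ?p k)) = ennreal ?l"
    by (intro suminf_ennreal_eq) auto
  have "(\<integral>\<^sup>+ \<omega>. emeasure (J \<omega>) B \<partial>M) = (\<integral>\<^sup>+ \<omega>. of_nat (count B \<omega>) \<partial>M)"
    by (rule nn_integral_cong_AE) (rule AE_J_eq_count[OF assms True])
  also have "\<dots> = (\<integral>\<^sup>+ k. of_nat k \<partial>distr M (count_space UNIV) (count B))"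
    by (subst nn_integral_distr) auto
  also have "\<dots> = (\<Sum>k. ennreal (?p k) * of_nat k)"
    unfolding distr_count[OF assms True]
    by (subst nn_integral_density) (auto simp: nn_integral_count_space_nat)
  also have "\<dots> = ennreal ?l"
    unfolding suminf[symmetric]
    by (rule arg_cong[of _ _ suminf]) (auto simp: ennreal_of_nat_eq_real_of_nat ennreal_mult[symmetric] mult.commute simp del: times_divide_eq_left)
  also have "\<dots> = emeasure N B" using True by (simp add: emeasure_eq_ennreal_measure top.not_eq_extremum)
  finally show ?thesis .
next
  case False
  then have inf: "emeasure N B = \<infinity>" by (simp add: less_top[symmetric])
  then have "AE \<omega> in M. emeasure (J \<omega>) B = \<infinity>"
    by (rule prm_conjs(5)[rule_format, OF assms])
  then have "(\<integral>\<^sup>+ \<omega>. emeasure (J \<omega>) B \<partial>M) = (\<integral>\<^sup>+ \<omega>. \<infinity> \<partial>M)" by (rule nn_integral_cong_AE)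
  then show ?thesis by (simp add: inf emeasure_space_1)
qed

text \<open>Campbell's formula. Measurability and the value are proved in one induction because the
  steps for sums and limits interchange operations under the integral over \<open>M\<close> and
  hence need the measurability of the earlier stages.\<close>

lemma
  fixes h :: "'c \<Rightarrow> ennreal"
  assumes "h \<in> borel_measurable N"
  shows nn_integral_J_measurable [measurable]: "(\<lambda>\<omega>. \<integral>\<^sup>+ x. h x \<partial>J \<omega>) \<in> borel_measurable M"
    and nn_integral_J: "(\<integral>\<^sup>+ \<omega>. (\<integral>\<^sup>+ x. h x \<partial>J \<omega>) \<partial>M) = (\<integral>\<^sup>+ x. h x \<partial>N)"
proof -
  have "(\<lambda>\<omega>. \<integral>\<^sup>+ x. h x \<partial>J \<omega>) \<in> borel_measurable M \<and>
    (\<integral>\<^sup>+ \<omega>. (\<integral>\<^sup>+ x. h x \<partial>J \<omega>) \<partial>M) = (\<integral>\<^sup>+ x. h x \<partial>N)"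
    using assms
  proof (induction rule: borel_measurable_induct)
    case (cong f g)
    have "(\<integral>\<^sup>+ x. f x \<partial>J \<omega>) = (\<integral>\<^sup>+ x. g x \<partial>J \<omega>)" if "\<omega> \<in> space M" for \<omega>
      by (rule nn_integral_cong) (use cong that in \<open>simp add: space_J\<close>)
    moreover have "(\<integral>\<^sup>+ x. f x \<partial>N) = (\<integral>\<^sup>+ x. g x \<partial>N)"
      by (rule nn_integral_cong) (use cong in simp)
    ultimately show ?case using cong.IH 
      by (simp cong: measurable_cong nn_integral_cong)
  next
    case (set A)
    have "(\<integral>\<^sup>+ x. indicator A x \<partial>J \<omega>) = emeasure (J \<omega>) A" if "\<omega> \<in> space M" for \<omega>
      using set that by (simp add: sets_J)
    then show ?case using set by (simp add: nn_integral_J_set cong: measurable_cong nn_integral_cong)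
  next
    case (mult u c)
    have "(\<integral>\<^sup>+ x. c * u x \<partial>J \<omega>) = c * (\<integral>\<^sup>+ x. u x \<partial>J \<omega>)" if "\<omega> \<in> space M" for \<omega>
      using mult that by (simp add: nn_integral_cmult borel_measurable_J)
    moreover have [measurable]: "(\<lambda>\<omega>. \<integral>\<^sup>+ x. u x \<partial>J \<omega>) \<in> borel_measurable M" using mult by simp
    have "(\<lambda>\<omega>. c * (\<integral>\<^sup>+ x. u x \<partial>J \<omega>)) \<in> borel_measurable M" by measurable
    ultimately show ?case using mult
      by (simp add: nn_integral_cmult cong: measurable_cong nn_integral_cong)
  next
    case (add u v)
    have "(\<integral>\<^sup>+ x. v x + u x \<partial>J \<omega>) = (\<integral>\<^sup>+ x. v x \<partial>J \<omega>) + (\<integral>\<^sup>+ x. u x \<partial>J \<omega>)" if "\<omega> \<in> space M" for \<omega>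
      using add that by (simp add: nn_integral_add borel_measurable_J)
    moreover have [measurable]: "(\<lambda>\<omega>. \<integral>\<^sup>+ x. u x \<partial>J \<omega>) \<in> borel_measurable M" "(\<lambda>\<omega>. \<integral>\<^sup>+ x. v x \<partial>J \<omega>) \<in> borel_measurable M" using add by auto
    have "(\<lambda>\<omega>. (\<integral>\<^sup>+ x. v x \<partial>J \<omega>) + (\<integral>\<^sup>+ x. u x \<partial>J \<omega>)) \<in> borel_measurable M" by measurable
    ultimately show ?case using add by (simp add: nn_integral_add cong: measurable_cong nn_integral_cong)
  next
    case (seq U)
    have *: "(\<integral>\<^sup>+ x. (SUP i. U i) x \<partial>J \<omega>) = (SUP i. \<integral>\<^sup>+ x. U i x \<partial>J \<omega>)" if "\<omega> \<in> space M" for \<omega>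
      using seq that unfolding SUP_apply by (intro nn_integral_monotone_convergence_SUP) (auto simp: borel_measurable_J)
    have inc: "incseq (\<lambda>i \<omega>. \<integral>\<^sup>+ x. U i x \<partial>J \<omega>)"
      using seq.hyps by (auto simp: incseq_def le_fun_def intro!: nn_integral_mono)
    have "(\<integral>\<^sup>+ \<omega>. (\<integral>\<^sup>+ x. (SUP i. U i) x \<partial>J \<omega>) \<partial>M) = (\<integral>\<^sup>+ \<omega>. (SUP i. \<integral>\<^sup>+ x. U i x \<partial>J \<omega>) \<partial>M)"
      by (intro nn_integral_cong *)
    also have "\<dots> = (SUP i. \<integral>\<^sup>+ \<omega>. (\<integral>\<^sup>+ x. U i x \<partial>J \<omega>) \<partial>M)"
      using seq inc by (intro nn_integral_monotone_convergence_SUP) auto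
    also have "\<dots> = (SUP i. \<integral>\<^sup>+ x. U i x \<partial>N)" using seq by simp
    also have "\<dots> = (\<integral>\<^sup>+ x. (SUP i. U i) x \<partial>N)"
      using seq unfolding SUP_apply by (intro nn_integral_monotone_convergence_SUP[symmetric]) auto
    finally have 2: "(\<integral>\<^sup>+ \<omega>. (\<integral>\<^sup>+ x. (SUP i. U i) x \<partial>J \<omega>) \<partial>M) = (\<integral>\<^sup>+ x. (SUP i. U i) x \<partial>N)" .
    have "(\<lambda>\<omega>. SUP i. \<integral>\<^sup>+ x. U i x \<partial>J \<omega>) \<in> borel_measurable M"
      using seq by (intro borel_measurable_SUP) auto
    then have "(\<lambda>\<omega>. \<integral>\<^sup>+ x. (SUP i. U i) x \<partial>J \<omega>) \<in> borel_measurable M"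
      by (subst measurable_cong[OF *]) auto
    with 2 show ?case by blast
  qed
  then show "(\<lambda>\<omega>. \<integral>\<^sup>+ x. h x \<partial>J \<omega>) \<in> borel_measurable M"
    "(\<integral>\<^sup>+ \<omega>. (\<integral>\<^sup>+ x. h x \<partial>J \<omega>) \<partial>M) = (\<integral>\<^sup>+ x. h x \<partial>N)" by auto
qed

section \<open>Pathwise integrals against the jump measure\<close>

definition Jint :: "('c \<Rightarrow> real) \<Rightarrow> 'w \<Rightarrow> real" where
  "Jint h \<omega> = (\<integral>x. h x \<partial>J \<omega>)"

lemma Jint_measurable [measurable]:
  assumes [measurable]: "h \<in> borel_measurable N"
  shows "Jint h \<in> borel_measurable M"
proof -
  \<comment> \<open>The case distinction reproduces the default value 0 of the Bochner integral:
    without it, an infinite positive part would be read as 0 by \<open>enn2real\<close> and the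
    negative part would remain.\<close>
  have "Jint h \<omega> = (if (\<integral>\<^sup>+ x. ennreal \<bar>h x\<bar> \<partial>J \<omega>) < \<infinity>
      then enn2real (\<integral>\<^sup>+ x. ennreal (h x) \<partial>J \<omega>) - enn2real (\<integral>\<^sup>+ x. ennreal (- h x) \<partial>J \<omega>) else 0)"
    if w: "\<omega> \<in> space M" for \<omega>
  proof (cases "integrable (J \<omega>) h")
    case True
    then show ?thesis unfolding Jint_def
      by (subst real_lebesgue_integral_def) (auto simp: integrable_iff_bounded)
  next
    case False
    then have "\<not> (\<integral>\<^sup>+ x. ennreal \<bar>h x\<bar> \<partial>J \<omega>) < \<infinity>"
      using w by (simp add: integrable_iff_bounded borel_measurable_J)
    with False show ?thesis unfolding Jint_def by (simp add: not_integrable_integral_eq)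
  qed
  then show ?thesis by (subst measurable_cong) auto
qed

text \<open>By Campbell's formula \<open>min \<bar>h\<bar> 1\<close> is integrable against almost
  every \<open>J \<omega>\<close>. What remains are the large values of \<open>h\<close>, and these
  are bounded along the jumps: the sets \<open>?B' n\<close> decrease to the empty set inside a set
  of finite mass, and integer masses that tend to 0 are eventually 0. This avoids representing
  \<open>J \<omega>\<close> as a sum of point masses.\<close>

lemma AE_J_integrable:
  assumes [measurable]: "h \<in> borel_measurable N" and fin: "(\<integral>\<^sup>+ x. ennreal (min \<bar>h x\<bar> 1) \<partial>N) < \<infinity>"
  shows "AE \<omega> in M. integrable (J \<omega>) h"
proof -
  let ?B = "{x \<in> space N. 1 < \<bar>h x\<bar>}"
  let ?B' = "\<lambda>n::nat. {x \<in> space N. real n < \<bar>h x\<bar> \<and> 1 < \<bar>h x\<bar>}"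
  have "AE \<omega> in M. (\<integral>\<^sup>+ x. ennreal (min \<bar>h x\<bar> 1) \<partial>J \<omega>) \<noteq> \<infinity>"
    by (rule nn_integral_noteq_infinite) (use fin in \<open>auto simp: nn_integral_J\<close>)
  then show ?thesis
    using AE_space
  proof eventually_elim
    fix \<omega> assume fin: "(\<integral>\<^sup>+ x. ennreal (min \<bar>h x\<bar> 1) \<partial>J \<omega>) \<noteq> \<infinity>" and w: "\<omega> \<in> space M"
    note sets_J[OF w, measurable_cong] space_J[OF w, simp]
    have "emeasure (J \<omega>) ?B = (\<integral>\<^sup>+ x. indicator ?B x \<partial>J \<omega>)" by simp
    also have "\<dots> \<le> (\<integral>\<^sup>+ x. ennreal (min \<bar>h x\<bar> 1) \<partial>J \<omega>)"
      by (rule nn_integral_mono) (auto simp: indicator_def)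
    finally have B: "emeasure (J \<omega>) ?B < \<infinity>"
      using fin by (simp add: less_top order.strict_trans1)
    have "(\<lambda>n. emeasure (J \<omega>) (?B' n)) \<longlonglongrightarrow> emeasure (J \<omega>) (\<Inter>n. ?B' n)"
    proof (rule Lim_emeasure_decseq)
      show "emeasure (J \<omega>) (?B' n) \<noteq> \<infinity>" for n
        using order.strict_trans1[OF emeasure_mono[of "?B' n" ?B "J \<omega>"] B] by force
    qed (auto simp: decseq_def)
    also have "(\<Inter>n. ?B' n) = {}"
    proof -
      have "\<exists>n. \<not> real n < \<bar>h x\<bar>" for x using real_arch_simple[of "\<bar>h x\<bar>"] by (auto simp: not_less)
      then show ?thesis by blast
    qed
    finally have "\<forall>\<^sub>F n in sequentially. emeasure (J \<omega>) (?B' n) < 1"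
      by (intro order_tendstoD) auto
    then obtain n where n: "emeasure (J \<omega>) (?B' n) < 1" by (auto simp: eventually_sequentially)
    \<comment> \<open>a measure with integer values that gives mass less than 1 gives mass 0\<close>
    have "emeasure (J \<omega>) (?B' n) = 0"
      by (rule emeasure_J_cases[OF w, of "?B' n"]) (use n in \<open>auto simp: less_top\<close>)
    then have "AE x in J \<omega>. x \<notin> ?B' n"
      by (intro AE_I[of _ _ "?B' n"]) auto
    then have ae: "AE x in J \<omega>. ennreal \<bar>h x\<bar> \<le> ennreal (real n + 1) * ennreal (min \<bar>h x\<bar> 1)"
      using AE_space
    proof eventually_elim
      fix x assume "x \<notin> ?B' n" "x \<in> space (J \<omega>)"
      then have "\<bar>h x\<bar> \<le> (real n + 1) * min \<bar>h x\<bar> 1"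
        by (auto simp: min_def mult_le_cancel_right1 not_less algebra_simps)
      then have "ennreal \<bar>h x\<bar> \<le> ennreal ((real n + 1) * min \<bar>h x\<bar> 1)" by (rule ennreal_leI)
      then show "ennreal \<bar>h x\<bar> \<le> ennreal (real n + 1) * ennreal (min \<bar>h x\<bar> 1)"
        by (simp add: ennreal_mult)
    qed
    have "(\<integral>\<^sup>+ x. ennreal \<bar>h x\<bar> \<partial>J \<omega>) \<le> (\<integral>\<^sup>+ x. ennreal (real n + 1) * ennreal (min \<bar>h x\<bar> 1) \<partial>J \<omega>)"
      by (rule nn_integral_mono_AE[OF ae])
    also have "\<dots> = ennreal (real n + 1) * (\<integral>\<^sup>+ x. ennreal (min \<bar>h x\<bar> 1) \<partial>J \<omega>)"
      by (rule nn_integral_cmult) measurable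
    also have "\<dots> < \<infinity>" using fin by (simp add: ennreal_mult_less_top less_top)
    finally show "integrable (J \<omega>) h"
      by (simp add: integrable_iff_bounded)
  qed
qed

lemma integral_exp_count:
  assumes [measurable]: "B \<in> sets N" and fin: "emeasure N B < \<infinity>"
  shows "(\<integral>\<omega>. exp (\<i> * complex_of_real (a * measure (J \<omega>) B)) \<partial>M) = exp (measure N B * (exp (\<i> * a) - 1))"
proof -
  let ?l = "measure N B" and ?p = "\<lambda>k::nat. exp (- measure N B) * measure N B ^ k / fact k"
  let ?e = "\<lambda>k::nat. exp (\<i> * complex_of_real (a * real k))"
  have pow: "?e k = exp (\<i> * a) ^ k" for k
    by (simp flip: exp_of_nat_mult add: mult_ac)
  have eq: "?p k *\<^sub>R ?e k = exp (- complex_of_real ?l) * ((?l * exp (\<i> * a)) ^ k /\<^sub>R fact k)" for k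
    unfolding pow by (simp add: power_mult_distrib scaleR_conv_of_real field_simps exp_of_real[symmetric])
  have sm: "(\<lambda>k. ?p k *\<^sub>R ?e k) sums (exp (- complex_of_real ?l) * exp (?l * exp (\<i> * a)))"
    unfolding eq by (intro sums_mult exp_converges)
  have int: "integrable (count_space UNIV) (\<lambda>k. ?p k *\<^sub>R ?e k)"
    unfolding integrable_count_space_nat_iff
    using sums_summable[OF poisson_sums[of ?l]] by (simp add: norm_mult)
  have "(\<integral>\<omega>. exp (\<i> * complex_of_real (a * measure (J \<omega>) B)) \<partial>M) = (\<integral>\<omega>. ?e (count B \<omega>) \<partial>M)"
  proof (rule integral_cong_AE)
    show "(\<lambda>\<omega>. exp (\<i> * complex_of_real (a * measure (J \<omega>) B))) \<in> borel_measurable M"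
      unfolding measure_def by measurable
    show "(\<lambda>\<omega>. ?e (count B \<omega>)) \<in> borel_measurable M" by measurable
    show "AE \<omega> in M. exp (\<i> * complex_of_real (a * measure (J \<omega>) B)) = ?e (count B \<omega>)"
      using AE_J_eq_count[OF assms] by eventually_elim (simp add: measure_def)
  qed
  also have "\<dots> = (\<integral>k. ?e k \<partial>distr M (count_space UNIV) (count B))"
    by (rule integral_distr[symmetric]) auto
  also have "\<dots> = (\<integral>k. ?p k *\<^sub>R ?e k \<partial>count_space UNIV)"
    unfolding distr_count[OF assms] by (subst integral_density) auto
  also have "\<dots> = exp (- complex_of_real ?l) * exp (?l * exp (\<i> * a))"
    using sm sums_unique2 sums_integral_count_space_nat[OF int] by blast
  also have "\<dots> = exp (?l * (exp (\<i> * a) - 1))"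
    by (simp flip: exp_add add: algebra_simps)
  finally show ?thesis .
qed

end

section \<open>Independence over level sets and the characteristic function of pathwise
  integrals\<close>

lemma simple_function_map_upt:
  assumes "\<And>l. l < n \<Longrightarrow> simple_function M (F l)"
  shows "simple_function M (\<lambda>x. map (\<lambda>l. F l x) [0..<n])"
  using assms
proof (induction n)
  case (Suc n)
  then have "simple_function M (\<lambda>x. map (\<lambda>l. F l x) [0..<n] @ [F n x])"
    by (intro simple_function_compose2[where h = "\<lambda>a b. a @ [b]"]) auto
  then show ?case by simp
qed simp

text \<open>Stated for an arbitrary measure because it is applied to the intensity, to each
  realization of the jump measure and, in the sampling argument, to \<open>\<mu>\<close>.\<close>

lemma has_bochner_integral_atoms:
  fixes c :: "'v \<Rightarrow> 'b::{banach, second_countable_topology}"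
  assumes q: "simple_function K q" and V: "finite V"
    and fin: "\<And>v. v \<in> V \<Longrightarrow> emeasure K (q -` {v} \<inter> space K) < \<infinity>"
  shows "has_bochner_integral K (\<lambda>x. if q x \<in> V then c (q x) else 0)
    (\<Sum>v\<in>V. measure K (q -` {v} \<inter> space K) *\<^sub>R c v)"
proof -
  have *: "has_bochner_integral K (\<lambda>x. \<Sum>v\<in>V. indicator (q -` {v} \<inter> space K) x *\<^sub>R c v)
    (\<Sum>v\<in>V. measure K (q -` {v} \<inter> space K) *\<^sub>R c v)"
    by (intro has_bochner_integral_sum has_bochner_integral_scaleR_left has_bochner_integral_indicator simple_functionD q fin)
  have "(\<Sum>v\<in>V. indicator (q -` {v} \<inter> space K) x *\<^sub>R c v) = (if q x \<in> V then c (q x) else 0)"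
    if "x \<in> space K" for x
  proof -
    have "(\<Sum>v\<in>V. indicator (q -` {v} \<inter> space K) x *\<^sub>R c v) = (\<Sum>v\<in>V. if v = q x then c v else 0)"
      using that by (intro sum.cong) (auto simp: indicator_def)
    then show ?thesis using V by simp
  qed
  then show ?thesis
    using * by (subst has_bochner_integral_cong[OF refl _ refl]) auto
qed

text \<open>The definition of a Poisson random measure provides independence for families indexed by
  natural numbers; an injective numbering carries it over to families indexed by level values, lists
  or options.\<close>

lemma (in prob_space) indep_vars_reindex:
  assumes f: "inj_on f V" and ind: "indep_vars M' X (f ` V)"
  shows "indep_vars (\<lambda>v. M' (f v)) (\<lambda>v. X (f v)) V"
proof -
  let ?F = "\<lambda>i. {X i -` A \<inter> space M | A. A \<in> sets (M' i)}"
  have rv: "\<And>i. i \<in> f ` V \<Longrightarrow> random_variable (M' i) (X i)" and F: "indep_sets ?F (f ` V)"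
    using ind unfolding indep_vars_def2 by auto
  have "indep_sets (\<lambda>v. ?F (f v)) V"
    unfolding indep_sets_def
  proof (intro conjI ballI allI impI)
    show "?F (f v) \<subseteq> events" if "v \<in> V" for v
      using F that unfolding indep_sets_def by blast
    fix K A assume K: "K \<subseteq> V" "K \<noteq> {}" "finite K" and A: "A \<in> Pi K (\<lambda>v. ?F (f v))"
    have fK: "inj_on f K" using f K by (auto intro: inj_on_subset)
    define A' where "A' i = A (the_inv_into K f i)" for i
    have A': "A' (f k) = A k" if "k \<in> K" for k
      using the_inv_into_f_f[OF fK that] by (simp add: A'_def)
    have "A' \<in> Pi (f ` K) ?F" using A by (auto simp: Pi_iff A')
    then have "prob (\<Inter>j\<in>f ` K. A' j) = (\<Prod>j\<in>f ` K. prob (A' j))"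
      using F K unfolding indep_sets_def by (meson finite_imageI image_is_empty image_mono)
    also have "(\<Inter>j\<in>f ` K. A' j) = (\<Inter>k\<in>K. A k)" using A' by auto
    also have "(\<Prod>j\<in>f ` K. prob (A' j)) = (\<Prod>k\<in>K. prob (A k))"
      by (simp add: prod.reindex[OF fK] A')
    finally show "prob (\<Inter>k\<in>K. A k) = (\<Prod>k\<in>K. prob (A k))" .
  qed
  with rv show ?thesis unfolding indep_vars_def2 by auto
qed

context poisson_measure
begin

lemma indep_J_family:
  assumes V: "finite V" and B: "\<And>v. v \<in> V \<Longrightarrow> B v \<in> sets N" and dis: "disjoint_family_on B V"
  shows "indep_vars (\<lambda>_. borel) (\<lambda>v \<omega>. emeasure (J \<omega>) (B v)) V"
proof -
  obtain f :: "_ \<Rightarrow> nat" where f: "inj_on f V" using finite_imp_inj_to_nat_seg[OF V] by auto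
  let ?g = "the_inv_into V f"
  have g: "?g (f v) = v" if "v \<in> V" for v using the_inv_into_f_f[OF f that] .
  have "indep_vars (\<lambda>_. borel) (\<lambda>i \<omega>. emeasure (J \<omega>) (B (?g i))) (f ` V)"
  proof (rule indep_J)
    show "disjoint_family_on (\<lambda>i. B (?g i)) (f ` V)"
      unfolding disjoint_family_on_def
    proof (intro ballI impI)
      fix i j assume "i \<in> f ` V" "j \<in> f ` V" "i \<noteq> j"
      then obtain v w where "v \<in> V" "w \<in> V" "i = f v" "j = f w" "v \<noteq> w" by blast
      then show "B (?g i) \<inter> B (?g j) = {}" using dis g by (simp add: disjoint_family_on_def)
    qed
  qed (use V B g in auto)
  from indep_vars_reindex[OF f this]
  have "indep_vars (\<lambda>_. borel) (\<lambda>v \<omega>. emeasure (J \<omega>) (B (?g (f v)))) V"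
    by (simp add: comp_def)
  then show ?thesis
    by (subst (asm) indep_vars_cong[OF refl, where Y = "\<lambda>v \<omega>. emeasure (J \<omega>) (B v)" and N' = "\<lambda>_. borel"])
      (auto simp: g)
qed

lemma simple_function_J: "\<omega> \<in> space M \<Longrightarrow> simple_function N q \<Longrightarrow> simple_function (J \<omega>) q"
  by (simp add: simple_function_def space_J sets_J)

lemma Jint_atoms:
  assumes q: "simple_function N q" and V: "finite V"
    and fin: "\<And>v. v \<in> V \<Longrightarrow> emeasure N (q -` {v} \<inter> space N) < \<infinity>"
    and h: "\<And>x. x \<in> space N \<Longrightarrow> h x = (if q x \<in> V then c (q x) else 0)"
  shows "AE \<omega> in M. Jint h \<omega> = (\<Sum>v\<in>V. c v * measure (J \<omega>) (q -` {v} \<inter> space N))"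
proof -
  have "AE \<omega> in M. \<forall>v\<in>V. emeasure (J \<omega>) (q -` {v} \<inter> space N) < \<infinity>"
    using V by (intro AE_finite_allI AE_J_finite fin) (use q in \<open>auto simp: simple_functionD\<close>)
  then show ?thesis
    using AE_space
  proof eventually_elim
    fix \<omega> assume fin: "\<forall>v\<in>V. emeasure (J \<omega>) (q -` {v} \<inter> space N) < \<infinity>" and w: "\<omega> \<in> space M"
    have "has_bochner_integral (J \<omega>) (\<lambda>x. if q x \<in> V then c (q x) else 0)
      (\<Sum>v\<in>V. measure (J \<omega>) (q -` {v} \<inter> space (J \<omega>)) *\<^sub>R c v)"
      using fin by (intro has_bochner_integral_atoms simple_function_J q V w) (auto simp: space_J w)
    then have "(\<integral>x. (if q x \<in> V then c (q x) else 0) \<partial>J \<omega>) = (\<Sum>v\<in>V. c v * measure (J \<omega>) (q -` {v} \<inter> space N))"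
      by (simp add: has_bochner_integral_integral_eq space_J w mult.commute)
    moreover have "Jint h \<omega> = (\<integral>x. (if q x \<in> V then c (q x) else 0) \<partial>J \<omega>)"
      unfolding Jint_def by (rule Bochner_Integration.integral_cong) (auto simp: h space_J w)
    ultimately show "Jint h \<omega> = (\<Sum>v\<in>V. c v * measure (J \<omega>) (q -` {v} \<inter> space N))" by simp
  qed
qed

lemma disjoint_vimages: "disjoint_family_on (\<lambda>v. q -` {v} \<inter> S) V"
  by (auto simp: disjoint_family_on_def)

text \<open>The integral is a linear combination of the independent Poisson counts of the level
  sets, so its characteristic function is a product of Poisson ones and the exponents add up to an
  integral over \<open>N\<close>.\<close>

lemma char_Jint_simple:
  assumes q: "simple_function N h" and fin: "emeasure N {x \<in> space N. h x \<noteq> 0} < \<infinity>"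
  shows "(\<integral>\<omega>. iexp (Jint h \<omega>) \<partial>M) = exp (\<integral>x. iexp (h x) - 1 \<partial>N)"
proof -
  \<comment> \<open>The value 0 is left out: its level set may have infinite intensity, and it
    contributes nothing to either side.\<close>
  define V where "V = h ` space N - {0}"
  define A where "A v = h -` {v} \<inter> space N" for v
  have [measurable]: "h \<in> borel_measurable N" using q by (rule borel_measurable_simple_function)
  have V: "finite V" using q by (auto simp: V_def simple_function_def)
  have A[measurable]: "A v \<in> sets N" for v using q by (simp add: A_def simple_functionD)
  have finA: "emeasure N (A v) < \<infinity>" if "v \<in> V" for v
  proof (rule order.strict_trans1[OF emeasure_mono fin])
    show "A v \<subseteq> {x \<in> space N. h x \<noteq> 0}" using that by (auto simp: A_def V_def)
  qed measurable
  have "(\<integral>\<omega>. iexp (Jint h \<omega>) \<partial>M) = (\<integral>\<omega>. (\<Prod>v\<in>V. iexp (v * measure (J \<omega>) (A v))) \<partial>M)"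
  proof (rule integral_cong_AE)
    have "AE \<omega> in M. Jint h \<omega> = (\<Sum>v\<in>V. v * measure (J \<omega>) (h -` {v} \<inter> space N))"
      using finA by (intro Jint_atoms q V) (auto simp: A_def V_def)
    then show "AE \<omega> in M. iexp (Jint h \<omega>) = (\<Prod>v\<in>V. iexp (v * measure (J \<omega>) (A v)))"
      by eventually_elim (simp add: A_def sum_distrib_left exp_sum V)
    show "(\<lambda>\<omega>. \<Prod>v\<in>V. iexp (v * measure (J \<omega>) (A v))) \<in> borel_measurable M"
      unfolding measure_def by measurable
  qed measurable
  also have "\<dots> = (\<Prod>v\<in>V. \<integral>\<omega>. iexp (v * measure (J \<omega>) (A v)) \<partial>M)"
  proof (rule indep_vars_lebesgue_integral[OF V])
    show "indep_vars (\<lambda>_. borel) (\<lambda>v \<omega>. iexp (v * measure (J \<omega>) (A v))) V"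
      unfolding measure_def
      by (rule indep_vars_compose2[OF indep_J_family[of V A, OF V]])
         (auto simp: disjoint_vimages A_def[abs_def] A[unfolded A_def])
    show "integrable M (\<lambda>\<omega>. iexp (v * measure (J \<omega>) (A v)))" for v
      by (rule integrable_const_bound[of _ 1]) (auto simp: measure_def)
  qed
  also have "\<dots> = (\<Prod>v\<in>V. exp (measure N (A v) * (iexp v - 1)))"
    by (intro prod.cong refl integral_exp_count finA A)
  also have "\<dots> = exp (\<Sum>v\<in>V. measure N (A v) *\<^sub>R (iexp v - 1))"
    by (simp add: exp_sum V scaleR_conv_of_real)
  also have "(\<Sum>v\<in>V. measure N (A v) *\<^sub>R (iexp v - 1)) = (\<integral>x. iexp (h x) - 1 \<partial>N)"
  proof -
    have "has_bochner_integral N (\<lambda>x. if h x \<in> V then iexp (h x) - 1 else 0) (\<Sum>v\<in>V. measure N (A v) *\<^sub>R (iexp v - 1))"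
      unfolding A_def by (rule has_bochner_integral_atoms) (use q V finA in \<open>auto simp: A_def\<close>)
    then have "(\<Sum>v\<in>V. measure N (A v) *\<^sub>R (iexp v - 1)) = (\<integral>x. (if h x \<in> V then iexp (h x) - 1 else 0) \<partial>N)"
      by (simp add: has_bochner_integral_integral_eq)
    also have "\<dots> = (\<integral>x. iexp (h x) - 1 \<partial>N)"
      by (rule Bochner_Integration.integral_cong) (auto simp: V_def)
    finally show ?thesis .
  qed
  finally show ?thesis .
qed

text \<open>The condition for absolute convergence without compensation: near 0 it asks for the
  first power of \<open>h\<close>, whereas finiteness of \<open>tmom N h\<close> asks only for the
  square.\<close>

definition jfin :: "('c \<Rightarrow> real) \<Rightarrow> bool" where
  "jfin h \<longleftrightarrow> h \<in> borel_measurable N \<and> (\<integral>\<^sup>+ x. ennreal (min \<bar>h x\<bar> 1) \<partial>N) < \<infinity>"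

lemma jfin_measurable: "jfin h \<Longrightarrow> h \<in> borel_measurable N"
  by (simp add: jfin_def)

lemma jfin_bound:
  assumes "jfin h" and [measurable]: "g \<in> borel_measurable N"
    and "c \<ge> 0" "\<And>x. x \<in> space N \<Longrightarrow> min \<bar>g x\<bar> 1 \<le> c * min \<bar>h x\<bar> 1"
  shows "jfin g"
proof -
  have [measurable]: "h \<in> borel_measurable N" using assms by (simp add: jfin_def)
  have "(\<integral>\<^sup>+ x. ennreal (min \<bar>g x\<bar> 1) \<partial>N) \<le> (\<integral>\<^sup>+ x. ennreal c * ennreal (min \<bar>h x\<bar> 1) \<partial>N)"
    using assms by (intro nn_integral_mono) (auto simp: ennreal_mult[symmetric] intro!: ennreal_leI)
  also have "\<dots> = ennreal c * (\<integral>\<^sup>+ x. ennreal (min \<bar>h x\<bar> 1) \<partial>N)"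
    by (rule nn_integral_cmult) measurable
  also have "\<dots> < \<infinity>" using assms(1) by (simp add: jfin_def ennreal_mult_less_top)
  finally show ?thesis by (simp add: jfin_def)
qed

lemma jfin_mono:
  assumes "jfin h" "g \<in> borel_measurable N" "\<And>x. x \<in> space N \<Longrightarrow> \<bar>g x\<bar> \<le> \<bar>h x\<bar>"
  shows "jfin g"
  by (rule jfin_bound[where c = 1, OF assms(1,2)]) (use assms(3) in \<open>auto simp: min_def intro: order.trans\<close>)

lemma jfin_cmult:
  assumes "jfin h"
  shows "jfin (\<lambda>x. c * h x)"
proof (rule jfin_bound[OF assms, where c = "max 1 \<bar>c\<bar>"])
  fix x
  have "\<bar>c\<bar> * \<bar>h x\<bar> \<le> max 1 \<bar>c\<bar> * \<bar>h x\<bar>" by (intro mult_right_mono) auto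
  moreover have "1 \<le> max 1 \<bar>c\<bar>" by simp
  ultimately show "min \<bar>c * h x\<bar> 1 \<le> max 1 \<bar>c\<bar> * min \<bar>h x\<bar> 1"
    unfolding abs_mult by (cases "\<bar>h x\<bar> \<le> 1") linarith+
qed (use assms in \<open>auto simp: jfin_def\<close>)

lemma jfin_add:
  assumes "jfin g" "jfin h"
  shows "jfin (\<lambda>x. g x + h x)"
proof -
  have [measurable]: "g \<in> borel_measurable N" "h \<in> borel_measurable N" using assms by (auto simp: jfin_def)
  have "(\<integral>\<^sup>+ x. ennreal (min \<bar>g x + h x\<bar> 1) \<partial>N) \<le> (\<integral>\<^sup>+ x. ennreal (min \<bar>g x\<bar> 1) + ennreal (min \<bar>h x\<bar> 1) \<partial>N)"
    by (intro nn_integral_mono) (auto simp flip: ennreal_plus intro!: ennreal_leI simp: min_def)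
  also have "\<dots> = (\<integral>\<^sup>+ x. ennreal (min \<bar>g x\<bar> 1) \<partial>N) + (\<integral>\<^sup>+ x. ennreal (min \<bar>h x\<bar> 1) \<partial>N)"
    by (rule nn_integral_add) measurable
  also have "\<dots> < \<infinity>" using assms by (simp add: jfin_def)
  finally show ?thesis by (simp add: jfin_def)
qed

lemma jfin_diff: "jfin g \<Longrightarrow> jfin h \<Longrightarrow> jfin (\<lambda>x. g x - h x)"
  using jfin_add[of g "\<lambda>x. -1 * h x"] jfin_cmult[of h "-1"] by simp

lemma jfin_zero: "jfin (\<lambda>x. 0)" by (simp add: jfin_def)

lemma jfin_AE_integrable: "jfin h \<Longrightarrow> AE \<omega> in M. integrable (J \<omega>) h"
  unfolding jfin_def using AE_J_integrable by blast

lemma jfin_finite_support: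
  assumes [measurable]: "h \<in> borel_measurable N" and "emeasure N {x \<in> space N. h x \<noteq> 0} < \<infinity>"
  shows "jfin h"
proof -
  have "(\<integral>\<^sup>+ x. ennreal (min \<bar>h x\<bar> 1) \<partial>N) \<le> (\<integral>\<^sup>+ x. indicator {x \<in> space N. h x \<noteq> 0} x \<partial>N)"
    by (intro nn_integral_mono) (auto simp: indicator_def)
  also have "\<dots> = emeasure N {x \<in> space N. h x \<noteq> 0}" by simp
  finally show ?thesis using assms by (auto simp: jfin_def)
qed

lemma Jint_cmult: "Jint (\<lambda>x. c * h x) \<omega> = c * Jint h \<omega>"
  by (simp add: Jint_def)

lemma Jint_add_AE:
  assumes "jfin g" "jfin h"
  shows "AE \<omega> in M. Jint (\<lambda>x. g x + h x) \<omega> = Jint g \<omega> + Jint h \<omega>"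
  using jfin_AE_integrable[OF assms(1)] jfin_AE_integrable[OF assms(2)]
  by eventually_elim (simp add: Jint_def)

lemma Jint_diff_AE:
  assumes "jfin g" "jfin h"
  shows "AE \<omega> in M. Jint (\<lambda>x. g x - h x) \<omega> = Jint g \<omega> - Jint h \<omega>"
  using jfin_AE_integrable[OF assms(1)] jfin_AE_integrable[OF assms(2)]
  by eventually_elim (simp add: Jint_def)

text \<open>The bound by \<open>2 * \<bar>h\<bar>\<close> serves several ends: it yields supports of
  finite intensity, it is the majorant for dominated convergence under almost every
  \<open>J \<omega>\<close>, and it makes the approximations vanish wherever \<open>h\<close>
  does.\<close>

lemma jfin_simple_approx:
  assumes "jfin h"
  obtains F where "\<And>i. simple_function N (F i)" "\<And>i. emeasure N {x \<in> space N. F i x \<noteq> 0} < \<infinity>"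
    "\<And>i x. x \<in> space N \<Longrightarrow> \<bar>F i x\<bar> \<le> 2 * \<bar>h x\<bar>" "\<And>x. x \<in> space N \<Longrightarrow> (\<lambda>i. F i x) \<longlonglongrightarrow> h x"
    "AE \<omega> in M. (\<lambda>i. Jint (F i) \<omega>) \<longlonglongrightarrow> Jint h \<omega>"
proof -
  have h[measurable]: "h \<in> borel_measurable N" using assms by (simp add: jfin_def)
  obtain F where *: "(\<forall>i. simple_function N (F i)) \<and> (\<forall>x\<in>space N. (\<lambda>i. F i x) \<longlonglongrightarrow> h x) \<and>
      (\<forall>i. \<forall>x\<in>space N. dist (F i x) 0 \<le> 2 * dist (h x) 0)"
    using borel_measurable_implies_sequence_metric[OF h, of 0] by (elim exE)
  then have F: "\<And>i. simple_function N (F i)" "\<And>x. x \<in> space N \<Longrightarrow> (\<lambda>i. F i x) \<longlonglongrightarrow> h x"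
    and bd: "\<And>i x. x \<in> space N \<Longrightarrow> \<bar>F i x\<bar> \<le> 2 * \<bar>h x\<bar>"
    by auto
  have [measurable]: "F i \<in> borel_measurable N" for i using F(1) by (rule borel_measurable_simple_function)
  have fin: "emeasure N {x \<in> space N. F i x \<noteq> 0} < \<infinity>" for i
  proof -
    define V where "V = (\<lambda>x. \<bar>F i x\<bar>) ` space N - {0}"
    have V: "finite V" using finite_imageI[OF simple_functionD(1)[OF F(1)[of i]], of abs] by (simp add: V_def image_image)
    \<comment> \<open>The least nonzero modulus of \<open>F i\<close>, capped at 1. Where
      \<open>F i\<close> does not vanish, \<open>min \<bar>h x\<bar> 1 \<ge> c / 2\<close>, and
      Markov's inequality applies; inserting 1 also covers \<open>F i = 0\<close>.\<close>
    define c where "c = Min (insert 1 V)"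
    have c: "0 < c" using V by (auto simp: c_def V_def)
    have ge: "c \<le> \<bar>F i x\<bar>" if "x \<in> space N" "F i x \<noteq> 0" for x
      using V that unfolding c_def by (intro Min_le) (auto simp: V_def)
    have "c \<le> 1" using V by (auto simp: c_def)
    have "emeasure N {x \<in> space N. F i x \<noteq> 0} \<le> emeasure N {x \<in> space N. 1 \<le> ennreal (2 / c) * ennreal (min \<bar>h x\<bar> 1)}"
    proof (rule emeasure_mono)
      show "{x \<in> space N. F i x \<noteq> 0} \<subseteq> {x \<in> space N. 1 \<le> ennreal (2 / c) * ennreal (min \<bar>h x\<bar> 1)}"
      proof safe
        fix x assume x: "x \<in> space N" "F i x \<noteq> 0"
        have "1 \<le> 2 / c * min \<bar>h x\<bar> 1"
          using ge[OF x] bd[OF x(1), of i] c \<open>c \<le> 1\<close> by (auto simp: field_simps min_def)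
        then show "1 \<le> ennreal (2 / c) * ennreal (min \<bar>h x\<bar> 1)"
          using c by (simp flip: ennreal_mult)
      qed
    qed measurable
    also have "\<dots> \<le> ennreal (2 / c) * (\<integral>\<^sup>+ x. ennreal (min \<bar>h x\<bar> 1) * indicator (space N) x \<partial>N)"
      using nn_integral_Markov_inequality[of "\<lambda>x. ennreal (min \<bar>h x\<bar> 1)" "space N" N "ennreal (2 / c)"] by simp
    also have "(\<integral>\<^sup>+ x. ennreal (min \<bar>h x\<bar> 1) * indicator (space N) x \<partial>N) = (\<integral>\<^sup>+ x. ennreal (min \<bar>h x\<bar> 1) \<partial>N)"
      by (intro nn_integral_cong) auto
    also have "ennreal (2 / c) * \<dots> < \<infinity>" using assms by (simp add: jfin_def ennreal_mult_less_top)
    finally show ?thesis .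
  qed
  have "AE \<omega> in M. (\<lambda>i. Jint (F i) \<omega>) \<longlonglongrightarrow> Jint h \<omega>"
    using jfin_AE_integrable[OF assms] AE_space
  proof eventually_elim
    fix \<omega> assume int: "integrable (J \<omega>) h" and w: "\<omega> \<in> space M"
    show "(\<lambda>i. Jint (F i) \<omega>) \<longlonglongrightarrow> Jint h \<omega>"
      unfolding Jint_def
      by (rule integral_dominated_convergence[where w = "\<lambda>x. 2 * \<bar>h x\<bar>"])
        (use int F bd in \<open>auto simp: borel_measurable_J w space_J\<close>)
  qed
  then show ?thesis using that F bd fin by blast
qed

lemma integrable_iexp_minus_1:
  assumes "jfin h"
  shows "integrable N (\<lambda>x. iexp (h x) - 1)"
proof (rule integrableI_bounded)
  have [measurable]: "h \<in> borel_measurable N" using assms by (simp add: jfin_def)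
  show "(\<lambda>x. iexp (h x) - 1) \<in> borel_measurable N" by measurable
  have "(\<integral>\<^sup>+ x. norm (iexp (h x) - 1) \<partial>N) \<le> (\<integral>\<^sup>+ x. 2 * ennreal (min \<bar>h x\<bar> 1) \<partial>N)"
  proof (rule nn_integral_mono)
    fix x
    have "cmod (iexp (h x) - 1) \<le> \<bar>h x\<bar>" using iexp_approx1[of "h x" 0] by simp
    moreover have "cmod (iexp (h x) - 1) \<le> 2" using norm_triangle_ineq4[of "iexp (h x)" 1] by simp
    ultimately have "ennreal (cmod (iexp (h x) - 1)) \<le> ennreal (2 * min \<bar>h x\<bar> 1)"
      by (intro ennreal_leI) auto
    then show "ennreal (cmod (iexp (h x) - 1)) \<le> 2 * ennreal (min \<bar>h x\<bar> 1)" by (simp add: ennreal_mult)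
  qed
  also have "\<dots> = 2 * (\<integral>\<^sup>+ x. ennreal (min \<bar>h x\<bar> 1) \<partial>N)" by (rule nn_integral_cmult) measurable
  also have "\<dots> < \<infinity>" using assms by (simp add: jfin_def ennreal_mult_less_top)
  finally show "(\<integral>\<^sup>+ x. norm (iexp (h x) - 1) \<partial>N) < \<infinity>" .
qed

text \<open>The Levy-Khintchine formula in the absolutely convergent case, obtained from simple
  functions by dominated convergence on both sides.\<close>

lemma char_Jint:
  assumes h: "jfin h"
  shows "(\<integral>\<omega>. iexp (Jint h \<omega>) \<partial>M) = exp (\<integral>x. iexp (h x) - 1 \<partial>N)"
proof -
  have [measurable]: "h \<in> borel_measurable N" using h by (simp add: jfin_def)
  obtain F where F: "\<And>i. simple_function N (F i)" "\<And>i. emeasure N {x \<in> space N. F i x \<noteq> 0} < \<infinity>"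
    and bd: "\<And>i x. x \<in> space N \<Longrightarrow> \<bar>F i x\<bar> \<le> 2 * \<bar>h x\<bar>" and lim: "\<And>x. x \<in> space N \<Longrightarrow> (\<lambda>i. F i x) \<longlonglongrightarrow> h x"
    and J: "AE \<omega> in M. (\<lambda>i. Jint (F i) \<omega>) \<longlonglongrightarrow> Jint h \<omega>"
    by (rule jfin_simple_approx[OF h]) blast
  have [measurable]: "F i \<in> borel_measurable N" for i using F(1) by (rule borel_measurable_simple_function)
  have 1: "(\<lambda>i. \<integral>\<omega>. iexp (Jint (F i) \<omega>) \<partial>M) \<longlonglongrightarrow> (\<integral>\<omega>. iexp (Jint h \<omega>) \<partial>M)"
    by (rule integral_dominated_convergence[where w = "\<lambda>_. 1"])
      (use J in \<open>auto elim!: eventually_mono intro!: tendsto_intros\<close>)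
  have "(\<lambda>i. \<integral>x. iexp (F i x) - 1 \<partial>N) \<longlonglongrightarrow> (\<integral>x. iexp (h x) - 1 \<partial>N)"
  proof (rule integral_dominated_convergence[where w = "\<lambda>x. 2 * min \<bar>h x\<bar> 1"])
    show "integrable N (\<lambda>x. 2 * min \<bar>h x\<bar> 1)"
      using h by (intro integrable_mult_right integrableI_bounded) (auto simp: jfin_def)
    show "AE x in N. (\<lambda>i. iexp (F i x) - 1) \<longlonglongrightarrow> iexp (h x) - 1"
      using AE_space by eventually_elim (use lim in \<open>auto intro!: tendsto_intros\<close>)
    show "AE x in N. norm (iexp (F i x) - 1) \<le> 2 * min \<bar>h x\<bar> 1" for i
      using AE_space
    proof eventually_elim
      fix x assume x: "x \<in> space N"
      have "cmod (iexp (F i x) - 1) \<le> \<bar>F i x\<bar>" using iexp_approx1[of "F i x" 0] by simp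
      moreover have "cmod (iexp (F i x) - 1) \<le> 2" using norm_triangle_ineq4[of "iexp (F i x)" 1] by simp
      ultimately show "cmod (iexp (F i x) - 1) \<le> 2 * min \<bar>h x\<bar> 1"
        using bd[OF x, of i] by auto
    qed
  qed measurable
  then have 2: "(\<lambda>i. exp (\<integral>x. iexp (F i x) - 1 \<partial>N)) \<longlonglongrightarrow> exp (\<integral>x. iexp (h x) - 1 \<partial>N)"
    by (intro tendsto_exp)
  show ?thesis
    using LIMSEQ_unique[OF 1] 2 unfolding char_Jint_simple[OF F] by blast
qed

section \<open>Independence of the jumps inside and outside a set\<close>

lemma prob_J_eq_0:
  assumes "C \<in> sets N" "emeasure N C < \<infinity>"
  shows "measure M {\<omega> \<in> space M. emeasure (J \<omega>) C = 0} = exp (- measure N C)"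
  using poisson_prob[OF assms, of 0] by simp

text \<open>The sums depend only on the jump counts of common level sets of the \<open>F l\<close>
  that are disjoint from \<open>C\<close>, hence they are independent of the count of
  \<open>C\<close>; the factor is the probability of no jump in \<open>C\<close>.\<close>

lemma split_jfin_simple:
  fixes \<zeta> :: "real \<Rightarrow> real" and n :: nat
  assumes [measurable]: "C \<in> sets N"
    and F: "\<And>l. l < n \<Longrightarrow> simple_function N (F l)"
    and fin: "\<And>l. l < n \<Longrightarrow> emeasure N {x \<in> space N. F l x \<noteq> 0} < \<infinity>"
    and F0: "\<And>l x. l < n \<Longrightarrow> x \<in> C \<Longrightarrow> F l x = 0"
    and C: "emeasure N C < \<infinity>"
    and \<zeta>[measurable]: "\<zeta> \<in> borel_measurable borel" and bd: "\<And>x. \<bar>\<zeta> x\<bar> \<le> b"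
  shows "(\<integral>\<omega>. indicator {\<omega> \<in> space M. emeasure (J \<omega>) C = 0} \<omega> * \<zeta> (\<Sum>l<n. w l * \<bar>Jint (F l) \<omega>\<bar>) \<partial>M) =
    exp (- measure N C) * (\<integral>\<omega>. \<zeta> (\<Sum>l<n. w l * \<bar>Jint (F l) \<omega>\<bar>) \<partial>M)"
proof -
  \<comment> \<open>Joining the finitely many simple functions into one with list values makes their
    common level sets a single partition.\<close>
  define q where "q x = map (\<lambda>l. F l x) [0..<n]" for x
  \<comment> \<open>The zero list is excluded: its cell contains \<open>C\<close> and may have
    infinite intensity.\<close>
  define V where "V = q ` space N - {v. \<forall>l<n. v ! l = 0}"
  define A where "A v = q -` {v} \<inter> space N" for v
  have q: "simple_function N q"
    unfolding q_def[abs_def] using F by (intro simple_function_map_upt) auto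
  have V: "finite V" using q by (auto simp: V_def simple_function_def)
  have A: "A v \<in> sets N" for v using q by (simp add: A_def simple_functionD)
  have Fm: "F l \<in> borel_measurable N" if "l < n" for l using F[OF that] by (rule borel_measurable_simple_function)
  have finA: "emeasure N (A v) < \<infinity>" if v: "v \<in> V" for v
  proof -
    obtain l where l: "l < n" "v ! l \<noteq> 0" using v by (auto simp: V_def)
    note [measurable] = Fm[OF l(1)]
    show ?thesis
    proof (rule order.strict_trans1[OF emeasure_mono fin[OF l(1)]])
      show "A v \<subseteq> {x \<in> space N. F l x \<noteq> 0}" using l by (auto simp: A_def q_def)
    qed measurable
  qed
  have J: "AE \<omega> in M. Jint (F l) \<omega> = (\<Sum>v\<in>V. v ! l * measure (J \<omega>) (A v))" if l: "l < n" for l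
    unfolding A_def
  proof (rule Jint_atoms[OF q V, where c = "\<lambda>v. v ! l"])
    fix x assume "x \<in> space N"
    moreover have "F l x = q x ! l" using l by (simp add: q_def)
    ultimately show "F l x = (if q x \<in> V then q x ! l else 0)" using l unfolding V_def by simp
  qed (use finA in \<open>auto simp: A_def\<close>)
  define B where "B i = (case i of None \<Rightarrow> C | Some v \<Rightarrow> A v)" for i
  have dis: "disjoint_family_on B (insert None (Some ` V))"
  proof -
    have "C \<inter> A v = {}" if v: "v \<in> V" for v
    proof (rule equals0I)
      fix x assume x: "x \<in> C \<inter> A v"
      obtain l where l: "l < n" "v ! l \<noteq> 0" using v unfolding V_def by blast
      have "v ! l = F l x" using x l(1) by (auto simp: A_def q_def)
      then show False using F0[OF l(1)] x l(2) by auto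
    qed
    moreover have "A v \<inter> A v' = {}" if "v \<noteq> v'" for v v' using that by (auto simp: A_def)
    ultimately show ?thesis unfolding disjoint_family_on_def by (auto simp only: B_def option.case) blast+
  qed
  have ind: "indep_vars (\<lambda>_. borel) (\<lambda>i \<omega>. emeasure (J \<omega>) (B i)) (insert None (Some ` V))"
    by (rule indep_J_family[OF _ _ dis]) (use V A in \<open>auto simp: B_def split: option.splits\<close>)
  have ind2: "indep_var (PiM {None} (\<lambda>_. borel)) (\<lambda>\<omega>. restrict (\<lambda>i. emeasure (J \<omega>) (B i)) {None})
    (PiM (Some ` V) (\<lambda>_. borel)) (\<lambda>\<omega>. restrict (\<lambda>i. emeasure (J \<omega>) (B i)) (Some ` V))"
    by (rule indep_var_restrict[OF ind]) auto
  let ?U = "\<lambda>x::real list option \<Rightarrow> ennreal. \<zeta> (\<Sum>l<n. w l * \<bar>\<Sum>v\<in>V. v ! l * enn2real (x (Some v))\<bar>)"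
  have m1: "(\<lambda>x. indicator {0} (x None) :: real) \<in> borel_measurable (PiM {None} (\<lambda>_. borel :: ennreal measure))"
    by measurable
  have m2: "?U \<in> borel_measurable (PiM (Some ` V) (\<lambda>_. borel))"
    by measurable
  have ind3: "indep_var borel (\<lambda>\<omega>. indicator {0} (emeasure (J \<omega>) C) :: real)
     borel (\<lambda>\<omega>. \<zeta> (\<Sum>l<n. w l * \<bar>\<Sum>v\<in>V. v ! l * measure (J \<omega>) (A v)\<bar>))"
    using indep_var_compose[OF ind2 m1 m2] by (simp add: comp_def B_def measure_def cong: sum.cong)
  have Am[measurable]: "(\<lambda>\<omega>. measure (J \<omega>) (A v)) \<in> borel_measurable M" for v
    unfolding measure_def using A by measurable
  have U: "AE \<omega> in M. (\<Sum>l<n. w l * \<bar>Jint (F l) \<omega>\<bar>) = (\<Sum>l<n. w l * \<bar>\<Sum>v\<in>V. v ! l * measure (J \<omega>) (A v)\<bar>)"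
  proof -
    have "AE \<omega> in M. \<forall>l\<in>{..<n}. Jint (F l) \<omega> = (\<Sum>v\<in>V. v ! l * measure (J \<omega>) (A v))"
      using J by (intro AE_finite_allI) auto
    then show ?thesis by eventually_elim simp
  qed
  have Jm[measurable]: "(\<lambda>\<omega>. \<Sum>l<n. w l * \<bar>Jint (F l) \<omega>\<bar>) \<in> borel_measurable M"
    using Fm by (intro borel_measurable_sum borel_measurable_times borel_measurable_abs Jint_measurable) auto
  have "(\<integral>\<omega>. indicator {\<omega> \<in> space M. emeasure (J \<omega>) C = 0} \<omega> * \<zeta> (\<Sum>l<n. w l * \<bar>Jint (F l) \<omega>\<bar>) \<partial>M) =
    (\<integral>\<omega>. indicator {0} (emeasure (J \<omega>) C) * \<zeta> (\<Sum>l<n. w l * \<bar>\<Sum>v\<in>V. v ! l * measure (J \<omega>) (A v)\<bar>) \<partial>M)"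
    by (rule integral_cong_AE) (use U AE_space in \<open>auto elim!: eventually_elim2 simp: indicator_def\<close>)
  also have "\<dots> = (\<integral>\<omega>. indicator {0} (emeasure (J \<omega>) C) \<partial>M) * (\<integral>\<omega>. \<zeta> (\<Sum>l<n. w l * \<bar>\<Sum>v\<in>V. v ! l * measure (J \<omega>) (A v)\<bar>) \<partial>M)"
  proof (rule indep_var_lebesgue_integral[OF ind3])
    show "integrable M (\<lambda>\<omega>. indicator {0} (emeasure (J \<omega>) C) :: real)"
      by (rule integrable_const_bound[of _ 1]) (auto simp: indicator_def)
    show "integrable M (\<lambda>\<omega>. \<zeta> (\<Sum>l<n. w l * \<bar>\<Sum>v\<in>V. v ! l * measure (J \<omega>) (A v)\<bar>))"
      by (rule integrable_const_bound[of _ b]) (use bd in auto)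
  qed
  also have "(\<integral>\<omega>. \<zeta> (\<Sum>l<n. w l * \<bar>\<Sum>v\<in>V. v ! l * measure (J \<omega>) (A v)\<bar>) \<partial>M) = (\<integral>\<omega>. \<zeta> (\<Sum>l<n. w l * \<bar>Jint (F l) \<omega>\<bar>) \<partial>M)"
    by (rule integral_cong_AE) (use U in \<open>auto elim!: eventually_mono\<close>)
  also have "(\<integral>\<omega>. indicator {0} (emeasure (J \<omega>) C) \<partial>M) = (\<integral>\<omega>. indicator {\<omega> \<in> space M. emeasure (J \<omega>) C = 0} \<omega> \<partial>M)"
    by (rule Bochner_Integration.integral_cong) (auto simp: indicator_def)
  also have "\<dots> = exp (- measure N C)"
    using prob_J_eq_0[OF _ C] by simp
  finally show ?thesis .
qed

text \<open>Simple approximations of \<open>G l\<close> inherit the zeros on \<open>C\<close> from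
  the bound by \<open>2 * \<bar>G l\<bar>\<close>; continuity and boundedness of
  \<open>\<zeta>\<close> carry the identity to the limit.\<close>

lemma split_jfin:
  fixes \<zeta> :: "real \<Rightarrow> real" and n :: nat
  assumes [measurable]: "C \<in> sets N" and C: "emeasure N C < \<infinity>"
    and G: "\<And>l. l < n \<Longrightarrow> jfin (G l)"
    and G0: "\<And>l x. l < n \<Longrightarrow> x \<in> C \<Longrightarrow> G l x = 0"
    and \<zeta>: "continuous_on UNIV \<zeta>" and bd: "\<And>x. \<bar>\<zeta> x\<bar> \<le> b"
  shows "(\<integral>\<omega>. indicator {\<omega> \<in> space M. emeasure (J \<omega>) C = 0} \<omega> * \<zeta> (\<Sum>l<n. w l * \<bar>Jint (G l) \<omega>\<bar>) \<partial>M) =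
    exp (- measure N C) * (\<integral>\<omega>. \<zeta> (\<Sum>l<n. w l * \<bar>Jint (G l) \<omega>\<bar>) \<partial>M)"
proof -
  have [measurable]: "\<zeta> \<in> borel_measurable borel" using \<zeta> by (rule borel_measurable_continuous_onI)
  have "\<forall>l\<in>{..<n}. \<exists>F. (\<forall>i. simple_function N (F i)) \<and> (\<forall>i. emeasure N {x \<in> space N. F i x \<noteq> 0} < \<infinity>) \<and>
    (\<forall>i. \<forall>x\<in>space N. \<bar>F i x\<bar> \<le> 2 * \<bar>G l x\<bar>) \<and> (AE \<omega> in M. (\<lambda>i. Jint (F i) \<omega>) \<longlonglongrightarrow> Jint (G l) \<omega>)"
  proof
    fix l assume "l \<in> {..<n}"
    then have "jfin (G l)" using G by simp
    then show "\<exists>F. (\<forall>i. simple_function N (F i)) \<and> (\<forall>i. emeasure N {x \<in> space N. F i x \<noteq> 0} < \<infinity>) \<and>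
      (\<forall>i. \<forall>x\<in>space N. \<bar>F i x\<bar> \<le> 2 * \<bar>G l x\<bar>) \<and> (AE \<omega> in M. (\<lambda>i. Jint (F i) \<omega>) \<longlonglongrightarrow> Jint (G l) \<omega>)"
      by (rule jfin_simple_approx) blast
  qed
  from bchoice[OF this] obtain F where "\<forall>l\<in>{..<n}. (\<forall>i. simple_function N (F l i)) \<and> (\<forall>i. emeasure N {x \<in> space N. F l i x \<noteq> 0} < \<infinity>) \<and>
    (\<forall>i. \<forall>x\<in>space N. \<bar>F l i x\<bar> \<le> 2 * \<bar>G l x\<bar>) \<and> (AE \<omega> in M. (\<lambda>i. Jint (F l i) \<omega>) \<longlonglongrightarrow> Jint (G l) \<omega>)"
    by (elim exE)
  then have F: "\<And>l i. l < n \<Longrightarrow> simple_function N (F l i)"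
    "\<And>l i. l < n \<Longrightarrow> emeasure N {x \<in> space N. F l i x \<noteq> 0} < \<infinity>"
    "\<And>l i x. l < n \<Longrightarrow> x \<in> space N \<Longrightarrow> \<bar>F l i x\<bar> \<le> 2 * \<bar>G l x\<bar>"
    "\<And>l. l < n \<Longrightarrow> AE \<omega> in M. (\<lambda>i. Jint (F l i) \<omega>) \<longlonglongrightarrow> Jint (G l) \<omega>"
    by auto
  have CN: "C \<subseteq> space N" by (rule sets.sets_into_space) fact
  have F0: "F l i x = 0" if "l < n" "x \<in> C" for l i x
    using F(3)[OF that(1), of x i] G0[OF that] that CN by auto
  have Fm: "F l i \<in> borel_measurable N" if "l < n" for l i using F(1)[OF that] by (rule borel_measurable_simple_function)
  have Jm[measurable]: "(\<lambda>\<omega>. \<Sum>l<n. w l * \<bar>Jint (F l i) \<omega>\<bar>) \<in> borel_measurable M" for i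
    using Fm by (intro borel_measurable_sum borel_measurable_times borel_measurable_abs Jint_measurable) auto
  have Gm[measurable]: "(\<lambda>\<omega>. \<Sum>l<n. w l * \<bar>Jint (G l) \<omega>\<bar>) \<in> borel_measurable M"
    using G by (intro borel_measurable_sum borel_measurable_times borel_measurable_abs Jint_measurable) (auto simp: jfin_def)
  have lim: "AE \<omega> in M. (\<lambda>i. \<zeta> (\<Sum>l<n. w l * \<bar>Jint (F l i) \<omega>\<bar>)) \<longlonglongrightarrow> \<zeta> (\<Sum>l<n. w l * \<bar>Jint (G l) \<omega>\<bar>)"
  proof -
    have "AE \<omega> in M. \<forall>l\<in>{..<n}. (\<lambda>i. Jint (F l i) \<omega>) \<longlonglongrightarrow> Jint (G l) \<omega>"
      using F(4) by (intro AE_finite_allI) auto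
    then show ?thesis
    proof eventually_elim
      fix \<omega> assume *: "\<forall>l\<in>{..<n}. (\<lambda>i. Jint (F l i) \<omega>) \<longlonglongrightarrow> Jint (G l) \<omega>"
      have "(\<lambda>i. \<Sum>l<n. w l * \<bar>Jint (F l i) \<omega>\<bar>) \<longlonglongrightarrow> (\<Sum>l<n. w l * \<bar>Jint (G l) \<omega>\<bar>)"
        using * by (intro tendsto_intros) auto
      then show "(\<lambda>i. \<zeta> (\<Sum>l<n. w l * \<bar>Jint (F l i) \<omega>\<bar>)) \<longlonglongrightarrow> \<zeta> (\<Sum>l<n. w l * \<bar>Jint (G l) \<omega>\<bar>)"
        using \<zeta> by (intro isCont_tendsto_compose[of _ \<zeta>]) (auto simp: continuous_on_eq_continuous_at)
    qed
  qed
  have 1: "(\<lambda>i. \<integral>\<omega>. \<zeta> (\<Sum>l<n. w l * \<bar>Jint (F l i) \<omega>\<bar>) \<partial>M) \<longlonglongrightarrow> (\<integral>\<omega>. \<zeta> (\<Sum>l<n. w l * \<bar>Jint (G l) \<omega>\<bar>) \<partial>M)"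
    by (rule integral_dominated_convergence[where w = "\<lambda>_. b"]) (use lim bd in auto)
  have 2: "(\<lambda>i. \<integral>\<omega>. indicator {\<omega> \<in> space M. emeasure (J \<omega>) C = 0} \<omega> * \<zeta> (\<Sum>l<n. w l * \<bar>Jint (F l i) \<omega>\<bar>) \<partial>M) \<longlonglongrightarrow>
    (\<integral>\<omega>. indicator {\<omega> \<in> space M. emeasure (J \<omega>) C = 0} \<omega> * \<zeta> (\<Sum>l<n. w l * \<bar>Jint (G l) \<omega>\<bar>) \<partial>M)"
    by (rule integral_dominated_convergence[where w = "\<lambda>_. \<bar>b\<bar>"])
      (use lim bd order.trans[OF bd abs_ge_self] in \<open>auto elim!: eventually_mono intro!: tendsto_intros simp: indicator_def\<close>)
  have eq: "(\<integral>\<omega>. indicator {\<omega> \<in> space M. emeasure (J \<omega>) C = 0} \<omega> * \<zeta> (\<Sum>l<n. w l * \<bar>Jint (F l i) \<omega>\<bar>) \<partial>M) =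
    exp (- measure N C) * (\<integral>\<omega>. \<zeta> (\<Sum>l<n. w l * \<bar>Jint (F l i) \<omega>\<bar>) \<partial>M)" for i
    by (rule split_jfin_simple) (use F F0 C bd in auto)
  show ?thesis
    using LIMSEQ_unique[OF 2[unfolded eq] tendsto_mult_left[OF 1]] .
qed

end

section \<open>The averaged cosine and the truncated square\<close>

definition cos_average :: "real \<Rightarrow> ennreal" where
  "cos_average x = (\<integral>\<^sup>+ u. ennreal (1 - cos (u * x)) * indicator {0..1} u \<partial>lborel)"

lemma one_minus_cos_le: "1 - cos y \<le> y\<^sup>2 / 2" for y :: real
proof -
  have "(sin (y / 2))\<^sup>2 \<le> (y / 2)\<^sup>2"
    using abs_sin_x_le_abs_x[of "y / 2"] by (simp only: abs_le_square_iff)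
  then show ?thesis using cos_double_sin[of "y / 2"] by (simp add: power_divide)
qed

text \<open>For \<open>x \<le> 2\<close> the Taylor bound gives at least
  \<open>x^2 * (1/6 - 4/120) = 2 * x^2 / 15\<close>, and for larger \<open>x\<close> the right side
  is at least 1/2; the constant 1/10 lies below both.\<close>

lemma one_minus_sinc_ge:
  fixes x :: real
  assumes "0 < x"
  shows "min (x\<^sup>2) 1 / 10 \<le> 1 - sin x / x"
proof (cases "x \<le> 2")
  case True
  have "\<bar>sin x - (\<Sum>m<5. sin_coeff m * x ^ m)\<bar> \<le> inverse (fact 5) * \<bar>x\<bar> ^ 5"
    by (rule Maclaurin_sin_bound)
  also have "(\<Sum>m<5. sin_coeff m * x ^ m) = x - x ^ 3 / 6"
  proof -
    have "{..<5} = {0, 1, 2, 3, 4::nat}" by auto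
    then show ?thesis by (simp add: sin_coeff_def fact_numeral)
  qed
  finally have "\<bar>sin x - (x - x ^ 3 / 6)\<bar> \<le> x ^ 5 / 120"
    using assms by (simp add: fact_numeral)
  then have "sin x \<le> x - x ^ 3 / 6 + x ^ 5 / 120" by linarith
  then have "sin x / x \<le> (x - x ^ 3 / 6 + x ^ 5 / 120) / x"
    using assms by (intro divide_right_mono) auto
  also have "\<dots> = 1 - x\<^sup>2 / 6 + x\<^sup>2 * x\<^sup>2 / 120"
    using assms by (simp add: field_simps eval_nat_numeral)
  finally have 1: "x\<^sup>2 / 6 - x\<^sup>2 * x\<^sup>2 / 120 \<le> 1 - sin x / x" by simp
  have "x\<^sup>2 \<le> 4" using True assms power_mono[of x 2 2] by simp
  then have "x\<^sup>2 * x\<^sup>2 \<le> x\<^sup>2 * 4" by (intro mult_left_mono) auto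
  with 1 have "x\<^sup>2 / 10 \<le> 1 - sin x / x" using zero_le_power2[of x] by linarith
  moreover have "min (x\<^sup>2) 1 \<le> x\<^sup>2" by simp
  ultimately show ?thesis by linarith
next
  case False
  have "sin x / x \<le> 1 / x" using assms by (intro divide_right_mono) auto
  also have "1 / x \<le> 1 / 2" using False by (intro divide_left_mono) auto
  finally have "1 / 10 \<le> 1 - sin x / x" by linarith
  moreover have "min (x\<^sup>2) 1 \<le> 1" by simp
  ultimately show ?thesis by linarith
qed

text \<open>Integrating over \<open>u\<close> gives the closed form \<open>1 - sin y / y\<close>
  with \<open>y = \<bar>x\<bar>\<close>, for which the lower bound is known.\<close>

lemma cos_average_ge: "ennreal (min (x\<^sup>2) 1 / 10) \<le> cos_average x"
proof (cases "x = 0")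
  case False
  define y where "y = \<bar>x\<bar>"
  have y: "y > 0" "min (y\<^sup>2) 1 = min (x\<^sup>2) 1" using False by (auto simp: y_def)
  have cy: "cos (u * x) = cos (u * y)" for u
    by (cases "x < 0") (auto simp: y_def)
  have "cos_average x = (\<integral>\<^sup>+ u. ennreal (1 - cos (u * y)) * indicator {0..1} u \<partial>lborel)"
    unfolding cos_average_def cy ..
  also have "\<dots> = ennreal ((1 - sin (1 * y) / y) - (0 - sin (0 * y) / y))"
    by (rule nn_integral_FTC_Icc[where F = "\<lambda>u. u - sin (u * y) / y"])
      (use y in \<open>auto intro!: derivative_eq_intros\<close>)
  also have "\<dots> = ennreal (1 - sin y / y)" by simp
  also have "\<dots> \<ge> ennreal (min (y\<^sup>2) 1 / 10)" by (intro ennreal_leI one_minus_sinc_ge y)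
  finally show ?thesis unfolding y .
qed simp

lemma one_minus_cos_le_min:
  assumes "0 \<le> u" "u \<le> 1"
  shows "1 - cos (u * x) \<le> 2 * min (x\<^sup>2) (1::real)"
proof -
  have "u\<^sup>2 * x\<^sup>2 \<le> 1 * x\<^sup>2" using assms by (intro mult_right_mono power_le_one) auto
  moreover have "1 - cos (u * x) \<le> (u * x)\<^sup>2 / 2" by (rule one_minus_cos_le)
  moreover have "(u * x)\<^sup>2 = u\<^sup>2 * x\<^sup>2" by (rule power_mult_distrib)
  ultimately have "1 - cos (u * x) \<le> 2 * x\<^sup>2" using zero_le_power2[of x] by linarith
  moreover have "1 - cos (u * x) \<le> 2" using cos_ge_minus_one[of "u * x"] by linarith
  ultimately show ?thesis by (cases "x\<^sup>2 \<le> 1") (auto simp: min_def)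
qed

lemma cos_average_le: "cos_average x \<le> 2 * ennreal (min (x\<^sup>2) 1)"
proof -
  have "cos_average x \<le> (\<integral>\<^sup>+ u. 2 * ennreal (min (x\<^sup>2) 1) * indicator {0..1::real} u \<partial>lborel)"
    unfolding cos_average_def
  proof (rule nn_integral_mono)
    fix u :: real
    show "ennreal (1 - cos (u * x)) * indicator {0..1} u \<le> 2 * ennreal (min (x\<^sup>2) 1) * indicator {0..1} u"
    proof (cases "u \<in> {0..1}")
      case True
      then have "ennreal (1 - cos (u * x)) \<le> ennreal (2 * min (x\<^sup>2) 1)"
        by (intro ennreal_leI one_minus_cos_le_min) auto
      then show ?thesis using True by (simp add: ennreal_mult)
    qed simp
  qed
  also have "\<dots> = 2 * ennreal (min (x\<^sup>2) 1)"
    by (subst nn_integral_cmult) auto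
  finally show ?thesis .
qed

text \<open>Tonelli's theorem and the two pointwise bounds on \<open>cos_average\<close>. An
  arbitrary sigma-finite measure is allowed so that the comparison applies both to the law on
  \<open>M\<close> and to the intensity \<open>N\<close>.\<close>

lemma tmom_le_cos_average:
  assumes [measurable]: "h \<in> borel_measurable M" and "sigma_finite_measure M"
  shows "tmom M h \<le> 10 * (\<integral>\<^sup>+ u. (\<integral>\<^sup>+ x. ennreal (1 - cos (u * h x)) \<partial>M) * indicator {0..1} u \<partial>lborel)"
    and "(\<integral>\<^sup>+ u. (\<integral>\<^sup>+ x. ennreal (1 - cos (u * h x)) \<partial>M) * indicator {0..1} u \<partial>lborel) \<le> 2 * tmom M h"
proof -
  interpret sigma_finite_measure M by fact
  interpret pair_sigma_finite lborel M ..
  have eq: "(\<integral>\<^sup>+ u. (\<integral>\<^sup>+ x. ennreal (1 - cos (u * h x)) \<partial>M) * indicator {0..1} u \<partial>lborel) = (\<integral>\<^sup>+ x. cos_average (h x) \<partial>M)"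
  proof -
    have "(\<integral>\<^sup>+ u. (\<integral>\<^sup>+ x. ennreal (1 - cos (u * h x)) \<partial>M) * indicator {0..1} u \<partial>lborel) =
      (\<integral>\<^sup>+ u. (\<integral>\<^sup>+ x. ennreal (1 - cos (u * h x)) * indicator {0..1} u \<partial>M) \<partial>lborel)"
      by (intro nn_integral_cong nn_integral_multc[symmetric]) measurable
    also have "\<dots> = (\<integral>\<^sup>+ x. cos_average (h x) \<partial>M)"
      unfolding cos_average_def by (intro Fubini'[symmetric]) measurable
    finally show ?thesis .
  qed
  have [measurable]: "(\<lambda>x. cos_average (h x)) \<in> borel_measurable M"
    unfolding cos_average_def by measurable
  have "ennreal (min (y\<^sup>2) 1) \<le> 10 * cos_average y" for y :: real
  proof -
    have "ennreal (min (y\<^sup>2) 1) = 10 * ennreal (min (y\<^sup>2) 1 / 10)"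
      using ennreal_mult[of 10 "min (y\<^sup>2) 1 / 10"] by simp
    also have "\<dots> \<le> 10 * cos_average y" by (intro mult_left_mono cos_average_ge) auto
    finally show ?thesis .
  qed
  then have "tmom M h \<le> (\<integral>\<^sup>+ x. 10 * cos_average (h x) \<partial>M)"
    unfolding tmom_def by (intro nn_integral_mono)
  also have "\<dots> = 10 * (\<integral>\<^sup>+ x. cos_average (h x) \<partial>M)" by (rule nn_integral_cmult) measurable
  finally show "tmom M h \<le> 10 * (\<integral>\<^sup>+ u. (\<integral>\<^sup>+ x. ennreal (1 - cos (u * h x)) \<partial>M) * indicator {0..1} u \<partial>lborel)"
    unfolding eq .
  have "(\<integral>\<^sup>+ x. cos_average (h x) \<partial>M) \<le> (\<integral>\<^sup>+ x. 2 * ennreal (min ((h x)\<^sup>2) 1) \<partial>M)"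
    by (intro nn_integral_mono cos_average_le)
  also have "\<dots> = 2 * tmom M h" unfolding tmom_def by (rule nn_integral_cmult) measurable
  finally show "(\<integral>\<^sup>+ u. (\<integral>\<^sup>+ x. ennreal (1 - cos (u * h x)) \<partial>M) * indicator {0..1} u \<partial>lborel) \<le> 2 * tmom M h"
    unfolding eq .
qed

section \<open>Antisymmetric integrands: comparing the integrand with its integral\<close>

locale symmetric_poisson_measure = poisson_measure M N J + jumps: sigma_finite_measure N
  for M :: "'w measure" and N :: "'c measure" and J :: "'w \<Rightarrow> 'c measure" +
  fixes r :: "'c \<Rightarrow> 'c"
  assumes r_measurable [measurable]: "r \<in> measurable N N" and distr_r: "distr N N r = N"
begin

definition antisym_fun :: "('c \<Rightarrow> real) \<Rightarrow> bool" where
  "antisym_fun h \<longleftrightarrow> (\<forall>x\<in>space N. h (r x) = - h x)"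

lemma antisym_fun_add: "antisym_fun g \<Longrightarrow> antisym_fun h \<Longrightarrow> antisym_fun (\<lambda>x. g x + h x)"
  and antisym_fun_diff: "antisym_fun g \<Longrightarrow> antisym_fun h \<Longrightarrow> antisym_fun (\<lambda>x. g x - h x)"
  and antisym_fun_cmult: "antisym_fun h \<Longrightarrow> antisym_fun (\<lambda>x. c * h x)"
  and antisym_fun_zero: "antisym_fun (\<lambda>x. 0)"
  by (simp_all add: antisym_fun_def)

text \<open>The reflection preserves \<open>N\<close> and reverses the sign of the integrand. The
  identity also covers integrands that are not integrable, for which the Bochner integral is
  0.\<close>

lemma integral_antisym:
  fixes F :: "real \<Rightarrow> real"
  assumes [measurable]: "h \<in> borel_measurable N" "F \<in> borel_measurable borel"
    and h: "antisym_fun h" and F: "\<And>y. F (- y) = - F y"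
  shows "(\<integral>x. F (h x) \<partial>N) = 0"
proof -
  have "(\<integral>x. F (h x) \<partial>N) = (\<integral>x. F (h x) \<partial>distr N N r)" by (simp add: distr_r)
  also have "\<dots> = (\<integral>x. F (h (r x)) \<partial>N)" by (rule integral_distr) measurable
  also have "\<dots> = (\<integral>x. - F (h x) \<partial>N)"
    by (rule Bochner_Integration.integral_cong) (use h F in \<open>auto simp: antisym_fun_def\<close>)
  finally show ?thesis by simp
qed

text \<open>The imaginary part of the exponent is the integral of \<open>sin (h x)\<close>, an odd
  function, and vanishes; hence the characteristic function is real and positive.\<close>

lemma cos_Jint:
  assumes h: "jfin h" "antisym_fun h"
  shows "integrable N (\<lambda>x. 1 - cos (h x))"
    and "(\<integral>\<omega>. cos (Jint h \<omega>) \<partial>M) = exp (- (\<integral>x. 1 - cos (h x) \<partial>N))"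
proof -
  have [measurable]: "h \<in> borel_measurable N" using h by (simp add: jfin_def)
  have int: "integrable N (\<lambda>x. iexp (h x) - 1)" by (rule integrable_iexp_minus_1[OF h(1)])
  have re: "Re (iexp y - 1) = - (1 - cos y)" and im: "Im (iexp y - 1) = sin y" for y :: real
    by (simp_all add: Re_exp Im_exp)
  show int2: "integrable N (\<lambda>x. 1 - cos (h x))"
    using integrable_minus[OF integrable_Re[OF int]] unfolding re by simp
  have "(\<integral>x. iexp (h x) - 1 \<partial>N) = complex_of_real (- (\<integral>x. 1 - cos (h x) \<partial>N))"
  proof (rule complex_eqI)
    have "Re (\<integral>x. iexp (h x) - 1 \<partial>N) = (\<integral>x. Re (iexp (h x) - 1) \<partial>N)"
      by (rule integral_Re[OF int, symmetric])
    then show "Re (\<integral>x. iexp (h x) - 1 \<partial>N) = Re (complex_of_real (- (\<integral>x. 1 - cos (h x) \<partial>N)))"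
      unfolding re by (simp only: Bochner_Integration.integral_minus Re_complex_of_real)
    have "Im (\<integral>x. iexp (h x) - 1 \<partial>N) = (\<integral>x. Im (iexp (h x) - 1) \<partial>N)"
      by (rule integral_Im[OF int, symmetric])
    also have "\<dots> = 0" unfolding im by (rule integral_antisym) (use h in auto)
    finally show "Im (\<integral>x. iexp (h x) - 1 \<partial>N) = Im (complex_of_real (- (\<integral>x. 1 - cos (h x) \<partial>N)))" by simp
  qed
  then have "(\<integral>\<omega>. iexp (Jint h \<omega>) \<partial>M) = complex_of_real (exp (- (\<integral>x. 1 - cos (h x) \<partial>N)))"
    unfolding char_Jint[OF h(1)] by (simp flip: exp_of_real)
  then have "Re (\<integral>\<omega>. iexp (Jint h \<omega>) \<partial>M) = exp (- (\<integral>x. 1 - cos (h x) \<partial>N))" by simp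
  moreover have "Re (\<integral>\<omega>. iexp (Jint h \<omega>) \<partial>M) = (\<integral>\<omega>. Re (iexp (Jint h \<omega>)) \<partial>M)"
    by (rule integral_Re[symmetric], rule integrable_const_bound[of _ 1]) auto
  ultimately show "(\<integral>\<omega>. cos (Jint h \<omega>) \<partial>M) = exp (- (\<integral>x. 1 - cos (h x) \<partial>N))"
    by (simp add: Re_exp)
qed

text \<open>Here \<open>\<psi>\<close> is the characteristic exponent along multiples of
  \<open>h\<close>. Both sides are put in nonnegative form so that they can be averaged over
  \<open>u\<close> and compared through \<open>\<psi> u\<close> and
  \<open>1 - exp (- \<psi> u)\<close>.\<close>

lemma one_minus_cos_Jint:
  assumes h: "jfin h" "antisym_fun h"
  obtains \<psi> where "\<And>u. 0 \<le> \<psi> u" "\<And>u. (\<integral>\<^sup>+ x. ennreal (1 - cos (u * h x)) \<partial>N) = ennreal (\<psi> u)"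
    "\<And>u. (\<integral>\<^sup>+ \<omega>. ennreal (1 - cos (u * Jint h \<omega>)) \<partial>M) = ennreal (1 - exp (- \<psi> u))"
proof -
  have [measurable]: "h \<in> borel_measurable N" using h by (simp add: jfin_def)
  define \<psi> where "\<psi> u = (\<integral>x. 1 - cos (u * h x) \<partial>N)" for u
  note uh = jfin_cmult[OF h(1)] antisym_fun_cmult[OF h(2)]
  have 0: "0 \<le> \<psi> u" for u unfolding \<psi>_def by (rule Bochner_Integration.integral_nonneg) simp
  have 1: "(\<integral>\<^sup>+ x. ennreal (1 - cos (u * h x)) \<partial>N) = ennreal (\<psi> u)" for u
    unfolding \<psi>_def by (rule nn_integral_eq_integral[OF cos_Jint(1)[OF uh]]) auto
  have ic: "integrable M (\<lambda>\<omega>. cos (u * Jint h \<omega>))" for u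
    by (rule integrable_const_bound[of _ 1]) auto
  have 2: "(\<integral>\<^sup>+ \<omega>. ennreal (1 - cos (u * Jint h \<omega>)) \<partial>M) = ennreal (1 - exp (- \<psi> u))" for u
  proof -
    have "(\<integral>\<^sup>+ \<omega>. ennreal (1 - cos (u * Jint h \<omega>)) \<partial>M) = ennreal (\<integral>\<omega>. 1 - cos (u * Jint h \<omega>) \<partial>M)"
      by (rule nn_integral_eq_integral) (use ic in auto)
    also have "(\<integral>\<omega>. 1 - cos (u * Jint h \<omega>) \<partial>M) = 1 - exp (- \<psi> u)"
      using ic cos_Jint(2)[OF uh, of u] by (simp add: Jint_cmult \<psi>_def prob_space)
    finally show ?thesis .
  qed
  show ?thesis using that 0 1 2 by blast
qed

text \<open>From \<open>1 - exp (- \<psi> u) \<le> \<psi> u\<close>; the constant is the product of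
  the factors 10 and 2 of the two cosine comparisons.\<close>

lemma tmom_Jint_le:
  assumes h: "jfin h" "antisym_fun h"
  shows "tmom M (Jint h) \<le> 20 * tmom N h"
proof -
  have [measurable]: "h \<in> borel_measurable N" using h by (simp add: jfin_def)
  obtain \<psi> where \<psi>: "\<And>u. 0 \<le> \<psi> u" "\<And>u. (\<integral>\<^sup>+ x. ennreal (1 - cos (u * h x)) \<partial>N) = ennreal (\<psi> u)"
    "\<And>u. (\<integral>\<^sup>+ \<omega>. ennreal (1 - cos (u * Jint h \<omega>)) \<partial>M) = ennreal (1 - exp (- \<psi> u))"
    by (rule one_minus_cos_Jint[OF h]) blast
  have "tmom M (Jint h) \<le> 10 * (\<integral>\<^sup>+ u. ennreal (1 - exp (- \<psi> u)) * indicator {0..1} u \<partial>lborel)"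
    unfolding \<psi>(3)[symmetric] by (rule tmom_le_cos_average) (auto intro: sigma_finite_measure_axioms)
  also have "\<dots> \<le> 10 * (\<integral>\<^sup>+ u. ennreal (\<psi> u) * indicator {0..1} u \<partial>lborel)"
  proof (intro mult_left_mono nn_integral_mono mult_right_mono ennreal_leI)
    show "1 - exp (- \<psi> u) \<le> \<psi> u" for u using exp_ge_add_one_self[of "- \<psi> u"] by linarith
  qed auto
  also have "\<dots> \<le> 10 * (2 * tmom N h)"
    unfolding \<psi>(2)[symmetric]
    by (intro mult_left_mono tmom_le_cos_average) (auto intro: jumps.sigma_finite_measure_axioms)
  finally show ?thesis by (simp flip: mult.assoc)
qed

text \<open>The quantity \<open>1 - exp (- \<psi> u)\<close> saturates at 1 and controls
  \<open>\<psi> u\<close> only when it stays away from 1. The bound 1/4 keeps it at most 1/2 for all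
  \<open>u\<close> in the unit interval, where it dominates half of \<open>\<psi> u\<close>; this
  gives \<open>\<psi> u \<le> 4 * t\<close> and the constant \<open>10 * 4\<close>.\<close>

lemma tmom_le_Jint:
  assumes h: "jfin h" "antisym_fun h" and small: "tmom M (Jint h) \<le> ennreal (1/4)"
  shows "tmom N h \<le> 40 * tmom M (Jint h)"
proof -
  have [measurable]: "h \<in> borel_measurable N" using h by (simp add: jfin_def)
  obtain \<psi> where \<psi>: "\<And>u. 0 \<le> \<psi> u" "\<And>u. (\<integral>\<^sup>+ x. ennreal (1 - cos (u * h x)) \<partial>N) = ennreal (\<psi> u)"
    "\<And>u. (\<integral>\<^sup>+ \<omega>. ennreal (1 - cos (u * Jint h \<omega>)) \<partial>M) = ennreal (1 - exp (- \<psi> u))"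
    by (rule one_minus_cos_Jint[OF h]) blast
  obtain t where t: "tmom M (Jint h) = ennreal t" "0 \<le> t" "t \<le> 1/4"
    using small by (cases "tmom M (Jint h)") (auto simp: top_unique)
  have bound: "\<psi> u \<le> 4 * t" if u: "0 \<le> u" "u \<le> 1" for u
  proof -
    have "ennreal (1 - exp (- \<psi> u)) \<le> (\<integral>\<^sup>+ \<omega>. 2 * ennreal (min ((Jint h \<omega>)\<^sup>2) 1) \<partial>M)"
      unfolding \<psi>(3)[symmetric]
    proof (rule nn_integral_mono)
      fix \<omega>
      show "ennreal (1 - cos (u * Jint h \<omega>)) \<le> 2 * ennreal (min ((Jint h \<omega>)\<^sup>2) 1)"
        using ennreal_leI[OF one_minus_cos_le_min[OF u, of "Jint h \<omega>"]] ennreal_mult[of 2 "min ((Jint h \<omega>)\<^sup>2) 1"] by simp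
    qed
    also have "\<dots> = 2 * ennreal t"
      unfolding t(1)[symmetric] tmom_def by (rule nn_integral_cmult) measurable
    also have "\<dots> = ennreal (2 * t)" using t by (simp add: ennreal_mult)
    finally have *: "1 - exp (- \<psi> u) \<le> 2 * t" using t by (simp add: ennreal_le_iff)
    then have "exp (- \<psi> u) \<ge> 1/2" using t by linarith
    then have "2 * exp (- \<psi> u) \<ge> 1" by linarith
    have "\<psi> u \<le> 1"
    proof (rule ccontr)
      assume "\<not> \<psi> u \<le> 1"
      then have "exp (- \<psi> u) \<le> exp (- 1)" by simp
      also have "exp (- 1) < (1/2::real)" using exp_ge_add_one_self[of "1::real"] e_less_272 exp_lower_Taylor_quadratic[of "1::real"]
        by (simp add: exp_minus field_simps)
      finally show False using \<open>exp (- \<psi> u) \<ge> 1/2\<close> by simp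
    qed
    \<comment> \<open>Multiplied by \<open>exp (- \<psi> u)\<close>, this becomes
      \<open>exp (- \<psi> u) * \<psi> u \<le> 1 - exp (- \<psi> u)\<close>, and the first factor is
      at least 1/2.\<close>
    have "1 + \<psi> u \<le> exp (\<psi> u)" by (rule exp_ge_add_one_self)
    then have "exp (- \<psi> u) * (1 + \<psi> u) \<le> exp (- \<psi> u) * exp (\<psi> u)" by (intro mult_left_mono) auto
    also have "\<dots> = 1" by (simp flip: exp_add)
    finally have "exp (- \<psi> u) * \<psi> u \<le> 1 - exp (- \<psi> u)" by (simp add: algebra_simps)
    moreover have "1/2 * \<psi> u \<le> exp (- \<psi> u) * \<psi> u"
      using \<open>exp (- \<psi> u) \<ge> 1/2\<close> \<psi>(1) by (intro mult_right_mono) auto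
    ultimately show ?thesis using * by linarith
  qed
  have "tmom N h \<le> 10 * (\<integral>\<^sup>+ u. ennreal (\<psi> u) * indicator {0..1} u \<partial>lborel)"
    unfolding \<psi>(2)[symmetric] by (rule tmom_le_cos_average) (auto intro: jumps.sigma_finite_measure_axioms)
  also have "\<dots> \<le> 10 * (\<integral>\<^sup>+ u. ennreal (4 * t) * indicator {0..1::real} u \<partial>lborel)"
    using bound by (intro mult_left_mono nn_integral_mono) (auto simp: indicator_def intro!: ennreal_leI)
  also have "\<dots> = 10 * ennreal (4 * t)"
    by (subst nn_integral_cmult) auto
  also have "\<dots> = 40 * tmom M (Jint h)" using t by (simp add: ennreal_mult flip: mult.assoc)
  finally show ?thesis .
qed

section \<open>The compensated Poisson integral of antisymmetric functions\<close>

text \<open>The closure of the graph of \<open>Jint\<close> on odd absolutely integrable functions,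
  in the truncated-moment distances of \<open>N\<close> and \<open>M\<close>. No compensator appears
  because it vanishes for odd functions. A relation is used instead of a function since
  \<open>Y\<close> is determined only up to null sets.\<close>

definition pint :: "('c \<Rightarrow> real) \<Rightarrow> ('w \<Rightarrow> real) \<Rightarrow> bool" where
  "pint g Y \<longleftrightarrow> g \<in> borel_measurable N \<and> antisym_fun g \<and> Y \<in> borel_measurable M \<and>
    (\<forall>e>0. \<exists>h. jfin h \<and> antisym_fun h \<and> tmom N (\<lambda>x. h x - g x) \<le> ennreal e \<and>
      tmom M (\<lambda>\<omega>. Jint h \<omega> - Y \<omega>) \<le> ennreal e)"

lemma pintD:
  assumes "pint g Y"
  shows "g \<in> borel_measurable N" "antisym_fun g" "Y \<in> borel_measurable M"
  using assms by (auto simp: pint_def)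

lemma pintE:
  assumes "pint g Y" "0 < e"
  obtains h where "jfin h" "antisym_fun h" "tmom N (\<lambda>x. h x - g x) \<le> ennreal e" "tmom M (\<lambda>\<omega>. Jint h \<omega> - Y \<omega>) \<le> ennreal e"
  using assms unfolding pint_def by blast

lemma pint_Jint: "jfin h \<Longrightarrow> antisym_fun h \<Longrightarrow> pint h (Jint h)"
  unfolding pint_def using jfin_measurable[of h] by (auto intro!: exI[of _ h])

lemma pint_cong_AE:
  assumes "pint g Y" and "AE \<omega> in M. Y \<omega> = Y' \<omega>" and [measurable]: "Y' \<in> borel_measurable M"
  shows "pint g Y'"
  unfolding pint_def
proof (intro conjI allI impI)
  fix e :: real assume "e > 0"
  then obtain h where h: "jfin h" "antisym_fun h" "tmom N (\<lambda>x. h x - g x) \<le> ennreal e" "tmom M (\<lambda>\<omega>. Jint h \<omega> - Y \<omega>) \<le> ennreal e"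
    using pintE[OF assms(1)] by blast
  have "tmom M (\<lambda>\<omega>. Jint h \<omega> - Y \<omega>) = tmom M (\<lambda>\<omega>. Jint h \<omega> - Y' \<omega>)"
    by (rule tmom_cong_AE) (use assms(2) in \<open>auto elim!: eventually_mono\<close>)
  then show "\<exists>h. jfin h \<and> antisym_fun h \<and> tmom N (\<lambda>x. h x - g x) \<le> ennreal e \<and> tmom M (\<lambda>\<omega>. Jint h \<omega> - Y' \<omega>) \<le> ennreal e"
    using h by metis
qed (use assms pintD[OF assms(1)] in auto)

lemma pint_add:
  assumes 1: "pint g1 Y1" and 2: "pint g2 Y2"
  shows "pint (\<lambda>x. g1 x + g2 x) (\<lambda>\<omega>. Y1 \<omega> + Y2 \<omega>)"
  unfolding pint_def
proof (intro conjI allI impI)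
  note [measurable] = pintD(1,3)[OF 1] pintD(1,3)[OF 2]
  show "(\<lambda>x. g1 x + g2 x) \<in> borel_measurable N" "(\<lambda>\<omega>. Y1 \<omega> + Y2 \<omega>) \<in> borel_measurable M" by measurable
  show "antisym_fun (\<lambda>x. g1 x + g2 x)" using pintD(2)[OF 1] pintD(2)[OF 2] by (rule antisym_fun_add)
  fix e :: real assume e: "e > 0"
  \<comment> \<open>Each use of the triangle inequality for \<open>tmom\<close> doubles both errors,
    so four quarters of \<open>e\<close> remain.\<close>
  then have e4: "e / 4 > 0" by simp
  obtain h1 where h1: "jfin h1" "antisym_fun h1" "tmom N (\<lambda>x. h1 x - g1 x) \<le> ennreal (e/4)" "tmom M (\<lambda>\<omega>. Jint h1 \<omega> - Y1 \<omega>) \<le> ennreal (e/4)"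
    using pintE[OF 1 e4] by blast
  obtain h2 where h2: "jfin h2" "antisym_fun h2" "tmom N (\<lambda>x. h2 x - g2 x) \<le> ennreal (e/4)" "tmom M (\<lambda>\<omega>. Jint h2 \<omega> - Y2 \<omega>) \<le> ennreal (e/4)"
    using pintE[OF 2 e4] by blast
  note [measurable] = jfin_measurable[OF h1(1)] jfin_measurable[OF h2(1)]
  have e2: "2 * ennreal (e/4) + 2 * ennreal (e/4) = ennreal e"
    using e ennreal_mult[of 2 "e/4"] ennreal_plus[of "e/2" "e/2"] by simp
  have "tmom N (\<lambda>x. (h1 x - g1 x) + (h2 x - g2 x)) \<le> ennreal e"
    unfolding e2[symmetric]
    by (rule order.trans[OF tmom_add]) (use h1 h2 in \<open>auto intro!: add_mono mult_left_mono\<close>)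
  moreover have "tmom M (\<lambda>x. (Jint h1 x - Y1 x) + (Jint h2 x - Y2 x)) \<le> ennreal e"
    unfolding e2[symmetric]
    by (rule order.trans[OF tmom_add]) (use h1 h2 in \<open>auto intro!: add_mono mult_left_mono\<close>)
  moreover have "tmom M (\<lambda>x. (Jint h1 x - Y1 x) + (Jint h2 x - Y2 x)) = tmom M (\<lambda>\<omega>. Jint (\<lambda>x. h1 x + h2 x) \<omega> - (Y1 \<omega> + Y2 \<omega>))"
    by (rule tmom_cong_AE) (use Jint_add_AE[OF h1(1) h2(1)] in \<open>auto elim!: eventually_mono\<close>)
  moreover have "tmom N (\<lambda>x. (h1 x - g1 x) + (h2 x - g2 x)) = tmom N (\<lambda>x. (h1 x + h2 x) - (g1 x + g2 x))"
    by (simp add: algebra_simps)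
  ultimately show "\<exists>h. jfin h \<and> antisym_fun h \<and> tmom N (\<lambda>x. h x - (g1 x + g2 x)) \<le> ennreal e \<and> tmom M (\<lambda>\<omega>. Jint h \<omega> - (Y1 \<omega> + Y2 \<omega>)) \<le> ennreal e"
    using h1 h2 by (intro exI[of _ "\<lambda>x. h1 x + h2 x"]) (auto intro: jfin_add antisym_fun_add)
qed

lemma pint_cmult:
  assumes 1: "pint g Y"
  shows "pint (\<lambda>x. c * g x) (\<lambda>\<omega>. c * Y \<omega>)"
  unfolding pint_def
proof (intro conjI allI impI)
  note [measurable] = pintD(1,3)[OF 1]
  show "(\<lambda>x. c * g x) \<in> borel_measurable N" "(\<lambda>\<omega>. c * Y \<omega>) \<in> borel_measurable M" by measurable
  show "antisym_fun (\<lambda>x. c * g x)" using pintD(2)[OF 1] by (rule antisym_fun_cmult)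
  fix e :: real assume e: "e > 0"
  define m where "m = max 1 (c\<^sup>2)"
  have m: "m \<ge> 1" by (simp add: m_def)
  have em: "e / m > 0" using e m by simp
  obtain h where h: "jfin h" "antisym_fun h" "tmom N (\<lambda>x. h x - g x) \<le> ennreal (e/m)" "tmom M (\<lambda>\<omega>. Jint h \<omega> - Y \<omega>) \<le> ennreal (e/m)"
    using pintE[OF 1 em] by blast
  note [measurable] = jfin_measurable[OF h(1)]
  have em': "ennreal m * ennreal (e / m) = ennreal e" using m e by (simp flip: ennreal_mult)
  have "tmom N (\<lambda>x. c * (h x - g x)) \<le> ennreal e" unfolding em'[symmetric]
    by (rule order.trans[OF tmom_cmult]) (use h in \<open>auto intro!: mult_left_mono simp: m_def\<close>)
  moreover have "tmom M (\<lambda>x. c * (Jint h x - Y x)) \<le> ennreal e" unfolding em'[symmetric]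
    by (rule order.trans[OF tmom_cmult]) (use h in \<open>auto intro!: mult_left_mono simp: m_def\<close>)
  ultimately show "\<exists>h. jfin h \<and> antisym_fun h \<and> tmom N (\<lambda>x. h x - c * g x) \<le> ennreal e \<and> tmom M (\<lambda>\<omega>. Jint h \<omega> - c * Y \<omega>) \<le> ennreal e"
    using h by (intro exI[of _ "\<lambda>x. c * h x"]) (auto intro: jfin_cmult antisym_fun_cmult simp: Jint_cmult right_diff_distrib)
qed

lemma pint_diff: "pint g1 Y1 \<Longrightarrow> pint g2 Y2 \<Longrightarrow> pint (\<lambda>x. g1 x - g2 x) (\<lambda>\<omega>. Y1 \<omega> - Y2 \<omega>)"
  using pint_add[of g1 Y1 "\<lambda>x. -1 * g2 x" "\<lambda>\<omega>. -1 * Y2 \<omega>"] pint_cmult[of g2 Y2 "-1"] by simp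

lemma pint_zero: "pint (\<lambda>x. 0) (\<lambda>\<omega>. 0)"
  using pint_Jint[OF jfin_zero antisym_fun_zero] by (simp add: Jint_def[abs_def])

lemma pint_sum:
  "(\<And>i. i \<in> I \<Longrightarrow> pint (g i) (Y i)) \<Longrightarrow> pint (\<lambda>x. \<Sum>i\<in>I. g i x) (\<lambda>\<omega>. \<Sum>i\<in>I. Y i \<omega>)"
  by (induction I rule: infinite_finite_induct) (auto intro: pint_zero pint_add)

text \<open>The bound with constant 20 survives the closure at the cost of two triangle
  inequalities, each doubling: \<open>80 = 2 * 20 * 2\<close>. The approximation errors add up to
  \<open>80 + 2 = 82\<close> times the tolerance.\<close>

lemma pint_tmom_le:
  assumes 1: "pint g Y"
  shows "tmom M Y \<le> 80 * tmom N g"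
proof (rule ennreal_le_epsilon)
  fix e :: real assume e: "e > 0"
  then have e': "e / 82 > 0" by simp
  obtain h where h: "jfin h" "antisym_fun h" "tmom N (\<lambda>x. h x - g x) \<le> ennreal (e/82)" "tmom M (\<lambda>\<omega>. Jint h \<omega> - Y \<omega>) \<le> ennreal (e/82)"
    using pintE[OF 1 e'] by blast
  note [measurable] = pintD(1,3)[OF 1] jfin_measurable[OF h(1)]
  let ?e = "ennreal (e / 82)"
  have "tmom M Y \<le> 2 * tmom M (Jint h) + 2 * tmom M (\<lambda>\<omega>. Y \<omega> - Jint h \<omega>)"
    by (rule tmom_le_add_diff) measurable
  also have "\<dots> \<le> 2 * (20 * tmom N h) + 2 * ?e"
    by (intro add_mono mult_left_mono tmom_Jint_le) (use h tmom_uminus_commute[of M Y] in auto)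
  also have "\<dots> \<le> 2 * (20 * (2 * tmom N g + 2 * ?e)) + 2 * ?e"
    by (intro add_mono mult_left_mono order.trans[OF tmom_le_add_diff[of h N g]]) (use h in auto)
  also have "\<dots> = 80 * tmom N g + 82 * ?e"
    by (simp add: distrib_left add.assoc flip: mult.assoc distrib_right)
  also have "82 * ?e = ennreal e" using e ennreal_mult[of 82 "e / 82"] by simp
  finally show "tmom M Y \<le> 80 * tmom N g + ennreal e" .
qed

text \<open>As for the upper bound, \<open>160 = 2 * 40 * 2\<close> with total error 162. The
  threshold 1/16 is such that \<open>2/16 + 2/16\<close> is the threshold 1/4 for the approximating
  pathwise integral.\<close>

lemma pint_tmom_ge:
  assumes 1: "pint g Y" and small: "tmom M Y \<le> ennreal (1/16)"
  shows "tmom N g \<le> 160 * tmom M Y"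
proof (rule ennreal_le_epsilon)
  fix e :: real assume e: "e > 0"
  define d where "d = min (1/16) (e / 162)"
  have d: "d > 0" "d \<le> 1/16" "162 * d \<le> e" using e by (auto simp: d_def)
  obtain h where h: "jfin h" "antisym_fun h" "tmom N (\<lambda>x. h x - g x) \<le> ennreal d" "tmom M (\<lambda>\<omega>. Jint h \<omega> - Y \<omega>) \<le> ennreal d"
    using pintE[OF 1 d(1)] by blast
  note [measurable] = pintD(1,3)[OF 1] jfin_measurable[OF h(1)]
  have J: "tmom M (Jint h) \<le> 2 * tmom M Y + 2 * ennreal d"
    by (rule order.trans[OF tmom_le_add_diff[of "Jint h" M Y]]) (use h in \<open>auto intro!: add_mono mult_left_mono\<close>)
  also have "\<dots> \<le> 2 * ennreal (1/16) + 2 * ennreal (1/16)"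
    using d by (intro add_mono mult_left_mono small ennreal_leI) auto
  also have "\<dots> = ennreal (1/4)"
    using ennreal_mult[of 2 "1/16"] ennreal_plus[of "1/8" "1/8"] by simp
  finally have "tmom N h \<le> 40 * tmom M (Jint h)" by (intro tmom_le_Jint h)
  also have "\<dots> \<le> 40 * (2 * tmom M Y + 2 * ennreal d)" by (intro mult_left_mono J) auto
  finally have *: "tmom N h \<le> 40 * (2 * tmom M Y + 2 * ennreal d)" .
  have "tmom N g \<le> 2 * tmom N h + 2 * tmom N (\<lambda>x. g x - h x)"
    by (rule tmom_le_add_diff) measurable
  also have "\<dots> \<le> 2 * (40 * (2 * tmom M Y + 2 * ennreal d)) + 2 * ennreal d"
    by (intro add_mono mult_left_mono *) (use h tmom_uminus_commute[of N g] in auto)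
  also have "\<dots> = 160 * tmom M Y + 162 * ennreal d"
    by (simp add: distrib_left add.assoc flip: mult.assoc distrib_right)
  also have "162 * ennreal d \<le> ennreal e"
    using d ennreal_mult[of 162 d] ennreal_leI[of "162 * d" e] by simp
  finally show "tmom N g \<le> 160 * tmom M Y + ennreal e" by (simp add: add_left_mono)
qed

lemma pint_unique:
  assumes "pint g Y" "pint g' Y'" "AE x in N. g x = g' x"
  shows "AE \<omega> in M. Y \<omega> = Y' \<omega>"
proof -
  note [measurable] = pintD(1,3)[OF assms(1)] pintD(1,3)[OF assms(2)]
  have "tmom N (\<lambda>x. g x - g' x) = 0" by (subst tmom_0_iff) (use assms(3) in auto)
  with pint_tmom_le[OF pint_diff[OF assms(1,2)]] have "tmom M (\<lambda>\<omega>. Y \<omega> - Y' \<omega>) = 0" by simp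
  then show ?thesis by (subst (asm) tmom_0_iff) auto
qed

lemma tmom_diff_to_0_Cauchy:
  assumes [measurable]: "\<And>k. g k \<in> borel_measurable K" "f \<in> borel_measurable K"
    and lim: "(\<lambda>k. tmom K (\<lambda>x. g k x - f x)) \<longlonglongrightarrow> 0" and e: "e > 0"
  shows "\<exists>n. \<forall>k\<ge>n. \<forall>l\<ge>n. tmom K (\<lambda>x. g k x - g l x) \<le> ennreal e"
proof -
  have "\<forall>\<^sub>F k in sequentially. tmom K (\<lambda>x. g k x - f x) < ennreal (e/4)"
    by (rule order_tendstoD[OF lim]) (use e in auto)
  then obtain n where n: "\<And>k. k \<ge> n \<Longrightarrow> tmom K (\<lambda>x. g k x - f x) \<le> ennreal (e/4)"
    unfolding eventually_sequentially by (meson less_imp_le)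
  have "tmom K (\<lambda>x. g k x - g l x) \<le> ennreal e" if "k \<ge> n" "l \<ge> n" for k l
  proof -
    have "tmom K (\<lambda>x. g k x - g l x) \<le> 2 * tmom K (\<lambda>x. g k x - f x) + 2 * tmom K (\<lambda>x. f x - g l x)"
      by (rule tmom_triangle) measurable
    also have "\<dots> \<le> 2 * ennreal (e/4) + 2 * ennreal (e/4)"
      by (intro add_mono mult_left_mono n that order.trans[OF eq_refl[OF tmom_uminus_commute] n]) auto
    also have "\<dots> = ennreal e"
      using e ennreal_mult[of 2 "e/4"] ennreal_plus[of "e/2" "e/2"] by simp
    finally show ?thesis .
  qed
  then show ?thesis by blast
qed

text \<open>Cutting off small values of \<open>g\<close>, rather than small jumps, keeps the
  function odd and makes it absolutely integrable: where \<open>\<bar>g\<bar> > 1 / (k + 1)\<close>,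
  the first power is at most \<open>k + 1\<close> times the square. The upper bound turns
  convergence of the cutoffs into a Cauchy property of their integrals.\<close>

lemma pint_exists:
  assumes [measurable]: "g \<in> borel_measurable N" and g: "antisym_fun g" and fin: "tmom N g < \<infinity>"
  obtains Y where "pint g Y"
proof -
  define h where "h k x = (if 1 / real (Suc k) < \<bar>g x\<bar> then g x else 0)" for k x
  have [measurable]: "h k \<in> borel_measurable N" for k unfolding h_def by measurable
  have odd: "antisym_fun (h k)" for k using g by (auto simp: antisym_fun_def h_def)
  have jf: "jfin (h k)" for k
  proof -
    have "(\<integral>\<^sup>+ x. ennreal (min \<bar>h k x\<bar> 1) \<partial>N) \<le> (\<integral>\<^sup>+ x. ennreal (real (Suc k)) * ennreal (min ((g x)\<^sup>2) 1) \<partial>N)"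
    proof (rule nn_integral_mono)
      fix x
      have "min \<bar>h k x\<bar> 1 \<le> real (Suc k) * min ((g x)\<^sup>2) 1"
      proof (cases "1 / real (Suc k) < \<bar>g x\<bar>")
        case True
        then have "1 < \<bar>g x\<bar> * real (Suc k)" by (simp add: field_simps)
        then have "\<bar>g x\<bar> * 1 \<le> \<bar>g x\<bar> * (\<bar>g x\<bar> * real (Suc k))" by (intro mult_left_mono) auto
        then have "\<bar>g x\<bar> \<le> real (Suc k) * (g x)\<^sup>2" by (simp add: power2_eq_square mult_ac)
        then show ?thesis using True by (auto simp: h_def min_def)
      qed (simp add: h_def)
      then show "ennreal (min \<bar>h k x\<bar> 1) \<le> ennreal (real (Suc k)) * ennreal (min ((g x)\<^sup>2) 1)"
        by (subst ennreal_mult[symmetric]) (auto intro: ennreal_leI)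
    qed
    also have "\<dots> = ennreal (real (Suc k)) * tmom N g" unfolding tmom_def by (rule nn_integral_cmult) measurable
    also have "\<dots> < \<infinity>" using fin by (simp add: ennreal_mult_less_top)
    finally show ?thesis by (simp add: jfin_def)
  qed
  have lim: "(\<lambda>k. tmom N (\<lambda>x. h k x - g x)) \<longlonglongrightarrow> 0"
  proof (rule tmom_dominated[where h = g])
    show "AE x in N. (\<lambda>k. h k x) \<longlonglongrightarrow> g x"
    proof (rule AE_I2)
      fix x
      show "(\<lambda>k. h k x) \<longlonglongrightarrow> g x"
      proof (cases "g x = 0")
        case False
        then have "\<forall>\<^sub>F k in sequentially. 1 / real (Suc k) < \<bar>g x\<bar>"
          by (intro order_tendstoD(2)[OF LIMSEQ_Suc[OF lim_1_over_n]]) auto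
        then have "\<forall>\<^sub>F k in sequentially. h k x = g x" by eventually_elim (simp add: h_def)
        then show ?thesis by (rule tendsto_eventually)
      qed (simp add: h_def)
    qed
  qed (use fin in \<open>auto simp: h_def\<close>)
  have "\<exists>Y \<in> borel_measurable M. (\<lambda>k. tmom M (\<lambda>\<omega>. Jint (h k) \<omega> - Y \<omega>)) \<longlonglongrightarrow> 0"
  proof (rule tmom_complete)
    fix e :: real assume "e > 0"
    then have "\<exists>n. \<forall>k\<ge>n. \<forall>l\<ge>n. tmom N (\<lambda>x. h k x - h l x) \<le> ennreal (e/20)"
      by (intro tmom_diff_to_0_Cauchy[OF _ _ lim]) auto
    then obtain n where n: "\<And>k l. k \<ge> n \<Longrightarrow> l \<ge> n \<Longrightarrow> tmom N (\<lambda>x. h k x - h l x) \<le> ennreal (e/20)" by blast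
    have "tmom M (\<lambda>\<omega>. Jint (h k) \<omega> - Jint (h l) \<omega>) \<le> ennreal e" if "k \<ge> n" "l \<ge> n" for k l
    proof -
      have "tmom M (\<lambda>\<omega>. Jint (h k) \<omega> - Jint (h l) \<omega>) = tmom M (Jint (\<lambda>x. h k x - h l x))"
        by (rule tmom_cong_AE) (use Jint_diff_AE[OF jf jf, of k l] in \<open>auto elim!: eventually_mono\<close>)
      also have "\<dots> \<le> 20 * tmom N (\<lambda>x. h k x - h l x)"
        by (intro tmom_Jint_le jfin_diff jf antisym_fun_diff odd)
      also have "\<dots> \<le> 20 * ennreal (e / 20)" by (intro mult_left_mono n that) auto
      also have "\<dots> = ennreal e" using \<open>e > 0\<close> ennreal_mult[of 20 "e/20"] by simp
      finally show ?thesis .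
    qed
    then show "\<exists>K. \<forall>k\<ge>K. \<forall>l\<ge>K. tmom M (\<lambda>\<omega>. Jint (h k) \<omega> - Jint (h l) \<omega>) \<le> ennreal e" by blast
  qed measurable
  then obtain Y where [measurable]: "Y \<in> borel_measurable M"
    and Y: "(\<lambda>k. tmom M (\<lambda>\<omega>. Jint (h k) \<omega> - Y \<omega>)) \<longlonglongrightarrow> 0" by blast
  have "pint g Y"
    unfolding pint_def
  proof (intro conjI allI impI g)
    fix e :: real assume "e > 0"
    then have "\<forall>\<^sub>F k in sequentially. tmom N (\<lambda>x. h k x - g x) < ennreal e \<and> tmom M (\<lambda>\<omega>. Jint (h k) \<omega> - Y \<omega>) < ennreal e"
      by (intro eventually_conj order_tendstoD[OF lim] order_tendstoD[OF Y]) auto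
    then obtain k where "tmom N (\<lambda>x. h k x - g x) < ennreal e" "tmom M (\<lambda>\<omega>. Jint (h k) \<omega> - Y \<omega>) < ennreal e"
      by (auto simp: eventually_sequentially)
    then show "\<exists>h. jfin h \<and> antisym_fun h \<and> tmom N (\<lambda>x. h x - g x) \<le> ennreal e \<and> tmom M (\<lambda>\<omega>. Jint h \<omega> - Y \<omega>) \<le> ennreal e"
      using jf odd less_imp_le by blast
  qed measurable
  then show ?thesis by (rule that)
qed

text \<open>The closed graph property. Since the integrals are Cauchy in probability, the lower
  bound makes the integrands Cauchy in \<open>tmom N\<close>; Fatou's lemma then identifies the
  almost everywhere limit \<open>f\<close> as their limit. It takes the place of a majorant for the
  integrands.\<close>

lemma pint_closed:
  assumes p: "\<And>k. pint (g k) (Y k)" and [measurable]: "f \<in> borel_measurable N" and f: "antisym_fun f"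
    and lim: "AE x in N. (\<lambda>k. g k x) \<longlonglongrightarrow> f x"
    and [measurable]: "Z \<in> borel_measurable M" and Z: "(\<lambda>k. tmom M (\<lambda>\<omega>. Y k \<omega> - Z \<omega>)) \<longlonglongrightarrow> 0"
  shows "pint f Z"
proof -
  note [measurable] = pintD(1,3)[OF p]
  have approx: "\<exists>n. \<forall>k\<ge>n. tmom N (\<lambda>x. g k x - f x) \<le> ennreal e" if e: "e > 0" for e
  proof -
    \<comment> \<open>The bound 1/16 makes the lower estimate applicable to differences of
      integrals, and \<open>e/160\<close> absorbs its constant.\<close>
    define d where "d = min (1/16) (e/160)"
    have d: "d > 0" "d \<le> 1/16" "160 * d \<le> e" using e by (auto simp: d_def)
    obtain n where n: "\<And>k l. k \<ge> n \<Longrightarrow> l \<ge> n \<Longrightarrow> tmom M (\<lambda>\<omega>. Y k \<omega> - Y l \<omega>) \<le> ennreal d"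
      using tmom_diff_to_0_Cauchy[OF _ _ Z d(1)] by (metis pintD(3)[OF p] assms(5))
    have "tmom N (\<lambda>x. g k x - f x) \<le> ennreal e" if k: "k \<ge> n" for k
    proof -
      have "tmom N (\<lambda>x. g k x - f x) \<le> liminf (\<lambda>l. tmom N (\<lambda>x. g k x - g l x))"
        by (rule tmom_Fatou) (use lim in \<open>auto elim!: eventually_mono intro!: tendsto_intros\<close>)
      also have "\<dots> \<le> liminf (\<lambda>l. ennreal e)"
      proof (rule Liminf_mono)
        have "tmom N (\<lambda>x. g k x - g l x) \<le> ennreal e" if l: "l \<ge> n" for l
        proof -
          have "tmom N (\<lambda>x. g k x - g l x) \<le> 160 * tmom M (\<lambda>\<omega>. Y k \<omega> - Y l \<omega>)"
            by (rule pint_tmom_ge[OF pint_diff[OF p p]])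
              (use order.trans[OF n[OF k l] ennreal_leI[OF d(2)]] in simp)
          also have "\<dots> \<le> 160 * ennreal d" by (intro mult_left_mono n k l) auto
          also have "\<dots> \<le> ennreal e" using d ennreal_mult[of 160 d] ennreal_leI[of "160 * d" e] by simp
          finally show ?thesis .
        qed
        then show "\<forall>\<^sub>F l in sequentially. tmom N (\<lambda>x. g k x - g l x) \<le> ennreal e"
          unfolding eventually_sequentially by blast
      qed
      also have "\<dots> = ennreal e" by (rule Liminf_const) simp
      finally show ?thesis .
    qed
    then show ?thesis by blast
  qed
  show ?thesis
    unfolding pint_def
  proof (intro conjI allI impI f)
    fix e :: real assume e: "e > 0"
    obtain n where n: "\<And>k. k \<ge> n \<Longrightarrow> tmom N (\<lambda>x. g k x - f x) \<le> ennreal (e/4)"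
      using approx[of "e/4"] e by auto
    have "\<forall>\<^sub>F k in sequentially. tmom M (\<lambda>\<omega>. Y k \<omega> - Z \<omega>) < ennreal (e/4)"
      by (rule order_tendstoD[OF Z]) (use e in auto)
    then obtain m where m: "\<And>k. k \<ge> m \<Longrightarrow> tmom M (\<lambda>\<omega>. Y k \<omega> - Z \<omega>) < ennreal (e/4)"
      by (auto simp: eventually_sequentially)
    define k where "k = max n m"
    have e4: "e / 4 > 0" using e by simp
    obtain h where h: "jfin h" "antisym_fun h" "tmom N (\<lambda>x. h x - g k x) \<le> ennreal (e/4)" "tmom M (\<lambda>\<omega>. Jint h \<omega> - Y k \<omega>) \<le> ennreal (e/4)"
      using pintE[OF p e4] by blast
    note [measurable] = jfin_measurable[OF h(1)]
    have e2: "2 * ennreal (e/4) + 2 * ennreal (e/4) = ennreal e"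
      using e ennreal_mult[of 2 "e/4"] ennreal_plus[of "e/2" "e/2"] by simp
    have "tmom N (\<lambda>x. h x - f x) \<le> ennreal e"
      unfolding e2[symmetric]
      by (rule order.trans[OF tmom_triangle[of h N "g k" f]]) (use h n[of k] in \<open>auto intro!: add_mono mult_left_mono simp: k_def\<close>)
    moreover have "tmom M (\<lambda>\<omega>. Jint h \<omega> - Z \<omega>) \<le> ennreal e"
      unfolding e2[symmetric]
      by (rule order.trans[OF tmom_triangle[of "Jint h" M "Y k" Z]]) (use h m[of k] in \<open>auto intro!: add_mono mult_left_mono simp: k_def less_imp_le\<close>)
    ultimately show "\<exists>h. jfin h \<and> antisym_fun h \<and> tmom N (\<lambda>x. h x - f x) \<le> ennreal e \<and> tmom M (\<lambda>\<omega>. Jint h \<omega> - Z \<omega>) \<le> ennreal e"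
      using h by blast
  qed measurable
qed

text \<open>One approximation at distance 1 suffices, since
  \<open>min (h^2) 1 \<le> min \<bar>h\<bar> 1\<close>. This is how membership in
  \<open>noise_L\<close> is later obtained from the mere existence of an integral.\<close>

lemma pint_tmom_finite:
  assumes 1: "pint g Y"
  shows "tmom N g < \<infinity>"
proof -
  obtain h where h: "jfin h" "tmom N (\<lambda>x. h x - g x) \<le> ennreal 1"
    using pintE[OF 1 zero_less_one] by blast
  note [measurable] = pintD(1,3)[OF 1] jfin_measurable[OF h(1)]
  have "tmom N h \<le> (\<integral>\<^sup>+ x. ennreal (min \<bar>h x\<bar> 1) \<partial>N)"
    unfolding tmom_def
  proof (intro nn_integral_mono ennreal_leI)
    fix x show "min ((h x)\<^sup>2) 1 \<le> min \<bar>h x\<bar> 1"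
      using mult_mono[of "\<bar>h x\<bar>" 1 "\<bar>h x\<bar>" "\<bar>h x\<bar>"] by (auto simp: min_def power2_eq_square)
  qed
  then have "tmom N h < \<infinity>" using h(1) by (simp add: jfin_def order.strict_trans1)
  have "tmom N g \<le> 2 * tmom N h + 2 * tmom N (\<lambda>x. g x - h x)" by (rule tmom_le_add_diff) measurable
  also have "\<dots> \<le> 2 * tmom N h + 2 * ennreal 1"
    by (intro add_left_mono mult_left_mono) (use h tmom_uminus_commute[of N g] in auto)
  also have "\<dots> < \<infinity>" using \<open>tmom N h < \<infinity>\<close> by (simp add: ennreal_mult_less_top)
  finally show ?thesis .
qed

end

section \<open>Removing the jumps in a set of finite intensity\<close>

context symmetric_poisson_measure
begin

definition r_invariant :: "'c set \<Rightarrow> bool" where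
  "r_invariant C \<longleftrightarrow> (\<forall>x\<in>space N. r x \<in> C \<longleftrightarrow> x \<in> C)"

lemma antisym_fun_indicator:
  "antisym_fun g \<Longrightarrow> r_invariant C \<Longrightarrow> antisym_fun (\<lambda>x. g x * indicator C x)"
  "antisym_fun g \<Longrightarrow> r_invariant C \<Longrightarrow> antisym_fun (\<lambda>x. g x * indicator (- C) x)"
  by (auto simp: antisym_fun_def r_invariant_def indicator_def)

lemma jfin_indicator_finite:
  assumes [measurable]: "g \<in> borel_measurable N" "C \<in> sets N" and "emeasure N C < \<infinity>"
  shows "jfin (\<lambda>x. g x * indicator C x)"
proof (rule jfin_finite_support)
  show "emeasure N {x \<in> space N. g x * indicator C x \<noteq> 0} < \<infinity>"
    by (rule order.strict_trans1[OF emeasure_mono assms(3)]) (auto simp: indicator_def)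
qed measurable

lemma pint_outside:
  assumes "pint g Y" and [measurable]: "C \<in> sets N" and "emeasure N C < \<infinity>" "r_invariant C"
  shows "pint (\<lambda>x. g x * indicator (- C) x) (\<lambda>\<omega>. Y \<omega> - Jint (\<lambda>x. g x * indicator C x) \<omega>)"
proof -
  have [measurable]: "g \<in> borel_measurable N" using assms(1) by (rule pintD)
  have "pint (\<lambda>x. g x * indicator C x) (Jint (\<lambda>x. g x * indicator C x))"
    by (intro pint_Jint jfin_indicator_finite antisym_fun_indicator pintD[OF assms(1)] assms)
  from pint_diff[OF assms(1) this]
  have "pint (\<lambda>x. g x - g x * indicator C x) (\<lambda>\<omega>. Y \<omega> - Jint (\<lambda>x. g x * indicator C x) \<omega>)" .
  moreover have "(\<lambda>x. g x - g x * indicator C x) = (\<lambda>x. g x * indicator (- C) x)"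
    by (auto simp: indicator_def)
  ultimately show ?thesis by simp
qed

text \<open>Setting an approximation to 0 on \<open>C\<close> brings it no farther from
  \<open>g\<close>, which vanishes there, but changes its integral; the distance to \<open>Z\<close>
  is therefore estimated afresh by the bound with constant 80.\<close>

lemma pint_approx_outside:
  assumes p: "pint g Z" and C: "r_invariant C" and [measurable]: "C \<in> sets N"
    and g0: "\<And>x. x \<in> C \<Longrightarrow> g x = 0" and e: "0 < e"
  obtains h where "jfin h" "\<And>x. x \<in> C \<Longrightarrow> h x = 0" "tmom M (\<lambda>\<omega>. Jint h \<omega> - Z \<omega>) \<le> ennreal e"
proof -
  have e': "e / 80 > 0" using e by simp
  obtain h where h: "jfin h" "antisym_fun h" "tmom N (\<lambda>x. h x - g x) \<le> ennreal (e / 80)"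
    using pintE[OF p e'] by blast
  note [measurable] = jfin_measurable[OF h(1)] pintD(1,3)[OF p]
  define h' where "h' x = h x * indicator (- C) x" for x
  have [measurable]: "h' \<in> borel_measurable N"
  proof -
    have "(\<lambda>x. if x \<in> C then 0 else h x) \<in> borel_measurable N" by measurable
    then show ?thesis by (rule measurable_cong[THEN iffD1, rotated]) (auto simp: h'_def)
  qed
  have h': "jfin h'" by (rule jfin_mono[OF h(1)]) (auto simp: h'_def indicator_def)
  have "antisym_fun h'" using antisym_fun_indicator(2)[OF h(2) C] by (simp add: h'_def[abs_def])
  from pint_tmom_le[OF pint_diff[OF pint_Jint[OF h' this] p]]
  have "tmom M (\<lambda>\<omega>. Jint h' \<omega> - Z \<omega>) \<le> 80 * tmom N (\<lambda>x. h' x - g x)" .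
  also have "\<dots> \<le> 80 * tmom N (\<lambda>x. h x - g x)"
    by (intro mult_left_mono tmom_mono_AE AE_I2) (auto simp: h'_def indicator_def g0)
  also have "\<dots> \<le> 80 * ennreal (e / 80)" using h by (intro mult_left_mono) auto
  also have "\<dots> = ennreal e" using e ennreal_mult[of 80 "e / 80"] by simp
  finally show ?thesis using that[OF h'] by (auto simp: h'_def)
qed

text \<open>The identity for pathwise integrals passes to limits in probability, after selecting a
  subsequence along which they converge almost surely.\<close>

lemma split_pint:
  fixes \<zeta> :: "real \<Rightarrow> real" and n :: nat
  assumes [measurable]: "C \<in> sets N" and C: "emeasure N C < \<infinity>" "r_invariant C"
    and p: "\<And>l. l < n \<Longrightarrow> pint (G l) (Z l)"
    and G0: "\<And>l x. l < n \<Longrightarrow> x \<in> C \<Longrightarrow> G l x = 0"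
    and \<zeta>: "continuous_on UNIV \<zeta>" and bd: "\<And>x. \<bar>\<zeta> x\<bar> \<le> b"
  shows "(\<integral>\<omega>. indicator {\<omega> \<in> space M. emeasure (J \<omega>) C = 0} \<omega> * \<zeta> (\<Sum>l<n. w l * \<bar>Z l \<omega>\<bar>) \<partial>M) =
    exp (- measure N C) * (\<integral>\<omega>. \<zeta> (\<Sum>l<n. w l * \<bar>Z l \<omega>\<bar>) \<partial>M)"
proof -
  have [measurable]: "\<zeta> \<in> borel_measurable borel" using \<zeta> by (rule borel_measurable_continuous_onI)
  have "\<forall>l i. \<exists>h. l < n \<longrightarrow> jfin h \<and> (\<forall>x\<in>C. h x = 0) \<and> tmom M (\<lambda>\<omega>. Jint h \<omega> - Z l \<omega>) \<le> ennreal (1 / real (Suc i))"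
  proof (intro allI)
    fix l i
    have "1 / real (Suc i) > 0" by simp
    show "\<exists>h. l < n \<longrightarrow> jfin h \<and> (\<forall>x\<in>C. h x = 0) \<and> tmom M (\<lambda>\<omega>. Jint h \<omega> - Z l \<omega>) \<le> ennreal (1 / real (Suc i))"
    proof (cases "l < n")
      case True
      obtain h where "jfin h" "\<And>x. x \<in> C \<Longrightarrow> h x = 0" "tmom M (\<lambda>\<omega>. Jint h \<omega> - Z l \<omega>) \<le> ennreal (1 / real (Suc i))"
        by (rule pint_approx_outside[OF p[OF True] C(2) _ G0[OF True] \<open>1 / real (Suc i) > 0\<close>]) auto
      then show ?thesis by blast
    qed blast
  qed
  then obtain h where "\<forall>l i. l < n \<longrightarrow> jfin (h l i) \<and> (\<forall>x\<in>C. h l i x = 0) \<and> tmom M (\<lambda>\<omega>. Jint (h l i) \<omega> - Z l \<omega>) \<le> ennreal (1 / real (Suc i))"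
    unfolding choice_iff by blast
  then have h: "\<And>l i. l < n \<Longrightarrow> jfin (h l i)" "\<And>l i x. l < n \<Longrightarrow> x \<in> C \<Longrightarrow> h l i x = 0"
    "\<And>l i. l < n \<Longrightarrow> tmom M (\<lambda>\<omega>. Jint (h l i) \<omega> - Z l \<omega>) \<le> ennreal (1 / real (Suc i))" by auto
  have hm: "Jint (h l i) \<in> borel_measurable M" "Z l \<in> borel_measurable M" if "l < n" for l i
    using h(1)[OF that] pintD(3)[OF p[OF that]] by (auto intro: Jint_measurable simp: jfin_def)
  \<comment> \<open>Adding the truncated squared errors over \<open>l\<close> yields one subsequence
    that serves all \<open>l < n\<close>.\<close>
  define u where "u i \<omega> = (\<Sum>l<n. min ((Jint (h l i) \<omega> - Z l \<omega>)\<^sup>2) 1)" for i \<omega>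
  have um[measurable]: "u i \<in> borel_measurable M" for i
    unfolding u_def using hm by (intro borel_measurable_sum) auto
  have u_int: "integrable M (u i)" for i
    unfolding u_def
    by (intro Bochner_Integration.integrable_sum integrable_const_bound[of _ 1]) (use hm in auto)
  have "(\<integral>\<omega>. norm (u i \<omega>) \<partial>M) \<le> real n * (1 / real (Suc i))" for i
  proof -
    have "(\<integral>\<omega>. norm (u i \<omega>) \<partial>M) = (\<integral>\<omega>. u i \<omega> \<partial>M)"
      by (intro Bochner_Integration.integral_cong) (auto simp: u_def sum_nonneg)
    also have "\<dots> = (\<Sum>l<n. \<integral>\<omega>. min ((Jint (h l i) \<omega> - Z l \<omega>)\<^sup>2) 1 \<partial>M)"
      unfolding u_def by (intro Bochner_Integration.integral_sum integrable_const_bound[of _ 1]) (use hm in auto)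
    also have "\<dots> \<le> (\<Sum>l<n. 1 / real (Suc i))"
    proof (rule sum_mono)
      fix l assume "l \<in> {..<n}"
      then have l: "l < n" by simp
      note [measurable] = hm[OF l]
      have "ennreal (\<integral>\<omega>. min ((Jint (h l i) \<omega> - Z l \<omega>)\<^sup>2) 1 \<partial>M) = tmom M (\<lambda>\<omega>. Jint (h l i) \<omega> - Z l \<omega>)"
        unfolding tmom_def
        by (rule nn_integral_eq_integral[symmetric], rule integrable_const_bound[of _ 1]) auto
      also have "\<dots> \<le> ennreal (1 / real (Suc i))" by (rule h(3)[OF l])
      finally show "(\<integral>\<omega>. min ((Jint (h l i) \<omega> - Z l \<omega>)\<^sup>2) 1 \<partial>M) \<le> 1 / real (Suc i)"
        by (simp add: ennreal_le_iff)
    qed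
    also have "\<dots> = real n * (1 / real (Suc i))" by simp
    finally show ?thesis .
  qed
  moreover have "(\<lambda>i. real n * (1 / real (Suc i))) \<longlonglongrightarrow> real n * 0"
    by (intro tendsto_mult tendsto_const LIMSEQ_Suc[OF lim_1_over_n])
  ultimately have "(\<lambda>i. \<integral>\<omega>. norm (u i \<omega>) \<partial>M) \<longlonglongrightarrow> 0"
    by (intro tendsto_sandwich[of "\<lambda>_. 0" "\<lambda>i. \<integral>\<omega>. norm (u i \<omega>) \<partial>M" sequentially "\<lambda>i. real n * (1 / real (Suc i))" 0])
      auto
  then obtain s :: "nat \<Rightarrow> nat" where s: "AE \<omega> in M. (\<lambda>i. u (s i) \<omega>) \<longlonglongrightarrow> 0"
    using tendsto_L1_AE_subseq[where u = u, OF u_int] by blast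
  have lim: "AE \<omega> in M. (\<lambda>i. \<zeta> (\<Sum>l<n. w l * \<bar>Jint (h l (s i)) \<omega>\<bar>)) \<longlonglongrightarrow> \<zeta> (\<Sum>l<n. w l * \<bar>Z l \<omega>\<bar>)"
    using s
  proof eventually_elim
    fix \<omega> assume u0: "(\<lambda>i. u (s i) \<omega>) \<longlonglongrightarrow> 0"
    have "(\<lambda>i. Jint (h l (s i)) \<omega>) \<longlonglongrightarrow> Z l \<omega>" if l: "l < n" for l
    proof -
      have "(\<lambda>i. min ((Jint (h l (s i)) \<omega> - Z l \<omega>)\<^sup>2) 1) \<longlonglongrightarrow> 0"
      proof (rule tendsto_sandwich[OF _ _ tendsto_const u0])
        show "\<forall>\<^sub>F i in sequentially. min ((Jint (h l (s i)) \<omega> - Z l \<omega>)\<^sup>2) 1 \<le> u (s i) \<omega>"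
          unfolding u_def using l by (intro always_eventually allI member_le_sum[of l "{..<n}" "\<lambda>l. min ((Jint (h l (s _)) \<omega> - Z l \<omega>)\<^sup>2) 1"]) auto
      qed auto
      then have "\<forall>\<^sub>F i in sequentially. min ((Jint (h l (s i)) \<omega> - Z l \<omega>)\<^sup>2) 1 < 1"
        by (rule order_tendstoD) simp
      then have "\<forall>\<^sub>F i in sequentially. min ((Jint (h l (s i)) \<omega> - Z l \<omega>)\<^sup>2) 1 = (Jint (h l (s i)) \<omega> - Z l \<omega>)\<^sup>2"
        by eventually_elim (simp add: min_def split: if_splits)
      with \<open>(\<lambda>i. min ((Jint (h l (s i)) \<omega> - Z l \<omega>)\<^sup>2) 1) \<longlonglongrightarrow> 0\<close>
      have "(\<lambda>i. (Jint (h l (s i)) \<omega> - Z l \<omega>)\<^sup>2) \<longlonglongrightarrow> 0" by (rule Lim_transform_eventually)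
      from tendsto_real_sqrt[OF this] have "(\<lambda>i. Jint (h l (s i)) \<omega> - Z l \<omega>) \<longlonglongrightarrow> 0"
        by (simp add: tendsto_rabs_zero_iff)
      then show ?thesis by (simp add: LIM_zero_iff)
    qed
    then have "(\<lambda>i. \<Sum>l<n. w l * \<bar>Jint (h l (s i)) \<omega>\<bar>) \<longlonglongrightarrow> (\<Sum>l<n. w l * \<bar>Z l \<omega>\<bar>)"
      by (intro tendsto_intros) auto
    then show "(\<lambda>i. \<zeta> (\<Sum>l<n. w l * \<bar>Jint (h l (s i)) \<omega>\<bar>)) \<longlonglongrightarrow> \<zeta> (\<Sum>l<n. w l * \<bar>Z l \<omega>\<bar>)"
      using \<zeta> by (intro isCont_tendsto_compose[of _ \<zeta>]) (auto simp: continuous_on_eq_continuous_at)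
  qed
  have Jm[measurable]: "(\<lambda>\<omega>. \<Sum>l<n. w l * \<bar>Jint (h l i) \<omega>\<bar>) \<in> borel_measurable M" for i
    using hm by (intro borel_measurable_sum borel_measurable_times borel_measurable_abs) auto
  have Zm[measurable]: "(\<lambda>\<omega>. \<Sum>l<n. w l * \<bar>Z l \<omega>\<bar>) \<in> borel_measurable M"
    using hm by (intro borel_measurable_sum borel_measurable_times borel_measurable_abs) auto
  have 1: "(\<lambda>i. \<integral>\<omega>. \<zeta> (\<Sum>l<n. w l * \<bar>Jint (h l (s i)) \<omega>\<bar>) \<partial>M) \<longlonglongrightarrow> (\<integral>\<omega>. \<zeta> (\<Sum>l<n. w l * \<bar>Z l \<omega>\<bar>) \<partial>M)"
    by (rule integral_dominated_convergence[where w = "\<lambda>_. b"]) (use lim bd in auto)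
  have 2: "(\<lambda>i. \<integral>\<omega>. indicator {\<omega> \<in> space M. emeasure (J \<omega>) C = 0} \<omega> * \<zeta> (\<Sum>l<n. w l * \<bar>Jint (h l (s i)) \<omega>\<bar>) \<partial>M) \<longlonglongrightarrow>
    (\<integral>\<omega>. indicator {\<omega> \<in> space M. emeasure (J \<omega>) C = 0} \<omega> * \<zeta> (\<Sum>l<n. w l * \<bar>Z l \<omega>\<bar>) \<partial>M)"
    by (rule integral_dominated_convergence[where w = "\<lambda>_. \<bar>b\<bar>"])
      (use lim bd order.trans[OF bd abs_ge_self] in \<open>auto elim!: eventually_mono intro!: tendsto_intros simp: indicator_def\<close>)
  have eq: "(\<integral>\<omega>. indicator {\<omega> \<in> space M. emeasure (J \<omega>) C = 0} \<omega> * \<zeta> (\<Sum>l<n. w l * \<bar>Jint (h l i) \<omega>\<bar>) \<partial>M) =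
    exp (- measure N C) * (\<integral>\<omega>. \<zeta> (\<Sum>l<n. w l * \<bar>Jint (h l i) \<omega>\<bar>) \<partial>M)" for i
    by (rule split_jfin) (use h C \<zeta> bd in auto)
  show ?thesis
    using LIMSEQ_unique[OF 2[unfolded eq] tendsto_mult_left[OF 1]] .
qed

lemma Jint_indicator_eq_0:
  assumes [measurable]: "C \<in> sets N"
  shows "\<omega> \<in> space M \<Longrightarrow> emeasure (J \<omega>) C = 0 \<Longrightarrow> Jint (\<lambda>x. g x * indicator C x) \<omega> = 0"
proof -
  assume w: "\<omega> \<in> space M" and 0: "emeasure (J \<omega>) C = 0"
  have "AE x in J \<omega>. x \<notin> C" by (rule AE_I[of _ _ C]) (use w 0 in \<open>auto simp: sets_J\<close>)
  then have "AE x in J \<omega>. g x * indicator C x = 0" by eventually_elim simp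
  then show ?thesis unfolding Jint_def by (rule integral_eq_zero_AE)
qed

text \<open>If the only jump in \<^term>\<open>C\<close> is at a point \<open>x\<close>, then the absolute value of the integral is
  \<open>\<bar>g x\<bar>\<close>; since measures on an abstract space with values in \<open>{0, 1}\<close> need not be point masses,
  this is expressed by an integral.\<close>

lemma abs_Jint_single_jump:
  assumes [measurable]: "C \<in> sets N" "g \<in> borel_measurable N"
    and w: "\<omega> \<in> space M" and 1: "emeasure (J \<omega>) C = 1"
  shows "\<bar>Jint (\<lambda>x. g x * indicator C x) \<omega>\<bar> = Jint (\<lambda>x. \<bar>g x\<bar> * indicator C x) \<omega>"
proof -
  note [measurable_cong] = sets_J[OF w]
  let ?P = "{x \<in> C. 0 < g x}"
  have CN: "C \<subseteq> space N" by (rule sets.sets_into_space) fact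
  have [measurable]: "?P \<in> sets N"
  proof -
    have "?P = {x \<in> space N. x \<in> C \<and> 0 < g x}" using CN by auto
    also have "\<dots> \<in> sets N" by measurable
    finally show ?thesis .
  qed
  have sum: "emeasure (J \<omega>) ?P + emeasure (J \<omega>) (C - ?P) = 1"
    using plus_emeasure[of ?P "J \<omega>" "C - ?P"] 1 by (auto simp: sets_J[OF w] Un_absorb1)
  \<comment> \<open>Two nonnegative integers with sum 1: one of the two sets carries no mass, so
    \<open>g\<close> has a constant sign on \<open>C\<close> up to a null set of
    \<open>J \<omega>\<close>.\<close>
  have "emeasure (J \<omega>) ?P = 0 \<or> emeasure (J \<omega>) (C - ?P) = 0"
  proof (rule emeasure_J_cases[OF w, of ?P])
    fix k assume k: "emeasure (J \<omega>) ?P = of_nat k"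
    show ?thesis
    proof (rule emeasure_J_cases[OF w, of "C - ?P"])
      fix l assume l: "emeasure (J \<omega>) (C - ?P) = of_nat l"
      have "of_nat (k + l) = (of_nat 1 :: ennreal)" using sum k l by simp
      then have "k + l = 1" by (simp only: of_nat_eq_iff)
      then show ?thesis using k l by (cases k) auto
    qed (use sum in auto)
  qed (use sum in auto)
  then show ?thesis
  proof
    assume "emeasure (J \<omega>) ?P = 0"
    then have "AE x in J \<omega>. x \<notin> ?P" by (intro AE_I[of _ _ ?P]) (auto simp: sets_J w)
    then have "AE x in J \<omega>. \<bar>g x\<bar> * indicator C x = - (g x * indicator C x)"
      by eventually_elim (auto simp: indicator_def)
    then have "Jint (\<lambda>x. \<bar>g x\<bar> * indicator C x) \<omega> = (\<integral>x. - (g x * indicator C x) \<partial>J \<omega>)"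
      unfolding Jint_def by (intro integral_cong_AE) auto
    then have *: "Jint (\<lambda>x. \<bar>g x\<bar> * indicator C x) \<omega> = - Jint (\<lambda>x. g x * indicator C x) \<omega>"
      by (simp add: Jint_def)
    moreover have "Jint (\<lambda>x. \<bar>g x\<bar> * indicator C x) \<omega> \<ge> 0"
      unfolding Jint_def by (rule Bochner_Integration.integral_nonneg) simp
    ultimately show ?thesis by simp
  next
    assume "emeasure (J \<omega>) (C - ?P) = 0"
    then have "AE x in J \<omega>. x \<notin> C - ?P" by (intro AE_I[of _ _ "C - ?P"]) (auto simp: sets_J w)
    then have "AE x in J \<omega>. \<bar>g x\<bar> * indicator C x = g x * indicator C x"
      by eventually_elim (auto simp: indicator_def)
    then have *: "Jint (\<lambda>x. \<bar>g x\<bar> * indicator C x) \<omega> = Jint (\<lambda>x. g x * indicator C x) \<omega>"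
      unfolding Jint_def by (intro integral_cong_AE) auto
    moreover have "Jint (\<lambda>x. \<bar>g x\<bar> * indicator C x) \<omega> \<ge> 0"
      unfolding Jint_def by (rule Bochner_Integration.integral_nonneg) simp
    ultimately show ?thesis by simp
  qed
qed

text \<open>With \<open>Z l\<close> for \<open>Y l\<close> without the contribution of the jumps in \<^term>\<open>C\<close>: if there is exactly one jump
  in \<^term>\<open>C\<close>, at a point with \<open>\<Sum> w l * \<bar>G l x\<bar> > 2 * L\<close>, then \<open>\<Sum> w l * \<bar>Y l\<bar>\<close> or \<open>\<Sum> w l * \<bar>Z l\<bar>\<close> is at
  least \<^term>\<open>L\<close>; the latter sum is independent of the number of jumps in \<^term>\<open>C\<close> and equals the former if
  there is none.\<close>

lemma jump_bound:
  fixes n :: nat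
  assumes [measurable]: "C \<in> sets N" and C: "emeasure N C < \<infinity>" "r_invariant C"
    and p: "\<And>l. l < n \<Longrightarrow> pint (G l) (Y l)" and w: "\<And>l. l < n \<Longrightarrow> 0 \<le> w l" and L: "0 < L"
  shows "measure N C * exp (- measure N C) \<le>
    measure N {x \<in> C. (\<Sum>l<n. w l * \<bar>G l x\<bar>) \<le> 2 * L} +
    (1 + exp (measure N C)) * measure M {\<omega> \<in> space M. L / 2 \<le> (\<Sum>l<n. w l * \<bar>Y l \<omega>\<bar>)}"
proof -
  define Z where "Z l \<omega> = Y l \<omega> - Jint (\<lambda>x. G l x * indicator C x) \<omega>" for l \<omega>
  \<comment> \<open>A continuous function that is 0 up to \<open>L / 2\<close> and 1 from
    \<open>L\<close> on; continuity is what the splitting identity requires, and the gap explains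
    the two thresholds.\<close>
  define \<zeta> where "\<zeta> x = max 0 (min 1 (2 * x / L - 1))" for x :: real
  have CN: "C \<subseteq> space N" by (rule sets.sets_into_space) fact
  have Gm: "G l \<in> borel_measurable N" and Ym: "Y l \<in> borel_measurable M" if "l < n" for l
    using pintD[OF p[OF that]] by auto
  have pZ: "pint (\<lambda>x. G l x * indicator (- C) x) (Z l)" if "l < n" for l
    unfolding Z_def[abs_def] by (rule pint_outside) (use p that C in auto)
  have \<zeta>c: "continuous_on UNIV \<zeta>" unfolding \<zeta>_def[abs_def] using L by (intro continuous_intros) auto
  have \<zeta>b: "0 \<le> \<zeta> x" "\<zeta> x \<le> 1" for x by (auto simp: \<zeta>_def)
  have \<zeta>m[measurable]: "\<zeta> \<in> borel_measurable borel" using \<zeta>c by (rule borel_measurable_continuous_onI)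
  let ?D = "{\<omega> \<in> space M. emeasure (J \<omega>) C = 0}"
  let ?SY = "\<lambda>\<omega>. \<Sum>l<n. w l * \<bar>Y l \<omega>\<bar>" and ?SZ = "\<lambda>\<omega>. \<Sum>l<n. w l * \<bar>Z l \<omega>\<bar>"
  have [measurable]: "?SY \<in> borel_measurable M" using Ym by (intro borel_measurable_sum) auto
  have [measurable]: "?SZ \<in> borel_measurable M" using pintD(3)[OF pZ] by (intro borel_measurable_sum) auto
  \<comment> \<open>If \<open>C\<close> contains no jump, \<open>?SZ\<close> and \<open>?SY\<close>
    agree. This event has probability \<open>exp (- measure N C)\<close> and is independent of
    \<open>?SZ\<close>, so conditioning on it loses only the factor
    \<open>exp (measure N C)\<close>.\<close>
  have PZ: "measure M {\<omega> \<in> space M. L \<le> ?SZ \<omega>} \<le> exp (measure N C) * measure M {\<omega> \<in> space M. L / 2 \<le> ?SY \<omega>}"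
  proof -
    have int: "integrable M (\<lambda>\<omega>. \<zeta> (?SZ \<omega>))"
      by (rule integrable_const_bound[of _ 1]) (use \<zeta>b in auto)
    have "measure M {\<omega> \<in> space M. L \<le> ?SZ \<omega>} = (\<integral>\<omega>. indicator {\<omega> \<in> space M. L \<le> ?SZ \<omega>} \<omega> \<partial>M)"
      by simp
    also have "\<dots> \<le> (\<integral>\<omega>. \<zeta> (?SZ \<omega>) \<partial>M)"
    proof (rule integral_mono)
      show "indicator {\<omega> \<in> space M. L \<le> ?SZ \<omega>} \<omega> \<le> \<zeta> (?SZ \<omega>)" for \<omega>
        using L \<zeta>b by (auto simp: indicator_def \<zeta>_def field_simps)
    qed (use int in \<open>auto simp: less_top[symmetric]\<close>)
    also have "(\<integral>\<omega>. \<zeta> (?SZ \<omega>) \<partial>M) = exp (measure N C) * (exp (- measure N C) * (\<integral>\<omega>. \<zeta> (?SZ \<omega>) \<partial>M))"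
      by (simp flip: mult.assoc exp_add)
    also have "exp (- measure N C) * (\<integral>\<omega>. \<zeta> (?SZ \<omega>) \<partial>M) = (\<integral>\<omega>. indicator ?D \<omega> * \<zeta> (?SZ \<omega>) \<partial>M)"
      by (rule split_pint[symmetric, where b = 1 and G = "\<lambda>l x. G l x * indicator (- C) x"]) (use C pZ \<zeta>c \<zeta>b in auto)
    also have "\<dots> \<le> (\<integral>\<omega>. indicator {\<omega> \<in> space M. L / 2 \<le> ?SY \<omega>} \<omega> \<partial>M)"
    proof (rule integral_mono)
      show "integrable M (\<lambda>\<omega>. indicator ?D \<omega> * \<zeta> (?SZ \<omega>))"
        by (rule integrable_const_bound[of _ 1]) (use \<zeta>b in \<open>auto simp: indicator_def\<close>)
      fix \<omega> assume w: "\<omega> \<in> space M"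
      show "indicator ?D \<omega> * \<zeta> (?SZ \<omega>) \<le> indicator {\<omega> \<in> space M. L / 2 \<le> ?SY \<omega>} \<omega>"
      proof (cases "\<omega> \<in> ?D")
        case True
        then have "?SZ \<omega> = ?SY \<omega>" using Jint_indicator_eq_0[of C \<omega>] by (simp add: Z_def)
        then show ?thesis using L w \<zeta>b by (auto simp: indicator_def \<zeta>_def field_simps max_def min_def)
      qed (auto simp: indicator_def)
    qed (auto simp: less_top[symmetric])
    also have "\<dots> = measure M {\<omega> \<in> space M. L / 2 \<le> ?SY \<omega>}" by simp
    finally show ?thesis by (simp add: mult_left_mono)
  qed
  define B where "B = {x \<in> C. (\<Sum>l<n. w l * \<bar>G l x\<bar>) \<le> 2 * L}"
  have Sm[measurable]: "(\<lambda>x. \<Sum>l<n. w l * \<bar>G l x\<bar>) \<in> borel_measurable N"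
    using Gm by (intro borel_measurable_sum) auto
  have [measurable]: "B \<in> sets N"
  proof -
    have "B = {x \<in> space N. x \<in> C \<and> (\<Sum>l<n. w l * \<bar>G l x\<bar>) \<le> 2 * L}" using CN by (auto simp: B_def)
    also have "\<dots> \<in> sets N" by measurable
    finally show ?thesis .
  qed
  have Bfin: "emeasure N B < \<infinity>"
    by (rule order.strict_trans1[OF emeasure_mono C(1)]) (auto simp: B_def)
  let ?E = "{\<omega> \<in> space M. emeasure (J \<omega>) C = 1}"
  let ?FB = "{\<omega> \<in> space M. emeasure (J \<omega>) B \<noteq> 0}"
  have "measure M ?FB = 1 - measure M {\<omega> \<in> space M. emeasure (J \<omega>) B = 0}"
    by (subst prob_neg[symmetric]) auto
  also have "\<dots> = 1 - exp (- measure N B)" by (subst prob_J_eq_0[OF _ Bfin]) auto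
  also have "\<dots> \<le> measure N B" using exp_ge_add_one_self[of "- measure N B"] by linarith
  finally have FB: "measure M ?FB \<le> measure N B" .
  have "measure N C * exp (- measure N C) = measure M ?E"
    using poisson_prob[OF _ C(1), of 1] by simp
  also have "\<dots> \<le> measure M (?FB \<union> {\<omega> \<in> space M. L \<le> ?SZ \<omega>} \<union> {\<omega> \<in> space M. L / 2 \<le> ?SY \<omega>})"
  proof (rule finite_measure_mono_AE)
    have ae: "AE \<omega> in M. \<forall>l\<in>{..<n}. integrable (J \<omega>) (\<lambda>x. G l x * indicator C x)"
      by (intro AE_finite_allI jfin_AE_integrable jfin_indicator_finite) (use Gm C in auto)
    show "AE \<omega> in M. \<omega> \<in> ?E \<longrightarrow> \<omega> \<in> ?FB \<union> {\<omega> \<in> space M. L \<le> ?SZ \<omega>} \<union> {\<omega> \<in> space M. L / 2 \<le> ?SY \<omega>}"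
      using ae
    proof (eventually_elim, intro impI)
      fix \<omega> assume int: "\<forall>l\<in>{..<n}. integrable (J \<omega>) (\<lambda>x. G l x * indicator C x)" and E: "\<omega> \<in> ?E"
      then have w': "\<omega> \<in> space M" and 1: "emeasure (J \<omega>) C = 1" by auto
      note [measurable_cong] = sets_J[OF w']
      show "\<omega> \<in> ?FB \<union> {\<omega> \<in> space M. L \<le> ?SZ \<omega>} \<union> {\<omega> \<in> space M. L / 2 \<le> ?SY \<omega>}"
      proof (cases "emeasure (J \<omega>) B = 0")
        case True
        have eq: "\<bar>G l x\<bar> * indicator C x = \<bar>G l x * indicator C x\<bar>" for l x by (simp add: abs_mult)
        have int': "integrable (J \<omega>) (\<lambda>x. \<bar>G l x\<bar> * indicator C x)" if "l < n" for l
          unfolding eq using int that by (intro integrable_abs) auto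
        \<comment> \<open>With mass 1 on \<open>C\<close> and none on \<open>B\<close>, the lower
          bound on the weighted sum can be integrated against \<open>J \<omega>\<close>. It yields
          \<open>2 * L \<le> ?SY + ?SZ\<close>, so one of the two sums is at least
          \<open>L\<close>.\<close>
        have "2 * L = (\<integral>x. 2 * L * indicator C x \<partial>J \<omega>)"
          using 1 by (simp add: measure_def)
        also have "\<dots> \<le> (\<integral>x. (\<Sum>l<n. w l * (\<bar>G l x\<bar> * indicator C x)) \<partial>J \<omega>)"
        proof (rule integral_mono_AE)
          show "integrable (J \<omega>) (\<lambda>x. 2 * L * indicator C x)" using 1 by (intro integrable_mult_right) auto
          show "integrable (J \<omega>) (\<lambda>x. \<Sum>l<n. w l * (\<bar>G l x\<bar> * indicator C x))" using int' by auto
          have "AE x in J \<omega>. x \<notin> B" by (intro AE_I[of _ _ B]) (use True in \<open>auto simp: sets_J w'\<close>)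
          then show "AE x in J \<omega>. 2 * L * indicator C x \<le> (\<Sum>l<n. w l * (\<bar>G l x\<bar> * indicator C x))"
            by eventually_elim (auto simp: B_def indicator_def)
        qed
        also have "\<dots> = (\<Sum>l<n. w l * Jint (\<lambda>x. \<bar>G l x\<bar> * indicator C x) \<omega>)"
          unfolding Jint_def using int' by (subst Bochner_Integration.integral_sum) auto
        also have "\<dots> = (\<Sum>l<n. w l * \<bar>Jint (\<lambda>x. G l x * indicator C x) \<omega>\<bar>)"
          using abs_Jint_single_jump[OF _ Gm w' 1] by (intro sum.cong) auto
        also have "\<dots> \<le> (\<Sum>l<n. w l * (\<bar>Y l \<omega>\<bar> + \<bar>Z l \<omega>\<bar>))"
          by (intro sum_mono mult_left_mono) (auto simp: Z_def w)
        also have "\<dots> = ?SY \<omega> + ?SZ \<omega>" by (simp add: distrib_left sum.distrib)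
        finally show ?thesis using w' L by auto
      qed (use w' in auto)
    qed
  qed measurable
  also have "\<dots> \<le> measure M (?FB \<union> {\<omega> \<in> space M. L \<le> ?SZ \<omega>}) + measure M {\<omega> \<in> space M. L / 2 \<le> ?SY \<omega>}"
    by (rule measure_Un_le) measurable
  also have "\<dots> \<le> measure M ?FB + measure M {\<omega> \<in> space M. L \<le> ?SZ \<omega>} + measure M {\<omega> \<in> space M. L / 2 \<le> ?SY \<omega>}"
    by (intro add_right_mono measure_Un_le) measurable
  finally show ?thesis using FB PZ unfolding B_def[symmetric] by (simp add: distrib_right)
qed

end

section \<open>The noise as an integral against the jump measure\<close>

text \<open>The mean value inequality on the left half plane, where the derivative of the
  exponential has modulus at most 1.\<close>

lemma norm_exp_minus_1_le:
  fixes w :: complex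
  assumes "Re w \<le> 0"
  shows "norm (exp w - 1) \<le> norm w"
proof -
  have "norm (exp w - exp 0) \<le> 1 * norm (w - 0)"
    by (rule field_differentiable_bound[OF convex_halfspace_Re_le[of 0], where f' = exp])
       (use assms in \<open>auto intro: DERIV_subset[OF DERIV_exp]\<close>)
  then show ?thesis by simp
qed

lemma norm_integral_le:
  fixes f :: "'a \<Rightarrow> 'b::{banach, second_countable_topology}"
  assumes "integrable M f" "integrable M g" "\<And>x. x \<in> space M \<Longrightarrow> norm (f x) \<le> g x"
  shows "norm (\<integral>x. f x \<partial>M) \<le> (\<integral>x. g x \<partial>M)"
  by (rule order.trans[OF integral_norm_bound integral_mono]) (use assms in auto)

context poisson_measure
begin

lemma jfin_integrable:
  assumes "integrable N h"
  shows "jfin h"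
proof -
  have "(\<integral>\<^sup>+ x. ennreal (min \<bar>h x\<bar> 1) \<partial>N) \<le> (\<integral>\<^sup>+ x. ennreal (norm (h x)) \<partial>N)"
    by (intro nn_integral_mono ennreal_leI) auto
  also have "\<dots> < \<infinity>" using assms by (simp add: integrable_iff_bounded)
  finally show ?thesis using assms by (simp add: jfin_def)
qed

text \<open>For \<open>V = Jint h - \<integral> h dN\<close>, the bound on \<open>1 - E cos (u V)\<close> comes from the characteristic function, so
  that no variance has to be computed; this is why the constant is not optimal.\<close>

lemma tmom_compensated_le:
  assumes h: "integrable N h" and h2: "integrable N (\<lambda>x. (h x)\<^sup>2)"
  shows "tmom M (\<lambda>\<omega>. Jint h \<omega> - (\<integral>x. h x \<partial>N)) \<le> 10 * (\<integral>\<^sup>+ x. ennreal ((h x)\<^sup>2) \<partial>N)"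
proof -
  define m where "m = (\<integral>x. h x \<partial>N)"
  define T where "T = (\<integral>x. (h x)\<^sup>2 \<partial>N)"
  have T: "0 \<le> T" unfolding T_def by (rule Bochner_Integration.integral_nonneg) simp
  have [measurable]: "h \<in> borel_measurable N" using h by auto
  have bound: "(\<integral>\<^sup>+ \<omega>. ennreal (1 - cos (u * (Jint h \<omega> - m))) \<partial>M) \<le> ennreal T"
    if u: "u \<in> {0..1}" for u
  proof -
    have uh: "jfin (\<lambda>x. u * h x)" by (intro jfin_integrable integrable_mult_right h)
    \<comment> \<open>The exponent of the compensated integral; subtracting the linear term makes
      the integrand quadratic in \<open>u * h x\<close>, hence the bound by
      \<open>u^2 / 2 * T\<close>.\<close>
    define w where "w = (\<integral>x. iexp (u * h x) - 1 - \<i> * complex_of_real (u * h x) \<partial>N)"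
    have int1: "integrable N (\<lambda>x. \<i> * complex_of_real (u * h x))"
      using h by (intro integrable_mult_right integrable_of_real)
    have w: "w = (\<integral>x. iexp (u * h x) - 1 \<partial>N) - \<i> * (u * m)"
      unfolding w_def m_def
      by (subst Bochner_Integration.integral_diff[OF integrable_iexp_minus_1[OF uh] int1]) simp
    have "cmod w \<le> (\<integral>x. u\<^sup>2 / 2 * (h x)\<^sup>2 \<partial>N)"
      unfolding w_def
    proof (rule norm_integral_le)
      show "integrable N (\<lambda>x. iexp (u * h x) - 1 - \<i> * complex_of_real (u * h x))"
        by (intro Bochner_Integration.integrable_diff integrable_iexp_minus_1[OF uh] int1)
      show "integrable N (\<lambda>x. u\<^sup>2 / 2 * (h x)\<^sup>2)" using h2 by simp
      show "cmod (iexp (u * h x) - 1 - \<i> * complex_of_real (u * h x)) \<le> u\<^sup>2 / 2 * (h x)\<^sup>2" for x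
        using iexp_approx1[of "u * h x" 1] by (simp add: power_mult_distrib power2_eq_square abs_mult algebra_simps)
    qed
    also have "\<dots> = u\<^sup>2 / 2 * T" by (simp add: T_def)
    also have "\<dots> \<le> 1 * T" using u T power_le_one[of u 2] by (intro mult_right_mono) auto
    finally have wT: "cmod w \<le> T" by simp
    have "(\<integral>\<omega>. iexp (u * (Jint h \<omega> - m)) \<partial>M) = (\<integral>\<omega>. iexp (Jint (\<lambda>x. u * h x) \<omega>) * exp (- (\<i> * (u * m))) \<partial>M)"
      by (rule Bochner_Integration.integral_cong) (simp_all add: Jint_cmult algebra_simps flip: exp_add)
    also have "\<dots> = exp (\<integral>x. iexp (u * h x) - 1 \<partial>N) * exp (- (\<i> * (u * m)))"
      by (simp add: char_Jint[OF uh])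
    also have "\<dots> = exp w" unfolding w by (simp flip: exp_add)
    finally have ch: "(\<integral>\<omega>. iexp (u * (Jint h \<omega> - m)) \<partial>M) = exp w" .
    have int: "integrable M (\<lambda>\<omega>. iexp (u * (Jint h \<omega> - m)))"
      by (rule integrable_const_bound[of _ 1]) auto
    have "cmod (exp w) \<le> (\<integral>\<omega>. 1 \<partial>M)"
      unfolding ch[symmetric] by (rule norm_integral_le[OF int]) auto
    \<comment> \<open>The exponential of \<open>w\<close> is the expectation of a variable of
      modulus 1, so the sign of \<open>Re w\<close> follows without computing it.\<close>
    then have "Re w \<le> 0" by (simp add: prob_space norm_exp_eq_Re)
    have ic: "integrable M (\<lambda>\<omega>. cos (u * (Jint h \<omega> - m)))"
      by (rule integrable_const_bound[of _ 1]) auto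
    have "(\<integral>\<omega>. cos (u * (Jint h \<omega> - m)) \<partial>M) = (\<integral>\<omega>. Re (iexp (u * (Jint h \<omega> - m))) \<partial>M)"
      by (simp add: Re_exp)
    also have "\<dots> = Re (exp w)" unfolding ch[symmetric] by (rule integral_Re[OF int])
    finally have "(\<integral>\<omega>. 1 - cos (u * (Jint h \<omega> - m)) \<partial>M) = - Re (exp w - 1)"
      using ic by (simp add: prob_space)
    also have "\<dots> \<le> cmod (exp w - 1)" using abs_Re_le_cmod[of "exp w - 1"] by linarith
    also have "\<dots> \<le> T" using norm_exp_minus_1_le[OF \<open>Re w \<le> 0\<close>] wT by linarith
    finally have "ennreal (\<integral>\<omega>. 1 - cos (u * (Jint h \<omega> - m)) \<partial>M) \<le> ennreal T" by (rule ennreal_leI)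
    then show ?thesis
      by (subst nn_integral_eq_integral) (use ic in auto)
  qed
  have "tmom M (\<lambda>\<omega>. Jint h \<omega> - m) \<le> 10 * (\<integral>\<^sup>+ u. (\<integral>\<^sup>+ \<omega>. ennreal (1 - cos (u * (Jint h \<omega> - m))) \<partial>M) * indicator {0..1} u \<partial>lborel)"
    by (rule tmom_le_cos_average) (auto intro: sigma_finite_measure_axioms)
  also have "\<dots> \<le> 10 * (\<integral>\<^sup>+ u. ennreal T * indicator {0..1::real} u \<partial>lborel)"
    using bound by (intro mult_left_mono nn_integral_mono) (auto simp: indicator_def)
  also have "\<dots> = 10 * ennreal T" by (subst nn_integral_cmult) auto
  also have "ennreal T = (\<integral>\<^sup>+ x. ennreal ((h x)\<^sup>2) \<partial>N)"
    unfolding T_def by (rule nn_integral_eq_integral[symmetric]) (use h2 in auto)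
  finally show ?thesis unfolding m_def .
qed

end

lemma tmom_le_nn_integral_square: "tmom M g \<le> (\<integral>\<^sup>+ x. ennreal ((g x)\<^sup>2) \<partial>M)"
  unfolding tmom_def by (intro nn_integral_mono ennreal_leI) auto

lemma nn_integral_square_diff_le:
  assumes [measurable]: "f \<in> borel_measurable M" "g \<in> borel_measurable M" "h \<in> borel_measurable M"
  shows "(\<integral>\<^sup>+ x. ennreal ((f x - h x)\<^sup>2) \<partial>M) \<le>
    2 * (\<integral>\<^sup>+ x. ennreal ((f x - g x)\<^sup>2) \<partial>M) + 2 * (\<integral>\<^sup>+ x. ennreal ((h x - g x)\<^sup>2) \<partial>M)"
proof -
  have "(\<integral>\<^sup>+ x. ennreal ((f x - h x)\<^sup>2) \<partial>M) \<le> (\<integral>\<^sup>+ x. 2 * ennreal ((f x - g x)\<^sup>2) + 2 * ennreal ((h x - g x)\<^sup>2) \<partial>M)"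
  proof (rule nn_integral_mono)
    fix x
    have "(a - b)\<^sup>2 \<le> 2 * a\<^sup>2 + 2 * b\<^sup>2" for a b :: real
      using zero_le_power2[of "a + b"] by (simp add: power2_sum power2_diff)
    from this[of "f x - g x" "h x - g x"]
    have "ennreal ((f x - h x)\<^sup>2) \<le> ennreal (2 * (f x - g x)\<^sup>2 + 2 * (h x - g x)\<^sup>2)" by (intro ennreal_leI) simp
    then show "ennreal ((f x - h x)\<^sup>2) \<le> 2 * ennreal ((f x - g x)\<^sup>2) + 2 * ennreal ((h x - g x)\<^sup>2)"
      by (simp add: ennreal_plus ennreal_mult)
  qed
  also have "\<dots> = 2 * (\<integral>\<^sup>+ x. ennreal ((f x - g x)\<^sup>2) \<partial>M) + 2 * (\<integral>\<^sup>+ x. ennreal ((h x - g x)\<^sup>2) \<partial>M)"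
    by (simp add: nn_integral_add nn_integral_cmult)
  finally show ?thesis .
qed

section \<open>The symmetric pure jump noise expressed through its jump measure\<close>

locale pure_jump_noise =
  fixes M :: "'w measure" and S :: "'a::euclidean_space set" and \<nu> :: "real measure"
    and J :: "'w \<Rightarrow> ('a \<times> real) measure" and X :: "'a set \<Rightarrow> 'w \<Rightarrow> real"
  assumes noise: "symmetric_pure_jump_noise M S \<nu> J X"
begin

abbreviation "N \<equiv> jump_intensity S \<nu>"
abbreviation "Leb \<equiv> restrict_space lborel S"

lemma S_borel [measurable]: "S \<in> sets borel"
  and levy: "symmetric_levy_measure \<nu>"
  and poisson: "poisson_random_measure M N J" and prob_M: "prob_space M"
  using noise unfolding symmetric_pure_jump_noise_def by blast+

lemma sets_\<nu> [measurable_cong]: "sets \<nu> = sets borel"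
  using levy unfolding symmetric_levy_measure_def by blast

lemma space_\<nu> [simp]: "space \<nu> = UNIV"
  using sets_eq_imp_space_eq[OF sets_\<nu>] by simp

lemma \<nu>_nonzero: "emeasure \<nu> UNIV \<noteq> 0" and \<nu>_0: "emeasure \<nu> {0} = 0"
  and \<nu>_square: "(\<integral>\<^sup>+ z. ennreal (min (z\<^sup>2) 1) \<partial>\<nu>) < \<infinity>"
  and \<nu>_sym: "A \<in> sets borel \<Longrightarrow> emeasure \<nu> (uminus ` A) = emeasure \<nu> A"
  using levy unfolding symmetric_levy_measure_def by blast+

lemma space_Leb [simp]: "space Leb = S"
  by (simp add: space_restrict_space)

lemma sets_Leb: "sets Leb = sets (restrict_space borel S)"
  by (simp add: sets_restrict_space)

lemma sets_Leb_iff: "A \<in> sets Leb \<longleftrightarrow> A \<in> sets borel \<and> A \<subseteq> S"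
  by (subst sets_restrict_space_iff) auto

lemma borel_measurable_Leb: "borel_measurable Leb = borel_measurable (restrict_space borel S)"
  by (rule measurable_cong_sets[OF sets_Leb refl])

lemma \<nu>_gt_finite:
  assumes "0 < e"
  shows "emeasure \<nu> {z. e < \<bar>z\<bar>} < \<infinity>"
proof -
  define d where "d = min e 1"
  have d: "0 < d" "d \<le> 1" "d \<le> e" using assms by (auto simp: d_def)
  have "emeasure \<nu> {z. e < \<bar>z\<bar>} \<le> emeasure \<nu> {z \<in> space \<nu>. d < \<bar>z\<bar>}"
    by (rule emeasure_mono) (use d in auto)
  also have "\<dots> \<le> ennreal (1 / d\<^sup>2) * tmom \<nu> (\<lambda>z. z)"
    by (rule emeasure_gt_le_tmom) (use d in auto)
  also have "\<dots> < \<infinity>" using \<nu>_square by (simp add: tmom_def ennreal_mult_less_top)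
  finally show ?thesis .
qed

lemma sigma_finite_\<nu>: "sigma_finite_measure \<nu>"
proof
  let ?A = "insert {0} (range (\<lambda>k::nat. {z::real. 1 / real (Suc k) < \<bar>z\<bar>}))"
  have "z \<in> \<Union>?A" for z :: real
  proof (cases "z = 0")
    case False
    then obtain n where "1 / real (Suc n) < \<bar>z\<bar>"
      using reals_Archimedean[of "\<bar>z\<bar>"] by (auto simp: inverse_eq_divide)
    then show ?thesis by blast
  qed simp
  then have "\<Union>?A = space \<nu>" by auto
  moreover have "emeasure \<nu> a \<noteq> \<infinity>" if "a \<in> ?A" for a
    using that \<nu>_gt_finite by (auto simp: \<nu>_0 less_top[symmetric])
  moreover have "countable ?A" "?A \<subseteq> sets \<nu>" by (auto simp: sets_\<nu>)
  ultimately show "\<exists>A. countable A \<and> A \<subseteq> sets \<nu> \<and> \<Union>A = space \<nu> \<and> (\<forall>a\<in>A. emeasure \<nu> a \<noteq> \<infinity>)"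
    by blast
qed

lemma sigma_finite_Leb: "sigma_finite_measure Leb"
  by (rule sigma_finite_measure_restrict_space[OF sigma_finite_lborel]) simp

sublocale \<nu>: sigma_finite_measure \<nu> by (rule sigma_finite_\<nu>)
sublocale Leb: sigma_finite_measure Leb by (rule sigma_finite_Leb)

lemma sigma_finite_N: "sigma_finite_measure N"
proof -
  interpret pair_sigma_finite Leb \<nu> ..
  show ?thesis unfolding jump_intensity_def by (rule P.sigma_finite_measure_axioms)
qed

lemma sets_N [measurable_cong]: "sets N = sets (Leb \<Otimes>\<^sub>M borel)"
  unfolding jump_intensity_def by (rule sets_pair_measure_cong[OF refl sets_\<nu>])

lemma space_N: "space N = S \<times> UNIV"
  by (simp add: jump_intensity_def space_pair_measure)

lemma distr_\<nu>: "distr \<nu> \<nu> uminus = \<nu>"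
proof (rule measure_eqI)
  fix A assume "A \<in> sets (distr \<nu> \<nu> uminus)"
  then have A: "A \<in> sets borel" by (simp add: sets_\<nu>)
  have "uminus -` A = uminus ` A" for A :: "real set" by (auto simp: image_iff) (metis minus_minus)
  then show "emeasure (distr \<nu> \<nu> uminus) A = emeasure \<nu> A"
    using A by (subst emeasure_distr) (auto simp: \<nu>_sym sets_\<nu>)
qed simp

lemma distr_N: "distr N N (\<lambda>(s, z). (s, - z)) = N"
proof -
  have "distr Leb Leb (\<lambda>s. s) \<Otimes>\<^sub>M distr \<nu> \<nu> uminus = distr (Leb \<Otimes>\<^sub>M \<nu>) (Leb \<Otimes>\<^sub>M \<nu>) (\<lambda>(x, y). (x, - y))"
    by (rule pair_measure_distr) (auto simp: distr_\<nu> sigma_finite_\<nu>)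
  then show ?thesis by (simp add: distr_\<nu> distr_id[unfolded id_def] jump_intensity_def)
qed

sublocale symmetric_poisson_measure M N J "\<lambda>(s, z). (s, - z)"
proof -
  interpret prob_space M by (rule prob_M)
  interpret N: sigma_finite_measure N by (rule sigma_finite_N)
  show "symmetric_poisson_measure M N J (\<lambda>(s, z). (s, - z))"
    by unfold_locales (auto simp: poisson distr_N)
qed

text \<open>Integrating \<open>f\<close> against the noise amounts to integrating this function
  against the compensated jump measure, and \<open>noise_L\<close> is finiteness of its truncated
  second moment.\<close>

definition jump_fun :: "('a \<Rightarrow> real) \<Rightarrow> 'a \<times> real \<Rightarrow> real" where
  "jump_fun f x = f (fst x) * snd x"

lemma fst_N [measurable]: "fst \<in> measurable N Leb"
  unfolding jump_intensity_def by (rule measurable_fst)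

lemma snd_N [measurable]: "snd \<in> borel_measurable N"
proof -
  have "snd \<in> measurable N \<nu>" unfolding jump_intensity_def by (rule measurable_snd)
  then show ?thesis by (simp add: measurable_cong_sets[OF refl sets_\<nu>])
qed

lemma jump_fun_measurable [measurable]:
  "f \<in> borel_measurable Leb \<Longrightarrow> jump_fun f \<in> borel_measurable N"
  unfolding jump_fun_def[abs_def] by (rule borel_measurable_times[OF measurable_compose[OF fst_N] snd_N])

lemma antisym_jump_fun: "antisym_fun (jump_fun f)"
  by (auto simp: antisym_fun_def jump_fun_def)

lemma AE_N_fst:
  assumes "AE s in Leb. P s"
  shows "AE x in N. P (fst x)"
proof -
  obtain A where A: "A \<in> sets Leb" "emeasure Leb A = 0" "{s \<in> space Leb. \<not> P s} \<subseteq> A"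
    using AE_E[OF assms] by metis
  have "emeasure N (A \<times> UNIV) = 0"
    unfolding jump_intensity_def
    using \<nu>.emeasure_pair_measure_Times[of A Leb UNIV] A sets.top[of \<nu>] by simp
  moreover have "A \<times> UNIV \<in> sets N" unfolding sets_N using A by auto
  ultimately show ?thesis
    using A(3) by (intro AE_I[of _ _ "A \<times> UNIV"]) (auto simp: space_N)
qed

lemma noise_L_iff: "f \<in> noise_L S \<nu> \<longleftrightarrow> f \<in> borel_measurable Leb \<and> tmom N (jump_fun f) < \<infinity>"
  unfolding noise_L_def tmom_def jump_fun_def borel_measurable_Leb by (simp add: case_prod_unfold)

lemma emeasure_Leb: "A \<in> sets borel \<Longrightarrow> A \<subseteq> S \<Longrightarrow> emeasure Leb A = emeasure lborel A"
  by (subst emeasure_restrict_space) auto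

text \<open>The bridge from the mean-square definition of the noise. The functions
  \<open>h k\<close> behind the compensated integral need not be odd, so their compensators need not
  vanish; they are compared in L2 with the odd cutoffs \<open>gk k\<close> of the small-jump part.
  The large jumps have finite intensity and enter as a pathwise integral.\<close>

lemma pint_X:
  assumes A: "A \<in> sets borel" "A \<subseteq> S" "emeasure lborel A < \<infinity>"
  shows "pint (jump_fun (indicator A)) (X A)"
proof -
  have A': "A \<in> sets Leb" "emeasure Leb A < \<infinity>" using A by (auto simp: sets_Leb_iff emeasure_Leb)
  note [measurable] = A'(1)
  have noiseA: "X A \<in> borel_measurable M \<and> (\<exists>Y. has_compensated_integral M N J
               (\<lambda>(s, z). z * indicator (A \<times> {z. \<bar>z\<bar> \<le> 1}) (s, z)) Y \<and>
             (AE \<omega> in M. X A \<omega> = Y \<omega> + (\<integral>(s, z). z * indicator (A \<times> {z. \<bar>z\<bar> > 1}) (s, z) \<partial>J \<omega>)))"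
    using noise A unfolding symmetric_pure_jump_noise_def by blast
  then have [measurable]: "X A \<in> borel_measurable M" by blast
  define g where "g = (\<lambda>(s, z::real). z * indicator (A \<times> {z. \<bar>z\<bar> \<le> 1}) (s, z) :: real)"
  define big where "big = (\<lambda>(s, z::real). z * indicator (A \<times> {z. \<bar>z\<bar> > 1}) (s, z) :: real)"
  obtain Y where hc: "has_compensated_integral M N J g Y" and XA: "AE \<omega> in M. X A \<omega> = Y \<omega> + Jint big \<omega>"
    using noiseA unfolding g_def big_def Jint_def by blast
  have [measurable]: "g \<in> borel_measurable N" "Y \<in> borel_measurable M" and g2: "integrable N (\<lambda>x. (g x)\<^sup>2)"
    using hc unfolding has_compensated_integral_def by blast+
  obtain h where h: "\<And>k. integrable N (h k)" "\<And>k. integrable N (\<lambda>x. (h k x)\<^sup>2)"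
    and hg: "(\<lambda>k. \<integral>\<^sup>+ x. ennreal ((h k x - g x)\<^sup>2) \<partial>N) \<longlonglongrightarrow> 0"
    and hY: "(\<lambda>k. \<integral>\<^sup>+ \<omega>. ennreal ((Jint (h k) \<omega> - (\<integral>x. h k x \<partial>N) - Y \<omega>)\<^sup>2) \<partial>M) \<longlonglongrightarrow> 0"
    using hc unfolding has_compensated_integral_def Jint_def by blast
  have hm[measurable]: "h k \<in> borel_measurable N" for k using h(1) by auto
  define c where "c k = {x :: 'a \<times> real. 1 / real (Suc k) < \<bar>snd x\<bar>}" for k
  have cN: "(\<lambda>x. indicator (c k) x :: real) \<in> borel_measurable N" for k
    unfolding c_def indicator_def by measurable
  define G where "G k x = jump_fun (indicator A) x * indicator (c k) x" for k x
  define gk where "gk k x = g x * indicator (c k) x" for k x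
  have [measurable]: "G k \<in> borel_measurable N" for k
    unfolding G_def by (rule borel_measurable_times[OF _ cN]) measurable
  have [measurable]: "gk k \<in> borel_measurable N" for k
    unfolding gk_def by (rule borel_measurable_times[OF _ cN]) measurable
  have bigm[measurable]: "big \<in> borel_measurable N"
  proof -
    have "(\<lambda>x. if 1 < \<bar>snd x\<bar> then jump_fun (indicator A) x else 0) \<in> borel_measurable N" by measurable
    also have "(\<lambda>x. if 1 < \<bar>snd x\<bar> then jump_fun (indicator A) x else 0) = big"
      by (auto simp: big_def jump_fun_def fun_eq_iff indicator_def)
    finally show ?thesis .
  qed
  have cfin: "emeasure N (A \<times> {z. e < \<bar>z\<bar>}) < \<infinity>" if "e > 0" for e
    unfolding jump_intensity_def
    using \<nu>.emeasure_pair_measure_Times[of A Leb "{z. e < \<bar>z\<bar>}"] A' \<nu>_gt_finite[OF that]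
    by (simp add: ennreal_mult_less_top sets_\<nu>)
  have cset: "A \<times> {z. e < \<bar>z\<bar>} \<in> sets N" for e unfolding sets_N by (intro pair_measureI A') measurable
  have jG: "jfin (G k)" for k
  proof (rule jfin_finite_support)
    show "emeasure N {x \<in> space N. G k x \<noteq> 0} < \<infinity>"
      by (rule order.strict_trans1[OF emeasure_mono[OF _ cset] cfin[of "1 / real (Suc k)"]])
         (auto simp: G_def jump_fun_def c_def indicator_def split: if_splits)
  qed measurable
  have jbig: "jfin big"
  proof (rule jfin_finite_support)
    show "emeasure N {x \<in> space N. big x \<noteq> 0} < \<infinity>"
      by (rule order.strict_trans1[OF emeasure_mono[OF _ cset] cfin[of 1]])
         (auto simp: big_def indicator_def split: if_splits)
  qed measurable
  have c1: "x \<in> c k" if "1 < \<bar>snd x\<bar>" for x k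
  proof -
    have "1 / real (Suc k) \<le> 1" by simp
    then show ?thesis using that unfolding c_def mem_Collect_eq by linarith
  qed
  \<comment> \<open>The cutoff level \<open>1 / (k + 1)\<close> is at most 1, so it affects only
    small jumps.\<close>
  have Gsplit: "G k x = gk k x + big x" for k x
    using c1[of x k] by (cases x) (auto simp: G_def gk_def g_def big_def jump_fun_def indicator_def)
  have gk_le: "\<bar>gk k x\<bar> \<le> \<bar>G k x\<bar>" and gk_le_g: "\<bar>gk k x\<bar> \<le> \<bar>g x\<bar>" and gk_le1: "\<bar>gk k x\<bar> \<le> 1" for k x
    by (cases x; auto simp: G_def gk_def g_def jump_fun_def indicator_def)+
  have jgk: "jfin (gk k)" for k by (rule jfin_mono[OF jG[of k]]) (auto simp: gk_le)
  have gk_int: "integrable N (gk k)" for k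
  proof (rule integrableI_bounded)
    have "(\<integral>\<^sup>+ x. ennreal (norm (gk k x)) \<partial>N) = (\<integral>\<^sup>+ x. ennreal (min \<bar>gk k x\<bar> 1) \<partial>N)"
      by (rule nn_integral_cong) (use gk_le1 in auto)
    also have "\<dots> < \<infinity>" using jgk by (simp add: jfin_def)
    finally show "(\<integral>\<^sup>+ x. ennreal (norm (gk k x)) \<partial>N) < \<infinity>" .
  qed measurable
  have gk2_int: "integrable N (\<lambda>x. (gk k x)\<^sup>2)" for k
    by (rule Bochner_Integration.integrable_bound[OF g2]) (auto simp: abs_le_square_iff[symmetric] gk_le_g)
  have gk0: "(\<integral>x. gk k x \<partial>N) = 0" for k
    by (rule integral_antisym[where F = "\<lambda>y. y"])
       (auto simp: antisym_fun_def gk_def g_def c_def indicator_def)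
  have lim_c: "(\<lambda>k. f * indicator (c k) x) \<longlonglongrightarrow> f" if "snd x = 0 \<longrightarrow> f = 0" for f :: real and x
  proof (cases "snd x = 0")
    case False
    then have "\<forall>\<^sub>F k in sequentially. 1 / real (Suc k) < \<bar>snd x\<bar>"
      by (intro order_tendstoD(2)[OF LIMSEQ_Suc[OF lim_1_over_n]]) auto
    then have "\<forall>\<^sub>F k in sequentially. f * indicator (c k) x = f" by eventually_elim (simp add: c_def)
    then show ?thesis by (rule tendsto_eventually)
  qed (use that in simp)
  have gkg: "(\<lambda>k. \<integral>\<^sup>+ x. ennreal ((gk k x - g x)\<^sup>2) \<partial>N) \<longlonglongrightarrow> 0"
  proof -
    have "(\<lambda>k. \<integral>\<^sup>+ x. ennreal ((gk k x - g x)\<^sup>2) \<partial>N) \<longlonglongrightarrow> (\<integral>\<^sup>+ x. 0 \<partial>N)"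
    proof (rule nn_integral_dominated_convergence[where w = "\<lambda>x. ennreal ((g x)\<^sup>2)"])
      show "AE x in N. ennreal ((gk j x - g x)\<^sup>2) \<le> ennreal ((g x)\<^sup>2)" for j
        by (rule AE_I2) (auto simp: gk_def indicator_def)
      show "(\<integral>\<^sup>+ x. ennreal ((g x)\<^sup>2) \<partial>N) < \<infinity>" using g2 by (simp add: integrable_iff_bounded)
      show "AE x in N. (\<lambda>k. ennreal ((gk k x - g x)\<^sup>2)) \<longlonglongrightarrow> 0"
      proof (rule AE_I2)
        fix x
        have "(\<lambda>k. gk k x) \<longlonglongrightarrow> g x" unfolding gk_def by (rule lim_c) (cases x, simp add: g_def)
        then have "(\<lambda>k. ennreal ((gk k x - g x)\<^sup>2)) \<longlonglongrightarrow> ennreal ((g x - g x)\<^sup>2)" by (intro tendsto_intros)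
        then show "(\<lambda>k. ennreal ((gk k x - g x)\<^sup>2)) \<longlonglongrightarrow> 0" by simp
      qed
    qed measurable
    then show ?thesis by simp
  qed
  define a where "a k = (\<integral>\<^sup>+ x. ennreal ((gk k x - g x)\<^sup>2) \<partial>N)" for k
  define b where "b k = (\<integral>\<^sup>+ x. ennreal ((h k x - g x)\<^sup>2) \<partial>N)" for k
  define d where "d k = (\<integral>\<^sup>+ \<omega>. ennreal ((Jint (h k) \<omega> - (\<integral>x. h k x \<partial>N) - Y \<omega>)\<^sup>2) \<partial>M)" for k
  have abd: "a \<longlonglongrightarrow> 0" "b \<longlonglongrightarrow> 0" "d \<longlonglongrightarrow> 0"
    using gkg hg hY unfolding a_def[abs_def] b_def[abs_def] d_def[abs_def] by auto
  \<comment> \<open>The large-jump part cancels. The compensated integral of \<open>h k\<close> is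
    inserted between \<open>Jint (gk k)\<close> and \<open>Y\<close>: its distance from the former
    is that of a compensated integral of \<open>gk k - h k\<close>, as \<open>gk k\<close> has
    compensator 0, and its distance from the latter is \<open>d k\<close>.\<close>
  have main: "tmom M (\<lambda>\<omega>. Jint (G k) \<omega> - X A \<omega>) \<le> 2 * (10 * (2 * a k + 2 * b k)) + 2 * d k" for k
  proof -
    have int_diff: "integrable N (\<lambda>x. gk k x - h k x)" using gk_int h by auto
    have int_diff2: "integrable N (\<lambda>x. (gk k x - h k x)\<^sup>2)"
    proof (rule Bochner_Integration.integrable_bound)
      show "integrable N (\<lambda>x. 2 * (gk k x)\<^sup>2 + 2 * (h k x)\<^sup>2)" using gk2_int h by auto
      have "(p - q)\<^sup>2 \<le> 2 * p\<^sup>2 + 2 * q\<^sup>2" for p q :: real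
        using zero_le_power2[of "p + q"] by (simp add: power2_sum power2_diff)
      then show "AE x in N. norm ((gk k x - h k x)\<^sup>2) \<le> norm (2 * (gk k x)\<^sup>2 + 2 * (h k x)\<^sup>2)"
        by (intro AE_I2) auto
    qed measurable
    have "tmom M (\<lambda>\<omega>. Jint (G k) \<omega> - X A \<omega>) = tmom M (\<lambda>\<omega>. Jint (gk k) \<omega> - Y \<omega>)"
    proof (rule tmom_cong_AE)
      have "AE \<omega> in M. Jint (\<lambda>x. gk k x + big x) \<omega> = Jint (gk k) \<omega> + Jint big \<omega>"
        by (rule Jint_add_AE[OF jgk jbig])
      moreover have "G k = (\<lambda>x. gk k x + big x)" by (rule ext) (rule Gsplit)
      ultimately show "AE \<omega> in M. Jint (G k) \<omega> - X A \<omega> = Jint (gk k) \<omega> - Y \<omega>"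
        using XA by auto
    qed
    also have "\<dots> \<le> 2 * tmom M (\<lambda>\<omega>. Jint (gk k) \<omega> - (Jint (h k) \<omega> - (\<integral>x. h k x \<partial>N))) +
        2 * tmom M (\<lambda>\<omega>. (Jint (h k) \<omega> - (\<integral>x. h k x \<partial>N)) - Y \<omega>)"
      by (rule tmom_triangle) measurable
    also have "\<dots> \<le> 2 * (10 * (2 * a k + 2 * b k)) + 2 * d k"
    proof (intro add_mono mult_left_mono)
      show "tmom M (\<lambda>\<omega>. (Jint (h k) \<omega> - (\<integral>x. h k x \<partial>N)) - Y \<omega>) \<le> d k"
        unfolding d_def by (rule tmom_le_nn_integral_square)
      have "tmom M (\<lambda>\<omega>. Jint (gk k) \<omega> - (Jint (h k) \<omega> - (\<integral>x. h k x \<partial>N))) =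
        tmom M (\<lambda>\<omega>. Jint (\<lambda>x. gk k x - h k x) \<omega> - (\<integral>x. gk k x - h k x \<partial>N))"
      proof (rule tmom_cong_AE)
        have "(\<integral>x. gk k x - h k x \<partial>N) = - (\<integral>x. h k x \<partial>N)"
          using gk_int h gk0[of k] by simp
        then show "AE \<omega> in M. Jint (gk k) \<omega> - (Jint (h k) \<omega> - (\<integral>x. h k x \<partial>N)) =
          Jint (\<lambda>x. gk k x - h k x) \<omega> - (\<integral>x. gk k x - h k x \<partial>N)"
          using Jint_diff_AE[OF jgk[of k] jfin_integrable[OF h(1)[of k]]] by auto
      qed
      also have "\<dots> \<le> 10 * (\<integral>\<^sup>+ x. ennreal ((gk k x - h k x)\<^sup>2) \<partial>N)"
        by (rule tmom_compensated_le[OF int_diff int_diff2])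
      also have "\<dots> \<le> 10 * (2 * a k + 2 * b k)"
        unfolding a_def b_def by (intro mult_left_mono nn_integral_square_diff_le) auto
      finally show "tmom M (\<lambda>\<omega>. Jint (gk k) \<omega> - (Jint (h k) \<omega> - (\<integral>x. h k x \<partial>N))) \<le> 10 * (2 * a k + 2 * b k)" .
    qed auto
    finally show ?thesis .
  qed
  have "(\<lambda>k. 2 * (10 * (2 * a k + 2 * b k)) + 2 * d k) \<longlonglongrightarrow> 2 * (10 * (2 * 0 + 2 * 0)) + 2 * 0"
    by (intro tendsto_add ennreal_tendsto_cmult abd) auto
  then have MX: "(\<lambda>k. tmom M (\<lambda>\<omega>. Jint (G k) \<omega> - X A \<omega>)) \<longlonglongrightarrow> 0"
    by (intro tendsto_0_le_ennreal[OF main]) simp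
  have anti: "antisym_fun (G k)" for k
    by (auto simp: antisym_fun_def G_def jump_fun_def c_def indicator_def)
  show ?thesis
  proof (rule pint_closed[OF pint_Jint[OF jG anti] _ antisym_jump_fun _ _ MX])
    show "AE x in N. (\<lambda>k. G k x) \<longlonglongrightarrow> jump_fun (indicator A) x"
      unfolding G_def by (intro AE_I2 lim_c) (simp add: jump_fun_def)
  qed measurable
qed

end

section \<open>The noise integral\<close>

context pure_jump_noise
begin

lemma conv_in_prob_iff:
  "conv_in_prob M Z Y \<longleftrightarrow> (\<forall>k. Z k \<in> borel_measurable M) \<and> Y \<in> borel_measurable M \<and>
     (\<lambda>k. tmom M (\<lambda>\<omega>. Z k \<omega> - Y \<omega>)) \<longlonglongrightarrow> 0"
  by (rule conv_in_prob_iff_tmom)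

lemma pint_simple:
  assumes \<phi>: "Bochner_Integration.simple_bochner_integrable Leb \<phi>" and A: "A \<in> sets borel" "A \<subseteq> S"
  shows "pint (jump_fun (\<lambda>s. \<phi> s * indicator A s)) (simple_noise_integral S X A \<phi>)"
proof -
  have sf: "simple_function Leb \<phi>" and fin: "emeasure Leb {s \<in> S. \<phi> s \<noteq> 0} \<noteq> \<infinity>"
    using \<phi> by (auto simp: Bochner_Integration.simple_bochner_integrable.simps)
  define B where "B y = A \<inter> {s \<in> S. \<phi> s = y}" for y
  have [measurable]: "\<phi> \<in> borel_measurable Leb" using sf by (rule borel_measurable_simple_function)
  have B: "B y \<in> sets borel" "B y \<subseteq> S" for y
  proof -
    have "{s \<in> space Leb. \<phi> s = y} \<in> sets Leb" by measurable
    then have "{s \<in> S. \<phi> s = y} \<in> sets borel" by (simp add: sets_Leb_iff)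
    then show "B y \<in> sets borel" unfolding B_def using A by auto
    show "B y \<subseteq> S" using A by (auto simp: B_def)
  qed
  have *: "pint (\<lambda>x. y * jump_fun (indicator (B y)) x) (\<lambda>\<omega>. y * X (B y) \<omega>)" for y
  \<comment> \<open>Only the level sets of nonzero values are known to have finite measure; for
    \<open>y = 0\<close> the coefficient makes the term vanish.\<close>
  proof (cases "y = 0")
    case False
    have "{s \<in> S. \<phi> s \<noteq> 0} \<in> sets Leb"
    proof -
      have "{s \<in> space Leb. \<phi> s \<noteq> 0} \<in> sets Leb" by measurable
      then show ?thesis by simp
    qed
    then have "emeasure Leb (B y) \<le> emeasure Leb {s \<in> S. \<phi> s \<noteq> 0}"
      using False by (intro emeasure_mono) (auto simp: B_def)
    then have "emeasure lborel (B y) < \<infinity>"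
      using fin emeasure_Leb[OF B, of y] by (simp add: less_top order.strict_trans1)
    then show ?thesis by (intro pint_cmult pint_X B)
  qed (simp add: pint_zero)
  have "pint (\<lambda>x. \<Sum>y\<in>\<phi> ` S. y * jump_fun (indicator (B y)) x) (\<lambda>\<omega>. \<Sum>y\<in>\<phi> ` S. y * X (B y) \<omega>)"
    by (intro pint_sum *)
  moreover have "(\<lambda>x. \<Sum>y\<in>\<phi> ` S. y * jump_fun (indicator (B y)) x) = jump_fun (\<lambda>s. \<phi> s * indicator A s)"
  proof
    fix x :: "'a \<times> real"
    have finS: "finite (\<phi> ` S)" using simple_functionD(1)[OF sf] by simp
    show "(\<Sum>y\<in>\<phi> ` S. y * jump_fun (indicator (B y)) x) = jump_fun (\<lambda>s. \<phi> s * indicator A s) x"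
    proof (cases "fst x \<in> A")
      case True
      then have "(\<Sum>y\<in>\<phi> ` S. y * jump_fun (indicator (B y)) x) = (\<Sum>y\<in>\<phi> ` S. if y = \<phi> (fst x) then y * snd x else 0)"
        using A by (intro sum.cong) (auto simp: jump_fun_def B_def indicator_def)
      then show ?thesis using True A finS by (auto simp: jump_fun_def)
    qed (simp add: jump_fun_def B_def)
  qed
  moreover have "(\<lambda>\<omega>. \<Sum>y\<in>\<phi> ` S. y * X (B y) \<omega>) = simple_noise_integral S X A \<phi>"
    by (simp add: simple_noise_integral_def B_def fun_eq_iff)
  ultimately show ?thesis by simp
qed

text \<open>By the closed graph property every admissible sequence of simple functions leads to the
  same integral up to a null set; hence the representative chosen in \<open>noise_integral\<close>
  is immaterial.\<close>

lemma has_noise_integral_pint: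
  assumes "has_noise_integral M S X f Y"
  shows "pint (jump_fun f) Y"
proof -
  have [measurable]: "f \<in> borel_measurable Leb"
    using assms by (simp add: has_noise_integral_def borel_measurable_Leb)
  obtain \<phi> where \<phi>: "\<And>k. Bochner_Integration.simple_bochner_integrable Leb (\<phi> k)"
    and lim: "AE s in Leb. (\<lambda>k. \<phi> k s) \<longlonglongrightarrow> f s"
    and conv: "conv_in_prob M (\<lambda>k. simple_noise_integral S X S (\<phi> k)) Y"
    using assms unfolding has_noise_integral_def by blast
  show ?thesis
  proof (rule pint_closed[OF pint_simple[OF \<phi>, of S] _ antisym_jump_fun])
    have "AE x in N. (\<lambda>k. \<phi> k (fst x)) \<longlonglongrightarrow> f (fst x)" using lim by (rule AE_N_fst)
    then show "AE x in N. (\<lambda>k. jump_fun (\<lambda>s. \<phi> k s * indicator S s) x) \<longlonglongrightarrow> jump_fun f x"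
      using AE_space by eventually_elim (auto simp: jump_fun_def space_N intro!: tendsto_intros)
    show "(\<lambda>k. tmom M (\<lambda>\<omega>. simple_noise_integral S X S (\<phi> k) \<omega> - Y \<omega>)) \<longlonglongrightarrow> 0" "Y \<in> borel_measurable M"
      using conv unfolding conv_in_prob_iff by auto
  qed auto
qed

section \<open>Existence of the noise integral\<close>

lemma \<nu>_gt_pos: obtains e where "0 < e" "0 < emeasure \<nu> {z. e < \<bar>z\<bar>}"
proof (rule ccontr)
  assume "\<not> thesis"
  then have 0: "emeasure \<nu> {z. e < \<bar>z\<bar>} = 0" if "0 < e" for e
    using that \<open>\<And>e. 0 < e \<Longrightarrow> 0 < emeasure \<nu> {z. e < \<bar>z\<bar>} \<Longrightarrow> thesis\<close> by (metis zero_less_iff_neq_zero)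
  have "{0} \<in> null_sets \<nu>" using \<nu>_0 by (auto simp: null_sets_def sets_\<nu>)
  moreover have "(\<Union>k::nat. {z. 1 / real (Suc k) < \<bar>z\<bar>}) \<in> null_sets \<nu>"
    using 0 by (intro null_sets_UN) (auto simp: null_sets_def sets_\<nu>)
  ultimately have "{0} \<union> (\<Union>k::nat. {z. 1 / real (Suc k) < \<bar>z\<bar>}) \<in> null_sets \<nu>" by (rule null_sets.Un)
  moreover have "z \<in> {0} \<union> (\<Union>k::nat. {z. 1 / real (Suc k) < \<bar>z\<bar>})" for z :: real
  proof (cases "z = 0")
    case False
    then obtain n where "1 / real (Suc n) < \<bar>z\<bar>"
      using reals_Archimedean[of "\<bar>z\<bar>"] by (auto simp: inverse_eq_divide)
    then show ?thesis by blast
  qed simp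
  then have "{0} \<union> (\<Union>k::nat. {z. 1 / real (Suc k) < \<bar>z\<bar>}) = UNIV" by blast
  ultimately have "UNIV \<in> null_sets \<nu>" by simp
  then show False using \<nu>_nonzero by (simp add: null_sets_def)
qed

text \<open>Since \<open>S\<close> may have infinite measure, finite supports of the simple
  approximations have to come from \<open>noise_L\<close>. A level set times a set of jumps of
  positive \<open>\<nu>\<close> measure lies in a set where \<open>jump_fun f\<close> is bounded
  away from 0, and Markov's inequality bounds the product of the two measures.\<close>

lemma noise_L_level_finite:
  assumes f: "f \<in> noise_L S \<nu>" and c: "0 < c"
  shows "emeasure Leb {s \<in> S. c < \<bar>f s\<bar>} < \<infinity>"
proof -
  have [measurable]: "f \<in> borel_measurable Leb" and fin: "tmom N (jump_fun f) < \<infinity>"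
    using f unfolding noise_L_iff by auto
  obtain e where e: "0 < e" "0 < emeasure \<nu> {z. e < \<bar>z\<bar>}" by (rule \<nu>_gt_pos)
  define d where "d = min 1 (c * e)"
  have d: "0 < d" "d \<le> 1" "d \<le> c * e" using c e by (auto simp: d_def)
  have set: "{s \<in> S. c < \<bar>f s\<bar>} \<in> sets Leb"
  proof -
    have "{s \<in> space Leb. c < \<bar>f s\<bar>} \<in> sets Leb" by measurable
    then show ?thesis by simp
  qed
  have "emeasure Leb {s \<in> S. c < \<bar>f s\<bar>} * emeasure \<nu> {z. e < \<bar>z\<bar>} = emeasure N ({s \<in> S. c < \<bar>f s\<bar>} \<times> {z. e < \<bar>z\<bar>})"
    unfolding jump_intensity_def using set by (intro \<nu>.emeasure_pair_measure_Times[symmetric]) (auto simp: sets_\<nu>)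
  also have "\<dots> \<le> emeasure N {x \<in> space N. d < \<bar>jump_fun f x\<bar>}"
  proof (rule emeasure_mono)
    show "{s \<in> S. c < \<bar>f s\<bar>} \<times> {z. e < \<bar>z\<bar>} \<subseteq> {x \<in> space N. d < \<bar>jump_fun f x\<bar>}"
    proof safe
      fix s z assume "s \<in> S" "c < \<bar>f s\<bar>" "e < \<bar>z\<bar>"
      then have "c * e < \<bar>f s\<bar> * \<bar>z\<bar>" using c e by (intro mult_strict_mono) auto
      then show "d < \<bar>jump_fun f (s, z)\<bar>" using d by (simp add: jump_fun_def abs_mult)
    qed (simp add: space_N)
  qed measurable
  also have "\<dots> \<le> ennreal (1 / d\<^sup>2) * tmom N (jump_fun f)"
    by (rule emeasure_gt_le_tmom) (use d in auto)
  also have "\<dots> < \<infinity>" using fin by (simp add: ennreal_mult_less_top)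
  finally show ?thesis using e by (auto simp: ennreal_mult_less_top)
qed

lemma has_noise_integral_exists:
  assumes f: "f \<in> noise_L S \<nu>"
  obtains Y where "has_noise_integral M S X f Y"
proof -
  have fm[measurable]: "f \<in> borel_measurable Leb" and fin: "tmom N (jump_fun f) < \<infinity>"
    using f unfolding noise_L_iff by auto
  obtain \<phi> where *: "(\<forall>i. simple_function Leb (\<phi> i)) \<and> (\<forall>x\<in>space Leb. (\<lambda>i. \<phi> i x) \<longlonglongrightarrow> f x) \<and>
      (\<forall>i. \<forall>x\<in>space Leb. dist (\<phi> i x) 0 \<le> 2 * dist (f x) 0)"
    using borel_measurable_implies_sequence_metric[OF fm, of 0] by (elim exE)
  then have \<phi>: "\<And>i. simple_function Leb (\<phi> i)" "\<And>s. s \<in> S \<Longrightarrow> (\<lambda>i. \<phi> i s) \<longlonglongrightarrow> f s"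
    and bd: "\<And>i s. s \<in> S \<Longrightarrow> \<bar>\<phi> i s\<bar> \<le> 2 * \<bar>f s\<bar>"
    by auto
  have [measurable]: "\<phi> i \<in> borel_measurable Leb" for i using \<phi>(1) by (rule borel_measurable_simple_function)
  have sbi: "Bochner_Integration.simple_bochner_integrable Leb (\<phi> i)" for i
  proof (rule Bochner_Integration.simple_bochner_integrable.intros[OF \<phi>(1)])
    define V where "V = (\<lambda>s. \<bar>\<phi> i s\<bar>) ` S - {0}"
    have V: "finite V" using finite_imageI[OF simple_functionD(1)[OF \<phi>(1)[of i]], of abs] by (simp add: V_def image_image)
    \<comment> \<open>The least nonzero modulus of \<open>\<phi> i\<close>, capped at 1. Where
      \<open>\<phi> i\<close> does not vanish, \<open>\<bar>f s\<bar> \<ge> c / 2\<close>; passing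
      to \<open>c / 4\<close> gives the strict inequality of the level sets.\<close>
    define c where "c = Min (insert 1 V)"
    have c: "0 < c" using V by (auto simp: c_def V_def)
    have ge: "c \<le> \<bar>\<phi> i s\<bar>" if "s \<in> S" "\<phi> i s \<noteq> 0" for s
      using V that unfolding c_def by (intro Min_le) (auto simp: V_def)
    have set: "{s \<in> S. c / 4 < \<bar>f s\<bar>} \<in> sets Leb"
    proof -
      have "{s \<in> space Leb. c / 4 < \<bar>f s\<bar>} \<in> sets Leb" by measurable
      then show ?thesis by simp
    qed
    have "emeasure Leb {s \<in> space Leb. \<phi> i s \<noteq> 0} \<le> emeasure Leb {s \<in> S. c / 4 < \<bar>f s\<bar>}"
    proof (rule emeasure_mono[OF _ set])
      show "{s \<in> space Leb. \<phi> i s \<noteq> 0} \<subseteq> {s \<in> S. c / 4 < \<bar>f s\<bar>}"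
        using ge bd[of _ i] c by (auto) (smt (verit, best) field_sum_of_halves)
    qed
    also have "\<dots> < \<infinity>" by (rule noise_L_level_finite[OF f]) (use c in simp)
    finally show "emeasure Leb {s \<in> space Leb. \<phi> i s \<noteq> 0} \<noteq> \<infinity>" by simp
  qed
  have conv: "\<exists>Z. conv_in_prob M (\<lambda>k. simple_noise_integral S X A (\<phi> k)) Z" if A: "A \<in> sets borel" "A \<subseteq> S" for A
  proof -
    have A'[measurable]: "A \<in> sets Leb" using A by (simp add: sets_Leb_iff)
    let ?g = "jump_fun (\<lambda>s. f s * indicator A s)" and ?g' = "\<lambda>k. jump_fun (\<lambda>s. \<phi> k s * indicator A s)"
    have m[measurable]: "(\<lambda>s. f s * indicator A s) \<in> borel_measurable Leb" "(\<lambda>s. \<phi> k s * indicator A s) \<in> borel_measurable Leb" for k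
      using A' by (intro borel_measurable_times borel_measurable_indicator; simp)+
    have "tmom N ?g \<le> tmom N (jump_fun f)"
      by (intro tmom_mono_AE AE_I2) (auto simp: jump_fun_def indicator_def)
    then have "tmom N ?g < \<infinity>" using fin by (rule order.strict_trans1)
    then obtain Z where Z: "pint ?g Z" by (rule pint_exists[OF jump_fun_measurable[OF m(1)] antisym_jump_fun])
    have lim: "(\<lambda>k. tmom N (\<lambda>x. ?g' k x - ?g x)) \<longlonglongrightarrow> 0"
    \<comment> \<open>The factor 3 comes from
      \<open>\<bar>\<phi> k s\<bar> \<le> 2 * \<bar>f s\<bar>\<close>.\<close>
    proof (rule tmom_dominated[where h = "\<lambda>x. 3 * jump_fun f x"])
      show "AE x in N. (\<lambda>k. ?g' k x) \<longlonglongrightarrow> ?g x"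
        using AE_space by eventually_elim (use \<phi>(2) in \<open>auto simp: space_N jump_fun_def intro!: tendsto_intros\<close>)
      show "AE x in N. \<bar>?g' k x - ?g x\<bar> \<le> \<bar>3 * jump_fun f x\<bar>" for k
        using AE_space
      proof eventually_elim
        fix x assume "x \<in> space N"
        then have "\<bar>\<phi> k (fst x)\<bar> \<le> 2 * \<bar>f (fst x)\<bar>" using bd by (auto simp: space_N)
        then have "\<bar>\<phi> k (fst x) - f (fst x)\<bar> \<le> 3 * \<bar>f (fst x)\<bar>" by linarith
        then have "\<bar>\<phi> k (fst x) - f (fst x)\<bar> * \<bar>snd x\<bar> \<le> 3 * \<bar>f (fst x)\<bar> * \<bar>snd x\<bar>" by (rule mult_right_mono) simp
        then show "\<bar>?g' k x - ?g x\<bar> \<le> \<bar>3 * jump_fun f x\<bar>"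
          by (auto simp: jump_fun_def indicator_def abs_mult left_diff_distrib[symmetric])
      qed
      have "tmom N (\<lambda>x. 3 * jump_fun f x) \<le> ennreal (max 1 (3\<^sup>2)) * tmom N (jump_fun f)" by (rule tmom_cmult) measurable
      also have "\<dots> < \<infinity>" using fin by (simp add: ennreal_mult_less_top)
      finally show "tmom N (\<lambda>x. 3 * jump_fun f x) < \<infinity>" .
    qed measurable
    have "tmom M (\<lambda>\<omega>. simple_noise_integral S X A (\<phi> k) \<omega> - Z \<omega>) \<le> 80 * tmom N (\<lambda>x. ?g' k x - ?g x)" for k
      by (rule pint_tmom_le[OF pint_diff[OF pint_simple[OF sbi A] Z]])
    then have "(\<lambda>k. tmom M (\<lambda>\<omega>. simple_noise_integral S X A (\<phi> k) \<omega> - Z \<omega>)) \<longlonglongrightarrow> 0"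
      by (rule tendsto_0_le_ennreal) (rule tendsto_0_cmult_ennreal[OF lim], simp)
    then have "conv_in_prob M (\<lambda>k. simple_noise_integral S X A (\<phi> k)) Z"
      unfolding conv_in_prob_iff using pintD(3)[OF Z] pintD(3)[OF pint_simple[OF sbi A]] by blast
    then show ?thesis by blast
  qed
  from conv[of S] obtain Y where "conv_in_prob M (\<lambda>k. simple_noise_integral S X S (\<phi> k)) Y" by auto
  moreover have "AE s in Leb. (\<lambda>k. \<phi> k s) \<longlonglongrightarrow> f s" using \<phi>(2) by (intro AE_I2) auto
  ultimately have "has_noise_integral M S X f Y"
    unfolding has_noise_integral_def using fm sbi conv borel_measurable_Leb by (intro conjI exI[of _ \<phi>]) auto
  then show ?thesis by (rule that)
qed

lemma pint_noise_integral:
  assumes "f \<in> noise_L S \<nu>"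
  shows "pint (jump_fun f) (noise_integral M S X f)"
proof -
  obtain Y where "has_noise_integral M S X f Y" by (rule has_noise_integral_exists[OF assms])
  then have "has_noise_integral M S X f (noise_integral M S X f)"
    unfolding noise_integral_def by (rule someI[of "has_noise_integral M S X f"])
  then show ?thesis by (rule has_noise_integral_pint)
qed

end

section \<open>Approximating integrals of measurable fields by finite sums\<close>

definition cell_approx :: "'t measure \<Rightarrow> 'k measure \<Rightarrow> ('t \<times> 'k \<Rightarrow> real) \<Rightarrow> real \<Rightarrow> bool" where
  "cell_approx \<mu> \<kappa> F e \<longleftrightarrow>
    (\<exists>(q :: 't \<Rightarrow> nat) c. q \<in> measurable \<mu> (count_space UNIV) \<and> finite (range q) \<and>
      (\<forall>i. c i \<in> borel_measurable \<kappa>) \<and>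
      (\<integral>\<^sup>+ x. ennreal \<bar>F x - c (q (fst x)) (snd x)\<bar> \<partial>(\<mu> \<Otimes>\<^sub>M \<kappa>)) \<le> ennreal e)"

text \<open>\<^term>\<open>L1_factor \<mu> \<kappa> F\<close> says that \<^term>\<open>F\<close> is in the \<open>L\<^sup>1\<close> closure of the functions that depend
  on the first variable only through the cell of a finite measurable partition.\<close>

definition L1_factor :: "'t measure \<Rightarrow> 'k measure \<Rightarrow> ('t \<times> 'k \<Rightarrow> real) \<Rightarrow> bool" where
  "L1_factor \<mu> \<kappa> F \<longleftrightarrow> F \<in> borel_measurable (\<mu> \<Otimes>\<^sub>M \<kappa>) \<and> (\<forall>e>0. cell_approx \<mu> \<kappa> F e)"

lemma measurable_factor:
  assumes "q \<in> measurable \<mu> (count_space (UNIV :: nat set))" "\<And>i. c i \<in> borel_measurable \<kappa>"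
  shows "(\<lambda>x. c (q (fst x)) (snd x)) \<in> borel_measurable (\<mu> \<Otimes>\<^sub>M \<kappa>)"
  by (rule measurable_compose_countable[where f = "\<lambda>i x. c i (snd x)" and g = "\<lambda>x. q (fst x)"])
    (use assms in measurable)

lemma L1_factorE:
  assumes "L1_factor \<mu> \<kappa> F" "0 < e"
  obtains q :: "_ \<Rightarrow> nat" and c where "q \<in> measurable \<mu> (count_space UNIV)" "finite (range q)"
    "\<And>i. c i \<in> borel_measurable \<kappa>"
    "(\<integral>\<^sup>+ x. ennreal \<bar>F x - c (q (fst x)) (snd x)\<bar> \<partial>(\<mu> \<Otimes>\<^sub>M \<kappa>)) \<le> ennreal e"
  using assms unfolding L1_factor_def cell_approx_def by blast

lemma nn_integral_abs_triangle:
  fixes f g h :: "'a \<Rightarrow> real"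
  assumes [measurable]: "f \<in> borel_measurable M" "g \<in> borel_measurable M" "h \<in> borel_measurable M"
    and "(\<integral>\<^sup>+ x. ennreal \<bar>f x - g x\<bar> \<partial>M) \<le> ennreal (e / 2)" "(\<integral>\<^sup>+ x. ennreal \<bar>g x - h x\<bar> \<partial>M) \<le> ennreal (e / 2)"
    and e: "0 < e"
  shows "(\<integral>\<^sup>+ x. ennreal \<bar>f x - h x\<bar> \<partial>M) \<le> ennreal e"
proof -
  have "(\<integral>\<^sup>+ x. ennreal \<bar>f x - h x\<bar> \<partial>M) \<le> (\<integral>\<^sup>+ x. ennreal \<bar>f x - g x\<bar> + ennreal \<bar>g x - h x\<bar> \<partial>M)"
    by (intro nn_integral_mono) (simp flip: ennreal_plus add: ennreal_leI)
  also have "\<dots> = (\<integral>\<^sup>+ x. ennreal \<bar>f x - g x\<bar> \<partial>M) + (\<integral>\<^sup>+ x. ennreal \<bar>g x - h x\<bar> \<partial>M)"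
    by (rule nn_integral_add) measurable
  also have "\<dots> \<le> ennreal (e / 2) + ennreal (e / 2)" by (intro add_mono assms)
  also have "\<dots> = ennreal e" using e by (simp flip: ennreal_plus)
  finally show ?thesis .
qed

lemma L1_factor_limit:
  fixes F :: "'t \<times> 'k \<Rightarrow> real"
  assumes F[measurable]: "F \<in> borel_measurable (\<mu> \<Otimes>\<^sub>M \<kappa>)"
    and approx: "\<And>e. 0 < e \<Longrightarrow> \<exists>G. L1_factor \<mu> \<kappa> G \<and> (\<integral>\<^sup>+ x. ennreal \<bar>F x - G x\<bar> \<partial>(\<mu> \<Otimes>\<^sub>M \<kappa>)) \<le> ennreal e"
  shows "L1_factor \<mu> \<kappa> F"
  unfolding L1_factor_def
proof (intro conjI allI impI F)
  fix e :: real assume e: "0 < e"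
  then have e2: "0 < e / 2" by simp
  obtain G where G: "L1_factor \<mu> \<kappa> G" "(\<integral>\<^sup>+ x. ennreal \<bar>F x - G x\<bar> \<partial>(\<mu> \<Otimes>\<^sub>M \<kappa>)) \<le> ennreal (e / 2)"
    using approx[OF e2] by blast
  obtain q :: "'t \<Rightarrow> nat" and c where qc: "q \<in> measurable \<mu> (count_space UNIV)" "finite (range q)"
    "\<And>i. c i \<in> borel_measurable \<kappa>"
    "(\<integral>\<^sup>+ x. ennreal \<bar>G x - c (q (fst x)) (snd x)\<bar> \<partial>(\<mu> \<Otimes>\<^sub>M \<kappa>)) \<le> ennreal (e / 2)"
    by (rule L1_factorE[OF G(1) e2]) blast
  have "(\<integral>\<^sup>+ x. ennreal \<bar>F x - c (q (fst x)) (snd x)\<bar> \<partial>(\<mu> \<Otimes>\<^sub>M \<kappa>)) \<le> ennreal e"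
    by (rule nn_integral_abs_triangle[where g = G, OF _ _ measurable_factor[OF qc(1,3)] G(2) qc(4) e])
      (use G in \<open>auto simp: L1_factor_def\<close>)
  then show "cell_approx \<mu> \<kappa> F e"
    unfolding cell_approx_def
    using qc by blast
qed

lemma L1_factor_rectangle:
  assumes [measurable]: "A \<in> sets \<mu>" "B \<in> sets \<kappa>"
  shows "L1_factor \<mu> \<kappa> (indicator (A \<times> B))"
  unfolding L1_factor_def
proof (intro conjI allI impI)
  fix e :: real assume "0 < e"
  let ?q = "\<lambda>t. if t \<in> A then 1 else 0 :: nat" and ?c = "\<lambda>i k. real i * indicator B k"
  have "?q \<in> measurable \<mu> (count_space UNIV)" by measurable
  moreover have "finite (range ?q)" by (rule finite_subset[of _ "{0, 1}"]) auto
  moreover have "?c i \<in> borel_measurable \<kappa>" for i by measurable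
  moreover have "(\<integral>\<^sup>+ x. ennreal \<bar>indicator (A \<times> B) x - ?c (?q (fst x)) (snd x)\<bar> \<partial>(\<mu> \<Otimes>\<^sub>M \<kappa>)) = (\<integral>\<^sup>+ x. 0 \<partial>(\<mu> \<Otimes>\<^sub>M \<kappa>))"
    by (rule nn_integral_cong) (auto simp: indicator_def)
  ultimately show "cell_approx \<mu> \<kappa> (indicator (A \<times> B)) e"
    unfolding cell_approx_def
    by (intro exI[of _ ?q] exI[of _ ?c]) simp
qed measurable

lemma L1_factor_lincomb:
  fixes F G :: "'t \<times> 'k \<Rightarrow> real"
  assumes F: "L1_factor \<mu> \<kappa> F" and G: "L1_factor \<mu> \<kappa> G"
  shows "L1_factor \<mu> \<kappa> (\<lambda>x. a * F x + G x)"
  unfolding L1_factor_def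
proof (intro conjI allI impI)
  have [measurable]: "F \<in> borel_measurable (\<mu> \<Otimes>\<^sub>M \<kappa>)" "G \<in> borel_measurable (\<mu> \<Otimes>\<^sub>M \<kappa>)"
    using F G by (auto simp: L1_factor_def)
  show "(\<lambda>x. a * F x + G x) \<in> borel_measurable (\<mu> \<Otimes>\<^sub>M \<kappa>)" by measurable
  fix e :: real assume e: "0 < e"
  \<comment> \<open>Adding 1 keeps the divisor positive when \<open>a = 0\<close>.\<close>
  define b where "b = \<bar>a\<bar> + 1"
  have b: "b > 0" "\<bar>a\<bar> \<le> b" by (auto simp: b_def)
  have e1: "0 < e / 2 / b" and e2: "0 < e / 2" using e b by auto
  obtain q :: "'t \<Rightarrow> nat" and c where qc: "q \<in> measurable \<mu> (count_space UNIV)" "finite (range q)"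
    "\<And>i. c i \<in> borel_measurable \<kappa>"
    "(\<integral>\<^sup>+ x. ennreal \<bar>F x - c (q (fst x)) (snd x)\<bar> \<partial>(\<mu> \<Otimes>\<^sub>M \<kappa>)) \<le> ennreal (e / 2 / b)"
    by (rule L1_factorE[OF F e1]) blast
  obtain p :: "'t \<Rightarrow> nat" and d where pd: "p \<in> measurable \<mu> (count_space UNIV)" "finite (range p)"
    "\<And>i. d i \<in> borel_measurable \<kappa>"
    "(\<integral>\<^sup>+ x. ennreal \<bar>G x - d (p (fst x)) (snd x)\<bar> \<partial>(\<mu> \<Otimes>\<^sub>M \<kappa>)) \<le> ennreal (e / 2)"
    by (rule L1_factorE[OF G e2]) blast
  note [measurable] = qc(1,3) pd(1,3) measurable_factor[OF qc(1,3)] measurable_factor[OF pd(1,3)]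
  \<comment> \<open>The common refinement of the two partitions, with pairs of labels encoded as one
    label.\<close>
  let ?r = "\<lambda>t. prod_encode (q t, p t)"
  let ?f = "\<lambda>i k. a * c (fst (prod_decode i)) k + d (snd (prod_decode i)) k"
  have "?r \<in> measurable \<mu> (count_space UNIV)" by measurable
  moreover have "finite (range ?r)"
  proof (rule finite_subset)
    show "range ?r \<subseteq> prod_encode ` (range q \<times> range p)" by auto
  qed (use qc pd in auto)
  moreover have "?f i \<in> borel_measurable \<kappa>" for i by measurable
  moreover have "(\<integral>\<^sup>+ x. ennreal \<bar>(a * F x + G x) - ?f (?r (fst x)) (snd x)\<bar> \<partial>(\<mu> \<Otimes>\<^sub>M \<kappa>)) \<le> ennreal e"
  proof -
    have "(\<integral>\<^sup>+ x. ennreal \<bar>(a * F x + G x) - ?f (?r (fst x)) (snd x)\<bar> \<partial>(\<mu> \<Otimes>\<^sub>M \<kappa>)) \<le>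
      (\<integral>\<^sup>+ x. ennreal b * ennreal \<bar>F x - c (q (fst x)) (snd x)\<bar> + ennreal \<bar>G x - d (p (fst x)) (snd x)\<bar> \<partial>(\<mu> \<Otimes>\<^sub>M \<kappa>))"
    proof (rule nn_integral_mono)
      fix x
      let ?u = "F x - c (q (fst x)) (snd x)" and ?v = "G x - d (p (fst x)) (snd x)"
      have "\<bar>a * ?u\<bar> \<le> b * \<bar>?u\<bar>" unfolding abs_mult by (intro mult_right_mono b) simp
      then have "\<bar>a * ?u + ?v\<bar> \<le> b * \<bar>?u\<bar> + \<bar>?v\<bar>" by linarith
      moreover have "(a * F x + G x) - ?f (?r (fst x)) (snd x) = a * ?u + ?v" by (simp add: algebra_simps)
      ultimately have "ennreal \<bar>(a * F x + G x) - ?f (?r (fst x)) (snd x)\<bar> \<le> ennreal (b * \<bar>?u\<bar> + \<bar>?v\<bar>)"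
        by (intro ennreal_leI) simp
      also have "\<dots> = ennreal b * ennreal \<bar>?u\<bar> + ennreal \<bar>?v\<bar>"
        using b by (simp add: ennreal_plus ennreal_mult)
      finally show "ennreal \<bar>(a * F x + G x) - ?f (?r (fst x)) (snd x)\<bar> \<le> ennreal b * ennreal \<bar>?u\<bar> + ennreal \<bar>?v\<bar>" .
    qed
    also have "\<dots> = ennreal b * (\<integral>\<^sup>+ x. ennreal \<bar>F x - c (q (fst x)) (snd x)\<bar> \<partial>(\<mu> \<Otimes>\<^sub>M \<kappa>)) +
      (\<integral>\<^sup>+ x. ennreal \<bar>G x - d (p (fst x)) (snd x)\<bar> \<partial>(\<mu> \<Otimes>\<^sub>M \<kappa>))"
      by (simp add: nn_integral_add nn_integral_cmult)
    also have "\<dots> \<le> ennreal b * ennreal (e / 2 / b) + ennreal (e / 2)"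
      by (intro add_mono mult_left_mono qc pd) auto
    also have "\<dots> = ennreal e" using e b by (simp flip: ennreal_mult ennreal_plus)
    finally show ?thesis .
  qed
  ultimately show "cell_approx \<mu> \<kappa> (\<lambda>x. a * F x + G x) e"
    unfolding cell_approx_def
    by (intro exI[of _ ?r] exI[of _ ?f]) blast
qed

lemma L1_factor_cong:
  fixes F G :: "'t \<times> 'k \<Rightarrow> real"
  assumes "L1_factor \<mu> \<kappa> F" and "\<And>x. x \<in> space (\<mu> \<Otimes>\<^sub>M \<kappa>) \<Longrightarrow> F x = G x"
  shows "L1_factor \<mu> \<kappa> G"
proof -
  have "(\<integral>\<^sup>+ x. ennreal \<bar>F x - c (q (fst x)) (snd x)\<bar> \<partial>(\<mu> \<Otimes>\<^sub>M \<kappa>)) = (\<integral>\<^sup>+ x. ennreal \<bar>G x - c (q (fst x)) (snd x)\<bar> \<partial>(\<mu> \<Otimes>\<^sub>M \<kappa>))"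
    for c and q :: "'t \<Rightarrow> nat"
    by (rule nn_integral_cong) (simp add: assms(2))
  moreover have "F \<in> borel_measurable (\<mu> \<Otimes>\<^sub>M \<kappa>) \<longleftrightarrow> G \<in> borel_measurable (\<mu> \<Otimes>\<^sub>M \<kappa>)"
    by (rule measurable_cong) (rule assms(2))
  ultimately show ?thesis using assms(1) unfolding L1_factor_def cell_approx_def by simp
qed

lemma L1_factor_zero: "L1_factor \<mu> \<kappa> (\<lambda>x. 0)"
  by (rule L1_factor_cong[OF L1_factor_rectangle[of "{}" \<mu> "{}" \<kappa>]]) auto

lemma L1_factor_sum:
  "finite I \<Longrightarrow> (\<And>i. i \<in> I \<Longrightarrow> L1_factor \<mu> \<kappa> (F i)) \<Longrightarrow> L1_factor \<mu> \<kappa> (\<lambda>x. \<Sum>i\<in>I. F i x)"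
proof (induction I rule: finite_induct)
  case (insert i I)
  then show ?case using L1_factor_lincomb[of \<mu> \<kappa> "F i" "\<lambda>x. \<Sum>i\<in>I. F i x" 1] by simp
qed (simp add: L1_factor_zero)

text \<open>A Dynkin class argument from rectangles. Finiteness of the measures enters for countable
  disjoint unions, whose tails then have measure tending to 0. No topology of the parameter space is
  involved, so the cells depend on the function and a fixed grid would not do.\<close>

lemma L1_factor_set:
  assumes "finite_measure \<mu>" "finite_measure \<kappa>" and A: "A \<in> sets (\<mu> \<Otimes>\<^sub>M \<kappa>)"
  shows "L1_factor \<mu> \<kappa> (indicator A)"
proof -
  interpret \<mu>: finite_measure \<mu> by fact
  interpret \<kappa>: finite_measure \<kappa> by fact
  interpret pair_sigma_finite \<mu> \<kappa> ..
  interpret P: finite_measure "\<mu> \<Otimes>\<^sub>M \<kappa>" by (rule finite_measure_pair_measure) fact+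
  let ?G = "{a \<times> b | a b. a \<in> sets \<mu> \<and> b \<in> sets \<kappa>}" and ?S = "space \<mu> \<times> space \<kappa>"
  have sets_eq: "sets (\<mu> \<Otimes>\<^sub>M \<kappa>) = sigma_sets ?S ?G" by (rule sets_pair_measure)
  have "?G \<subseteq> Pow ?S" by (auto dest: sets.sets_into_space)
  from Int_stable_pair_measure_generator this A[unfolded sets_eq]
  show ?thesis
  proof (induction rule: sigma_sets_induct_disjoint)
    case (basic A)
    then show ?case using L1_factor_rectangle by auto
  next
    case empty
    then show ?case using L1_factor_zero by simp
  next
    case (compl A)
    have "L1_factor \<mu> \<kappa> (\<lambda>x. -1 * indicator A x + indicator ?S x)"
      by (intro L1_factor_lincomb compl.IH L1_factor_rectangle) auto
    then show ?case
      by (rule L1_factor_cong) (auto simp: indicator_def space_pair_measure)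
  next
    case (union A)
    have Am[measurable]: "A i \<in> sets (\<mu> \<Otimes>\<^sub>M \<kappa>)" for i using union.hyps(2) unfolding sets_eq by auto
    show ?case
    proof (rule L1_factor_limit)
      fix e :: real assume e: "0 < e"
      define R where "R n = (\<Union>i. A i) - (\<Union>i<n. A i)" for n
      have Rm[measurable]: "R n \<in> sets (\<mu> \<Otimes>\<^sub>M \<kappa>)" for n unfolding R_def by measurable
      have "(\<lambda>n. emeasure (\<mu> \<Otimes>\<^sub>M \<kappa>) (R n)) \<longlonglongrightarrow> emeasure (\<mu> \<Otimes>\<^sub>M \<kappa>) (\<Inter>n. R n)"
        by (rule Lim_emeasure_decseq) (auto simp: decseq_def R_def)
      also have "(\<Inter>n. R n) = {}" by (auto simp: R_def)
      finally have "\<forall>\<^sub>F n in sequentially. emeasure (\<mu> \<Otimes>\<^sub>M \<kappa>) (R n) < ennreal e"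
        by (rule order_tendstoD) (use e in simp)
      then obtain n where n: "emeasure (\<mu> \<Otimes>\<^sub>M \<kappa>) (R n) \<le> ennreal e"
        by (auto simp: eventually_sequentially intro: less_imp_le)
      have sum: "(\<Sum>i<n. indicator (A i) x) = (indicator (\<Union>i<n. A i) x :: real)" for x
        using union.hyps(1) by (intro indicator_UN_disjoint[symmetric]) (auto simp: disjoint_family_on_def)
      have "(\<integral>\<^sup>+ x. ennreal \<bar>indicator (\<Union>i. A i) x - (\<Sum>i<n. indicator (A i) x)\<bar> \<partial>(\<mu> \<Otimes>\<^sub>M \<kappa>)) =
        (\<integral>\<^sup>+ x. indicator (R n) x \<partial>(\<mu> \<Otimes>\<^sub>M \<kappa>))"
        unfolding sum by (rule nn_integral_cong) (auto simp: indicator_def R_def)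
      also have "\<dots> \<le> ennreal e" using n by simp
      finally show "\<exists>G. L1_factor \<mu> \<kappa> G \<and> (\<integral>\<^sup>+ x. ennreal \<bar>indicator (\<Union>i. A i) x - G x\<bar> \<partial>(\<mu> \<Otimes>\<^sub>M \<kappa>)) \<le> ennreal e"
        using L1_factor_sum[of "{..<n}" \<mu> \<kappa> "\<lambda>i. indicator (A i)"] union.IH
        by (intro exI[of _ "\<lambda>x. \<Sum>i<n. indicator (A i) x"]) auto
    qed measurable
  qed
qed

lemma L1_factor_integrable:
  assumes "finite_measure \<mu>" "finite_measure \<kappa>" and F: "integrable (\<mu> \<Otimes>\<^sub>M \<kappa>) F"
  shows "L1_factor \<mu> \<kappa> F"
  using F
proof (induction rule: integrable_induct)
  case (base A c)
  then show ?case
    using L1_factor_lincomb[OF L1_factor_set[OF assms(1,2) base(1)] L1_factor_zero, of c]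
    by (simp add: mult.commute)
next
  case (add f g)
  then show ?case using L1_factor_lincomb[of \<mu> \<kappa> f g 1] by simp
next
  case (lim f s)
  have [measurable]: "f \<in> borel_measurable (\<mu> \<Otimes>\<^sub>M \<kappa>)" "\<And>i. s i \<in> borel_measurable (\<mu> \<Otimes>\<^sub>M \<kappa>)"
    using lim by auto
  have "(\<lambda>i. \<integral>\<^sup>+ x. ennreal \<bar>f x - s i x\<bar> \<partial>(\<mu> \<Otimes>\<^sub>M \<kappa>)) \<longlonglongrightarrow> (\<integral>\<^sup>+ x. 0 \<partial>(\<mu> \<Otimes>\<^sub>M \<kappa>))"
  proof (rule nn_integral_dominated_convergence[where w = "\<lambda>x. ennreal (norm (3 * f x))"])
    show "AE x in \<mu> \<Otimes>\<^sub>M \<kappa>. ennreal \<bar>f x - s j x\<bar> \<le> ennreal (norm (3 * f x))" for j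
      using AE_space
    proof eventually_elim
      fix x assume "x \<in> space (\<mu> \<Otimes>\<^sub>M \<kappa>)"
      then have "\<bar>s j x\<bar> \<le> 2 * \<bar>f x\<bar>" using lim(3)[of x j] by simp
      then have "\<bar>f x - s j x\<bar> \<le> 3 * \<bar>f x\<bar>" by linarith
      then show "ennreal \<bar>f x - s j x\<bar> \<le> ennreal (norm (3 * f x))" by (intro ennreal_leI) (simp add: abs_mult)
    qed
    have "integrable (\<mu> \<Otimes>\<^sub>M \<kappa>) (\<lambda>x. 3 * f x)" using lim by simp
    then show "(\<integral>\<^sup>+ x. ennreal (norm (3 * f x)) \<partial>(\<mu> \<Otimes>\<^sub>M \<kappa>)) < \<infinity>" by (simp only: integrable_iff_bounded)
    show "AE x in \<mu> \<Otimes>\<^sub>M \<kappa>. (\<lambda>i. ennreal \<bar>f x - s i x\<bar>) \<longlonglongrightarrow> 0"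
      using AE_space
    proof eventually_elim
      fix x assume "x \<in> space (\<mu> \<Otimes>\<^sub>M \<kappa>)"
      then have "(\<lambda>i. ennreal \<bar>f x - s i x\<bar>) \<longlonglongrightarrow> ennreal \<bar>f x - f x\<bar>" using lim(2) by (intro tendsto_intros)
      then show "(\<lambda>i. ennreal \<bar>f x - s i x\<bar>) \<longlonglongrightarrow> 0" by simp
    qed
  qed measurable
  then have L: "(\<lambda>i. \<integral>\<^sup>+ x. ennreal \<bar>f x - s i x\<bar> \<partial>(\<mu> \<Otimes>\<^sub>M \<kappa>)) \<longlonglongrightarrow> 0" by simp
  show ?case
  proof (rule L1_factor_limit)
    fix e :: real assume "0 < e"
    then have "\<forall>\<^sub>F i in sequentially. (\<integral>\<^sup>+ x. ennreal \<bar>f x - s i x\<bar> \<partial>(\<mu> \<Otimes>\<^sub>M \<kappa>)) < ennreal e"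
      by (intro order_tendstoD[OF L]) simp
    then obtain i where "(\<integral>\<^sup>+ x. ennreal \<bar>f x - s i x\<bar> \<partial>(\<mu> \<Otimes>\<^sub>M \<kappa>)) \<le> ennreal e"
      by (auto simp: eventually_sequentially intro: less_imp_le)
    then show "\<exists>G. L1_factor \<mu> \<kappa> G \<and> (\<integral>\<^sup>+ x. ennreal \<bar>f x - G x\<bar> \<partial>(\<mu> \<Otimes>\<^sub>M \<kappa>)) \<le> ennreal e"
      using lim(5) by blast
  qed measurable
qed

section \<open>Sampling points in the cells of a partition\<close>

lemma (in finite_measure) exists_point_below_mean:
  fixes D :: "'a \<Rightarrow> ennreal"
  assumes [measurable]: "D \<in> borel_measurable M" "B \<in> sets M" and fin: "(\<integral>\<^sup>+ t. D t \<partial>M) < \<infinity>" and d: "0 < d"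
  shows "\<exists>t. (emeasure M B \<noteq> 0 \<longrightarrow> t \<in> B) \<and> emeasure M B * D t \<le> (\<integral>\<^sup>+ t. D t * indicator B t \<partial>M) + ennreal d"
proof (rule ccontr)
  let ?I = "\<integral>\<^sup>+ t. D t * indicator B t \<partial>M"
  assume "\<not> ?thesis"
  then have *: "(emeasure M B \<noteq> 0 \<longrightarrow> t \<in> B) \<Longrightarrow> ?I + ennreal d < emeasure M B * D t" for t
    by (auto simp: not_le)
  then have B: "emeasure M B \<noteq> 0" by force
  have "?I \<le> (\<integral>\<^sup>+ t. D t \<partial>M)" by (intro nn_integral_mono) (auto simp: indicator_def)
  then have I: "?I < \<infinity>" using fin by (rule order.strict_trans1)
  \<comment> \<open>Integrating the assumed inequality over \<open>B\<close> gives
    \<open>?I + d \<le> ?I\<close>. The slack \<open>d\<close> makes monotonicity of the integral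
    sufficient, without a strict version of it.\<close>
  have "emeasure M B * (?I + ennreal d) = (\<integral>\<^sup>+ t. (?I + ennreal d) * indicator B t \<partial>M)"
    by (subst nn_integral_cmult_indicator) (auto simp: mult.commute)
  also have "\<dots> \<le> (\<integral>\<^sup>+ t. emeasure M B * (D t * indicator B t) \<partial>M)"
    using * B by (intro nn_integral_mono) (auto simp: indicator_def less_imp_le)
  also have "\<dots> = emeasure M B * ?I" by (rule nn_integral_cmult) measurable
  finally have "?I + ennreal d \<le> ?I"
    using B emeasure_finite[of B] by (subst (asm) ennreal_mult_le_mult_iff) (auto simp: top.not_eq_extremum)
  then show False using I d by (cases ?I) (auto simp flip: ennreal_plus simp: ennreal_le_iff)
qed

lemma (in sigma_finite_measure) borel_measurable_nn_integral_snd: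
  fixes f :: "'a \<times> 'k \<Rightarrow> ennreal"
  assumes "f \<in> borel_measurable (M \<Otimes>\<^sub>M K)"
  shows "(\<lambda>k. \<integral>\<^sup>+ t. f (t, k) \<partial>M) \<in> borel_measurable K"
  using borel_measurable_nn_integral_fst[OF measurable_compose[OF measurable_pair_swap' assms]] by simp

text \<open>The weighted sum is exact for functions that are constant in \<open>t\<close> on the
  cells. Inserting \<open>c\<close> therefore splits the error into the errors at the chosen points
  and the L1 distance of \<open>H\<close> from \<open>c\<close>.\<close>

lemma sampling_error:
  fixes H :: "'t \<times> 'k \<Rightarrow> real" and n :: nat
  assumes fin: "finite_measure \<mu>" "finite_measure \<kappa>" and H: "integrable (\<mu> \<Otimes>\<^sub>M \<kappa>) H"
    and space: "space \<mu> = UNIV"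
    and q: "q \<in> measurable \<mu> (count_space UNIV)" "range q \<subseteq> {..<n}" and c: "\<And>i. c i \<in> borel_measurable \<kappa>"
    and E: "(\<integral>\<^sup>+ x. ennreal \<bar>H x - c (q (fst x)) (snd x)\<bar> \<partial>(\<mu> \<Otimes>\<^sub>M \<kappa>)) \<le> E"
    and a: "\<And>i. i < n \<Longrightarrow> emeasure \<mu> (q -` {i}) * (\<integral>\<^sup>+ k. ennreal \<bar>H (t i, k) - c i k\<bar> \<partial>\<kappa>) \<le> a i"
  shows "(\<integral>\<^sup>+ k. ennreal \<bar>(\<Sum>i<n. measure \<mu> (q -` {i}) * H (t i, k)) - (\<integral>t. H (t, k) \<partial>\<mu>)\<bar> \<partial>\<kappa>) \<le> (\<Sum>i<n. a i) + E"
proof -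
  interpret \<mu>: finite_measure \<mu> by fact
  interpret \<kappa>: finite_measure \<kappa> by fact
  interpret pair_sigma_finite \<mu> \<kappa> ..
  let ?m = "\<lambda>i. measure \<mu> (q -` {i})"
  note [measurable] = q(1) c measurable_factor[OF q(1) c]
  have [measurable]: "H \<in> borel_measurable (\<mu> \<Otimes>\<^sub>M \<kappa>)" using H by auto
  have Ht[measurable]: "(\<lambda>k. H (t i, k)) \<in> borel_measurable \<kappa>" for i
    by (rule measurable_compose[OF measurable_Pair1'[of "t i" \<mu> \<kappa>]]) (auto simp: space)
  have "AE k in \<kappa>. integrable \<mu> (\<lambda>t. H (t, k))"
    using AE_integrable_snd[of "curry H"] H by simp
  then have AE: "AE k in \<kappa>. ennreal \<bar>(\<Sum>i<n. ?m i * H (t i, k)) - (\<integral>t. H (t, k) \<partial>\<mu>)\<bar> \<le>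
    (\<Sum>i<n. ennreal (?m i) * ennreal \<bar>H (t i, k) - c i k\<bar>) + (\<integral>\<^sup>+ t. ennreal \<bar>H (t, k) - c (q t) k\<bar> \<partial>\<mu>)"
    using AE_space
  proof eventually_elim
    fix k assume int: "integrable \<mu> (\<lambda>t. H (t, k))" and k: "k \<in> space \<kappa>"
    have hbi: "has_bochner_integral \<mu> (\<lambda>t. if q t \<in> {..<n} then c (q t) k else 0) (\<Sum>i\<in>{..<n}. measure \<mu> (q -` {i} \<inter> space \<mu>) *\<^sub>R c i k)"
    proof (rule has_bochner_integral_atoms[where c = "\<lambda>i. c i k"])
      show "simple_function \<mu> q"
        unfolding simple_function_def
        using finite_subset[OF q(2)] measurable_sets[OF q(1)] by (auto simp: space)
    qed (auto simp: less_top[symmetric])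
    have "(if q t \<in> {..<n} then c (q t) k else 0) = c (q t) k" for t using q(2) by auto
    then have hbi': "has_bochner_integral \<mu> (\<lambda>t. c (q t) k) (\<Sum>i<n. ?m i * c i k)" using hbi by (simp add: space)
    then have ci: "integrable \<mu> (\<lambda>t. c (q t) k)" and ce: "(\<integral>t. c (q t) k \<partial>\<mu>) = (\<Sum>i<n. ?m i * c i k)"
      by (auto simp: has_bochner_integral_iff)
    have di: "integrable \<mu> (\<lambda>t. H (t, k) - c (q t) k)" by (intro Bochner_Integration.integrable_diff int ci)
    \<comment> \<open>Exactness on \<open>c\<close>: the same number
      \<open>\<integral>t. c (q t) k \<partial>\<mu>\<close> is subtracted from both terms.\<close>
    have "(\<Sum>i<n. ?m i * H (t i, k)) - (\<integral>t. H (t, k) \<partial>\<mu>) =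
      (\<Sum>i<n. ?m i * (H (t i, k) - c i k)) - (\<integral>t. H (t, k) - c (q t) k \<partial>\<mu>)"
      using int ci by (simp add: ce right_diff_distrib sum_subtractf)
    then have "\<bar>(\<Sum>i<n. ?m i * H (t i, k)) - (\<integral>t. H (t, k) \<partial>\<mu>)\<bar> \<le>
      \<bar>\<Sum>i<n. ?m i * (H (t i, k) - c i k)\<bar> + \<bar>\<integral>t. H (t, k) - c (q t) k \<partial>\<mu>\<bar>"
      by (simp only: abs_triangle_ineq4)
    also have "\<dots> \<le> (\<Sum>i<n. ?m i * \<bar>H (t i, k) - c i k\<bar>) + (\<integral>t. \<bar>H (t, k) - c (q t) k\<bar> \<partial>\<mu>)"
      by (intro add_mono integral_abs_bound order.trans[OF sum_abs]) (simp add: abs_mult)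
    finally have "ennreal \<bar>(\<Sum>i<n. ?m i * H (t i, k)) - (\<integral>t. H (t, k) \<partial>\<mu>)\<bar> \<le>
      ennreal ((\<Sum>i<n. ?m i * \<bar>H (t i, k) - c i k\<bar>) + (\<integral>t. \<bar>H (t, k) - c (q t) k\<bar> \<partial>\<mu>))" by (rule ennreal_leI)
    also have "\<dots> = (\<Sum>i<n. ennreal (?m i) * ennreal \<bar>H (t i, k) - c i k\<bar>) + (\<integral>\<^sup>+ t. ennreal \<bar>H (t, k) - c (q t) k\<bar> \<partial>\<mu>)"
      by (subst nn_integral_eq_integral[OF integrable_abs[OF di]])
        (auto simp: ennreal_plus sum_nonneg sum_ennreal[symmetric] ennreal_mult)
    finally show "ennreal \<bar>(\<Sum>i<n. ?m i * H (t i, k)) - (\<integral>t. H (t, k) \<partial>\<mu>)\<bar> \<le>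
      (\<Sum>i<n. ennreal (?m i) * ennreal \<bar>H (t i, k) - c i k\<bar>) + (\<integral>\<^sup>+ t. ennreal \<bar>H (t, k) - c (q t) k\<bar> \<partial>\<mu>)" .
  qed
  have m3: "(\<lambda>x. ennreal \<bar>H x - c (q (fst x)) (snd x)\<bar>) \<in> borel_measurable (\<mu> \<Otimes>\<^sub>M \<kappa>)" by measurable
  have m2: "(\<lambda>k. \<integral>\<^sup>+ t. ennreal \<bar>H (t, k) - c (q t) k\<bar> \<partial>\<mu>) \<in> borel_measurable \<kappa>"
    using \<mu>.borel_measurable_nn_integral_snd[OF m3] by simp
  have "(\<integral>\<^sup>+ k. ennreal \<bar>(\<Sum>i<n. ?m i * H (t i, k)) - (\<integral>t. H (t, k) \<partial>\<mu>)\<bar> \<partial>\<kappa>) \<le>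
    (\<integral>\<^sup>+ k. (\<Sum>i<n. ennreal (?m i) * ennreal \<bar>H (t i, k) - c i k\<bar>) + (\<integral>\<^sup>+ t. ennreal \<bar>H (t, k) - c (q t) k\<bar> \<partial>\<mu>) \<partial>\<kappa>)"
    by (rule nn_integral_mono_AE[OF AE])
  also have "\<dots> = (\<Sum>i<n. ennreal (?m i) * (\<integral>\<^sup>+ k. ennreal \<bar>H (t i, k) - c i k\<bar> \<partial>\<kappa>)) +
      (\<integral>\<^sup>+ k. (\<integral>\<^sup>+ t. ennreal \<bar>H (t, k) - c (q t) k\<bar> \<partial>\<mu>) \<partial>\<kappa>)"
    using m2 by (simp add: nn_integral_add nn_integral_sum nn_integral_cmult)
  also have "(\<integral>\<^sup>+ k. (\<integral>\<^sup>+ t. ennreal \<bar>H (t, k) - c (q t) k\<bar> \<partial>\<mu>) \<partial>\<kappa>) = (\<integral>\<^sup>+ x. ennreal \<bar>H x - c (q (fst x)) (snd x)\<bar> \<partial>(\<mu> \<Otimes>\<^sub>M \<kappa>))"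
    using nn_integral_snd[OF m3] by simp
  also have "(\<Sum>i<n. ennreal (?m i) * (\<integral>\<^sup>+ k. ennreal \<bar>H (t i, k) - c i k\<bar> \<partial>\<kappa>)) + \<dots> \<le> (\<Sum>i<n. a i) + E"
    using a by (intro add_mono sum_mono E) (simp add: \<mu>.emeasure_eq_measure)
  finally show ?thesis .
qed

text \<open>In each cell, the point is chosen such that the sum of the two errors is essentially at most its mean
  over the cell.\<close>

lemma sampling_step:
  fixes H1 :: "'t \<times> 'k \<Rightarrow> real" and H2 :: "'t \<times> 'l \<Rightarrow> real"
  assumes fin: "finite_measure \<mu>" "finite_measure \<kappa>1" "finite_measure \<kappa>2"
    and H: "integrable (\<mu> \<Otimes>\<^sub>M \<kappa>1) H1" "integrable (\<mu> \<Otimes>\<^sub>M \<kappa>2) H2"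
    and space: "space \<mu> = UNIV" and e: "0 < e"
  obtains n :: nat and w t where "\<And>i. 0 \<le> w i"
    "(\<integral>\<^sup>+ k. ennreal \<bar>(\<Sum>i<n. w i * H1 (t i, k)) - (\<integral>t. H1 (t, k) \<partial>\<mu>)\<bar> \<partial>\<kappa>1) \<le> ennreal e"
    "(\<integral>\<^sup>+ k. ennreal \<bar>(\<Sum>i<n. w i * H2 (t i, k)) - (\<integral>t. H2 (t, k) \<partial>\<mu>)\<bar> \<partial>\<kappa>2) \<le> ennreal e"
proof -
  interpret \<mu>: finite_measure \<mu> by fact
  interpret \<kappa>1: finite_measure \<kappa>1 by fact
  interpret \<kappa>2: finite_measure \<kappa>2 by fact
  \<comment> \<open>Four shares: the mean errors of the two functions at the sample points, the
    total slack in the choice of the points, and the L1 distance of the function under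
    consideration.\<close>
  define d where "d = e / 4"
  have d: "0 < d" using e by (simp add: d_def)
  obtain q1 :: "'t \<Rightarrow> nat" and c1 where 1: "q1 \<in> measurable \<mu> (count_space UNIV)" "finite (range q1)"
    "\<And>i. c1 i \<in> borel_measurable \<kappa>1"
    "(\<integral>\<^sup>+ x. ennreal \<bar>H1 x - c1 (q1 (fst x)) (snd x)\<bar> \<partial>(\<mu> \<Otimes>\<^sub>M \<kappa>1)) \<le> ennreal d"
    by (rule L1_factorE[OF L1_factor_integrable[OF fin(1,2) H(1)] d]) blast
  obtain q2 :: "'t \<Rightarrow> nat" and c2 where 2: "q2 \<in> measurable \<mu> (count_space UNIV)" "finite (range q2)"
    "\<And>i. c2 i \<in> borel_measurable \<kappa>2"
    "(\<integral>\<^sup>+ x. ennreal \<bar>H2 x - c2 (q2 (fst x)) (snd x)\<bar> \<partial>(\<mu> \<Otimes>\<^sub>M \<kappa>2)) \<le> ennreal d"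
    by (rule L1_factorE[OF L1_factor_integrable[OF fin(1,3) H(2)] d]) blast
  \<comment> \<open>Refining both partitions lets the same cells, weights and points serve
    \<open>H1\<close> and \<open>H2\<close>.\<close>
  define q where "q t = prod_encode (q1 t, q2 t)" for t
  define b1 where "b1 i = c1 (fst (prod_decode i))" for i
  define b2 where "b2 i = c2 (snd (prod_decode i))" for i
  note [measurable] = 1(1) 2(1)
  have q: "q \<in> measurable \<mu> (count_space UNIV)" unfolding q_def[abs_def] by measurable
  have "range q \<subseteq> prod_encode ` (range q1 \<times> range q2)" by (auto simp: q_def)
  then have "finite (range q)" by (rule finite_subset) (use 1(2) 2(2) in simp)
  then obtain n where n: "range q \<subseteq> {..<n}" by (meson finite_nat_bounded)
  have b[measurable]: "b1 i \<in> borel_measurable \<kappa>1" "b2 i \<in> borel_measurable \<kappa>2" for i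
    using 1(3) 2(3) by (auto simp: b1_def b2_def)
  note [measurable] = q measurable_factor[OF q b(1)] measurable_factor[OF q b(2)]
  have [measurable]: "H1 \<in> borel_measurable (\<mu> \<Otimes>\<^sub>M \<kappa>1)" "H2 \<in> borel_measurable (\<mu> \<Otimes>\<^sub>M \<kappa>2)" using H by auto
  have E1: "(\<integral>\<^sup>+ x. ennreal \<bar>H1 x - b1 (q (fst x)) (snd x)\<bar> \<partial>(\<mu> \<Otimes>\<^sub>M \<kappa>1)) \<le> ennreal d"
    and E2: "(\<integral>\<^sup>+ x. ennreal \<bar>H2 x - b2 (q (fst x)) (snd x)\<bar> \<partial>(\<mu> \<Otimes>\<^sub>M \<kappa>2)) \<le> ennreal d"
    using 1(4) 2(4) by (simp_all add: q_def b1_def b2_def)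
  define D1 where "D1 t = (\<integral>\<^sup>+ k. ennreal \<bar>H1 (t, k) - b1 (q t) k\<bar> \<partial>\<kappa>1)" for t
  define D2 where "D2 t = (\<integral>\<^sup>+ k. ennreal \<bar>H2 (t, k) - b2 (q t) k\<bar> \<partial>\<kappa>2)" for t
  have m1: "(\<lambda>x. ennreal \<bar>H1 x - b1 (q (fst x)) (snd x)\<bar>) \<in> borel_measurable (\<mu> \<Otimes>\<^sub>M \<kappa>1)" by measurable
  have m2: "(\<lambda>x. ennreal \<bar>H2 x - b2 (q (fst x)) (snd x)\<bar>) \<in> borel_measurable (\<mu> \<Otimes>\<^sub>M \<kappa>2)" by measurable
  have D1m[measurable]: "D1 \<in> borel_measurable \<mu>"
    unfolding D1_def[abs_def] using \<kappa>1.borel_measurable_nn_integral_fst[OF m1] by simp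
  have D2m[measurable]: "D2 \<in> borel_measurable \<mu>"
    unfolding D2_def[abs_def] using \<kappa>2.borel_measurable_nn_integral_fst[OF m2] by simp
  have "(\<integral>\<^sup>+ t. D1 t \<partial>\<mu>) \<le> ennreal d" using \<kappa>1.nn_integral_fst[OF m1] E1 by (simp add: D1_def)
  moreover have "(\<integral>\<^sup>+ t. D2 t \<partial>\<mu>) \<le> ennreal d" using \<kappa>2.nn_integral_fst[OF m2] E2 by (simp add: D2_def)
  ultimately have D: "(\<integral>\<^sup>+ t. D1 t + D2 t \<partial>\<mu>) \<le> ennreal d + ennreal d"
    by (subst nn_integral_add) (auto intro: add_mono)
  \<comment> \<open>The slack over all \<open>n\<close> cells amounts to at most \<open>d\<close>;
    adding 1 covers \<open>n = 0\<close>.\<close>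
  define \<delta> where "\<delta> = d / (real n + 1)"
  have \<delta>: "0 < \<delta>" "real n * \<delta> \<le> d" using d by (auto simp: \<delta>_def field_simps)
  let ?B = "\<lambda>i. q -` {i}"
  have B[measurable]: "?B i \<in> sets \<mu>" for i using measurable_sets[OF q, of "{i}"] by (simp add: space)
  have "\<forall>i. \<exists>t. (emeasure \<mu> (?B i) \<noteq> 0 \<longrightarrow> t \<in> ?B i) \<and>
    emeasure \<mu> (?B i) * (D1 t + D2 t) \<le> (\<integral>\<^sup>+ t. (D1 t + D2 t) * indicator (?B i) t \<partial>\<mu>) + ennreal \<delta>"
    by (intro allI \<mu>.exists_point_below_mean) (use order.strict_trans1[OF D] \<delta> in auto)
  then obtain t where t: "\<And>i. emeasure \<mu> (?B i) \<noteq> 0 \<Longrightarrow> t i \<in> ?B i"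
    "\<And>i. emeasure \<mu> (?B i) * (D1 (t i) + D2 (t i)) \<le> (\<integral>\<^sup>+ t. (D1 t + D2 t) * indicator (?B i) t \<partial>\<mu>) + ennreal \<delta>"
    unfolding choice_iff by blast
  define a where "a i = (\<integral>\<^sup>+ t. (D1 t + D2 t) * indicator (?B i) t \<partial>\<mu>) + ennreal \<delta>" for i
  have a1: "emeasure \<mu> (?B i) * (\<integral>\<^sup>+ k. ennreal \<bar>H1 (t i, k) - b1 i k\<bar> \<partial>\<kappa>1) \<le> a i" for i
  proof (cases "emeasure \<mu> (?B i) = 0")
    case False
    then have "q (t i) = i" using t(1) by auto
    then have "(\<integral>\<^sup>+ k. ennreal \<bar>H1 (t i, k) - b1 i k\<bar> \<partial>\<kappa>1) \<le> D1 (t i) + D2 (t i)"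
      by (simp add: D1_def add_increasing2)
    then show ?thesis unfolding a_def by (rule order.trans[OF mult_left_mono t(2)]) simp
  qed simp
  have a2: "emeasure \<mu> (?B i) * (\<integral>\<^sup>+ k. ennreal \<bar>H2 (t i, k) - b2 i k\<bar> \<partial>\<kappa>2) \<le> a i" for i
  proof (cases "emeasure \<mu> (?B i) = 0")
    case False
    then have "q (t i) = i" using t(1) by auto
    then have "(\<integral>\<^sup>+ k. ennreal \<bar>H2 (t i, k) - b2 i k\<bar> \<partial>\<kappa>2) \<le> D1 (t i) + D2 (t i)"
      by (simp add: D2_def add_increasing)
    then show ?thesis unfolding a_def by (rule order.trans[OF mult_left_mono t(2)]) simp
  qed simp
  have "(\<Sum>i<n. a i) = (\<integral>\<^sup>+ t. (\<Sum>i<n. (D1 t + D2 t) * indicator (?B i) t) \<partial>\<mu>) + ennreal (real n * \<delta>)"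
  proof -
    have "(\<Sum>i<n. ennreal \<delta>) = ennreal (real n * \<delta>)"
      using \<delta>(1) by (simp add: ennreal_mult ennreal_of_nat_eq_real_of_nat)
    moreover have "(\<Sum>i<n. \<integral>\<^sup>+ t. (D1 t + D2 t) * indicator (?B i) t \<partial>\<mu>) = (\<integral>\<^sup>+ t. (\<Sum>i<n. (D1 t + D2 t) * indicator (?B i) t) \<partial>\<mu>)"
      by (rule nn_integral_sum[symmetric]) measurable
    ultimately show ?thesis unfolding a_def sum.distrib by (simp only:)
  qed
  also have "\<dots> \<le> (\<integral>\<^sup>+ t. D1 t + D2 t \<partial>\<mu>) + ennreal d"
  proof (intro add_mono ennreal_leI \<delta> nn_integral_mono)
    fix t
    have "(\<Sum>i<n. (D1 t + D2 t) * indicator (?B i) t) = (\<Sum>i<n. if i = q t then D1 t + D2 t else 0)"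
      by (intro sum.cong) (auto simp: indicator_def)
    then show "(\<Sum>i<n. (D1 t + D2 t) * indicator (?B i) t) \<le> D1 t + D2 t" by simp
  qed
  also have "\<dots> \<le> (ennreal d + ennreal d) + ennreal d" by (intro add_mono D) auto
  finally have "(\<Sum>i<n. a i) + ennreal d \<le> ((ennreal d + ennreal d) + ennreal d) + ennreal d" by (intro add_mono) auto
  also have "\<dots> = ennreal e" using d by (simp add: d_def flip: ennreal_plus)
  finally have ad: "(\<Sum>i<n. a i) + ennreal d \<le> ennreal e" .
  show ?thesis
  proof (rule that[of "\<lambda>i. measure \<mu> (?B i)"])
    show "(\<integral>\<^sup>+ k. ennreal \<bar>(\<Sum>i<n. measure \<mu> (?B i) * H1 (t i, k)) - (\<integral>t. H1 (t, k) \<partial>\<mu>)\<bar> \<partial>\<kappa>1) \<le> ennreal e"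
      by (rule order.trans[OF sampling_error[OF fin(1,2) H(1) space q n b(1) E1 a1] ad])
    show "(\<integral>\<^sup>+ k. ennreal \<bar>(\<Sum>i<n. measure \<mu> (?B i) * H2 (t i, k)) - (\<integral>t. H2 (t, k) \<partial>\<mu>)\<bar> \<partial>\<kappa>2) \<le> ennreal e"
      by (rule order.trans[OF sampling_error[OF fin(1,3) H(2) space q n b(2) E2 a2] ad])
  qed simp
qed

lemma AE_tendsto_0_summable:
  fixes u :: "nat \<Rightarrow> 'a \<Rightarrow> real"
  assumes [measurable]: "\<And>j. u j \<in> borel_measurable M"
    and u: "\<And>j. (\<integral>\<^sup>+ x. ennreal \<bar>u j x\<bar> \<partial>M) \<le> ennreal ((1/2) ^ j)"
  shows "AE x in M. (\<lambda>j. u j x) \<longlonglongrightarrow> 0"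
proof -
  have "(\<integral>\<^sup>+ x. (\<Sum>j. ennreal \<bar>u j x\<bar>) \<partial>M) = (\<Sum>j. \<integral>\<^sup>+ x. ennreal \<bar>u j x\<bar> \<partial>M)"
    by (rule nn_integral_suminf) measurable
  also have "\<dots> \<le> (\<Sum>j. ennreal ((1/2) ^ j))" by (rule suminf_le[OF u]) auto
  also have "\<dots> = ennreal (\<Sum>j. (1/2) ^ j)" by (rule suminf_ennreal2) auto
  finally have "(\<integral>\<^sup>+ x. (\<Sum>j. ennreal \<bar>u j x\<bar>) \<partial>M) \<noteq> \<infinity>" by (auto simp: top_unique)
  then have "AE x in M. (\<Sum>j. ennreal \<bar>u j x\<bar>) \<noteq> \<infinity>" by (intro nn_integral_noteq_infinite) auto
  then show ?thesis
  proof eventually_elim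
    fix x assume "(\<Sum>j. ennreal \<bar>u j x\<bar>) \<noteq> \<infinity>"
    then have "summable (\<lambda>j. \<bar>u j x\<bar>)" by (intro summable_suminf_not_top) auto
    then show "(\<lambda>j. u j x) \<longlonglongrightarrow> 0"
      using summable_LIMSEQ_zero tendsto_rabs_zero_iff by blast
  qed
qed

text \<open>\<open>H2\<close> may change with \<open>j\<close>, which permits truncation at a
  growing level; its conclusion is therefore a difference tending to 0. Errors of order
  \<open>(1/2)^j\<close> are summable and give convergence almost everywhere without passing to
  subsequences.\<close>

lemma sampling_sequence:
  fixes H1 :: "'t \<times> 'k \<Rightarrow> real" and H2 :: "nat \<Rightarrow> 't \<times> 'l \<Rightarrow> real"
  assumes fin: "finite_measure \<mu>" "finite_measure \<kappa>1" "finite_measure \<kappa>2"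
    and H: "integrable (\<mu> \<Otimes>\<^sub>M \<kappa>1) H1" "\<And>j. integrable (\<mu> \<Otimes>\<^sub>M \<kappa>2) (H2 j)"
    and space: "space \<mu> = UNIV"
  obtains n :: "nat \<Rightarrow> nat" and w t where "\<And>j i. 0 \<le> w j i"
    "AE k in \<kappa>1. (\<lambda>j. \<Sum>i<n j. w j i * H1 (t j i, k)) \<longlonglongrightarrow> (\<integral>t. H1 (t, k) \<partial>\<mu>)"
    "AE k in \<kappa>2. (\<lambda>j. (\<Sum>i<n j. w j i * H2 j (t j i, k)) - (\<integral>t. H2 j (t, k) \<partial>\<mu>)) \<longlonglongrightarrow> 0"
proof -
  interpret \<mu>: finite_measure \<mu> by fact
  interpret \<kappa>1: finite_measure \<kappa>1 by fact
  interpret \<kappa>2: finite_measure \<kappa>2 by fact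
  interpret P1: pair_sigma_finite \<mu> \<kappa>1 ..
  interpret P2: pair_sigma_finite \<mu> \<kappa>2 ..
  have "\<forall>j. \<exists>(n :: nat) w t. (\<forall>i. 0 \<le> w i) \<and>
    (\<integral>\<^sup>+ k. ennreal \<bar>(\<Sum>i<n. w i * H1 (t i, k)) - (\<integral>t. H1 (t, k) \<partial>\<mu>)\<bar> \<partial>\<kappa>1) \<le> ennreal ((1/2) ^ j) \<and>
    (\<integral>\<^sup>+ k. ennreal \<bar>(\<Sum>i<n. w i * H2 j (t i, k)) - (\<integral>t. H2 j (t, k) \<partial>\<mu>)\<bar> \<partial>\<kappa>2) \<le> ennreal ((1/2) ^ j)"
  proof
    fix j :: nat
    have "0 < (1/2 :: real) ^ j" by simp
    then obtain n :: nat and w t where "\<And>i. 0 \<le> w i"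
      "(\<integral>\<^sup>+ k. ennreal \<bar>(\<Sum>i<n. w i * H1 (t i, k)) - (\<integral>t. H1 (t, k) \<partial>\<mu>)\<bar> \<partial>\<kappa>1) \<le> ennreal ((1/2) ^ j)"
      "(\<integral>\<^sup>+ k. ennreal \<bar>(\<Sum>i<n. w i * H2 j (t i, k)) - (\<integral>t. H2 j (t, k) \<partial>\<mu>)\<bar> \<partial>\<kappa>2) \<le> ennreal ((1/2) ^ j)"
      by (rule sampling_step[OF fin H(1) H(2)[of j] space]) blast
    then show "\<exists>(n :: nat) w t. (\<forall>i. 0 \<le> w i) \<and>
    (\<integral>\<^sup>+ k. ennreal \<bar>(\<Sum>i<n. w i * H1 (t i, k)) - (\<integral>t. H1 (t, k) \<partial>\<mu>)\<bar> \<partial>\<kappa>1) \<le> ennreal ((1/2) ^ j) \<and>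
    (\<integral>\<^sup>+ k. ennreal \<bar>(\<Sum>i<n. w i * H2 j (t i, k)) - (\<integral>t. H2 j (t, k) \<partial>\<mu>)\<bar> \<partial>\<kappa>2) \<le> ennreal ((1/2) ^ j)"
      by blast
  qed
  then obtain n :: "nat \<Rightarrow> nat" and w t where *: "\<forall>j. (\<forall>i. 0 \<le> w j i) \<and>
    (\<integral>\<^sup>+ k. ennreal \<bar>(\<Sum>i<n j. w j i * H1 (t j i, k)) - (\<integral>t. H1 (t, k) \<partial>\<mu>)\<bar> \<partial>\<kappa>1) \<le> ennreal ((1/2) ^ j) \<and>
    (\<integral>\<^sup>+ k. ennreal \<bar>(\<Sum>i<n j. w j i * H2 j (t j i, k)) - (\<integral>t. H2 j (t, k) \<partial>\<mu>)\<bar> \<partial>\<kappa>2) \<le> ennreal ((1/2) ^ j)"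
    unfolding choice_iff by blast
  have Hm[measurable]: "H1 \<in> borel_measurable (\<mu> \<Otimes>\<^sub>M \<kappa>1)" "H2 j \<in> borel_measurable (\<mu> \<Otimes>\<^sub>M \<kappa>2)" for j using H by auto
  have [measurable]: "(\<lambda>k. H1 (t, k)) \<in> borel_measurable \<kappa>1" "(\<lambda>k. H2 j (t, k)) \<in> borel_measurable \<kappa>2" for t j
    by (rule measurable_compose[OF measurable_Pair1'[of t \<mu>]]; simp add: space)+
  have [measurable]: "(\<lambda>k. \<integral>t. H1 (t, k) \<partial>\<mu>) \<in> borel_measurable \<kappa>1"
    using P1.integrable_snd[of "curry H1"] H by auto
  have [measurable]: "(\<lambda>k. \<integral>t. H2 j (t, k) \<partial>\<mu>) \<in> borel_measurable \<kappa>2" for j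
    using P2.integrable_snd[of "curry (H2 j)"] H by auto
  have 1: "AE k in \<kappa>1. (\<lambda>j. (\<Sum>i<n j. w j i * H1 (t j i, k)) - (\<integral>t. H1 (t, k) \<partial>\<mu>)) \<longlonglongrightarrow> 0"
    by (rule AE_tendsto_0_summable) (use * in auto)
  have 2: "AE k in \<kappa>2. (\<lambda>j. (\<Sum>i<n j. w j i * H2 j (t j i, k)) - (\<integral>t. H2 j (t, k) \<partial>\<mu>)) \<longlonglongrightarrow> 0"
    by (rule AE_tendsto_0_summable) (use * in auto)
  show ?thesis
  proof (rule that[OF _ _ 2])
    show "AE k in \<kappa>1. (\<lambda>j. \<Sum>i<n j. w j i * H1 (t j i, k)) \<longlonglongrightarrow> (\<integral>t. H1 (t, k) \<partial>\<mu>)"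
      using 1 by eventually_elim (rule LIM_zero_cancel)
  qed (use * in auto)
qed

text \<open>Sampling requires integrability over the product, while only integrability in
  \<open>t\<close> for almost every \<open>k\<close> is available. A strictly positive density that
  is small where the integral over \<open>t\<close> is large provides it and leaves the null sets
  unchanged.\<close>

lemma (in sigma_finite_measure) obtain_integrating_density:
  fixes H :: "'t \<times> 'a \<Rightarrow> real"
  assumes "finite_measure \<mu>" and H[measurable]: "H \<in> borel_measurable (\<mu> \<Otimes>\<^sub>M M)"
    and int: "AE k in M. integrable \<mu> (\<lambda>t. H (t, k))"
  obtains \<rho> :: "'a \<Rightarrow> real" where "\<rho> \<in> borel_measurable M" "\<And>k. 0 < \<rho> k"
    "finite_measure (density M \<rho>)" "integrable (\<mu> \<Otimes>\<^sub>M density M \<rho>) H"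
proof -
  interpret \<mu>: finite_measure \<mu> by fact
  interpret P: pair_sigma_finite \<mu> M ..
  obtain f :: "'a \<Rightarrow> real" where f[measurable]: "f \<in> borel_measurable M" "\<And>x. f x > 0" "\<And>x. f x \<le> 1" "integrable M f"
    by (rule obtain_positive_integrable_function) blast
  define I where "I k = (\<integral>\<^sup>+ t. ennreal \<bar>H (t, k)\<bar> \<partial>\<mu>)" for k
  have [measurable]: "I \<in> borel_measurable M"
    unfolding I_def[abs_def] using \<mu>.borel_measurable_nn_integral_snd[of "\<lambda>x. ennreal \<bar>H x\<bar>"] by simp
  \<comment> \<open>After multiplication by this weight the integral over \<open>t\<close> is at
    most \<open>f k\<close>. Where \<open>I k\<close> is infinite \<open>enn2real\<close> returns 0,
    but this happens only on a null set.\<close>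
  define \<rho> where "\<rho> k = f k / (1 + enn2real (I k))" for k
  have [measurable]: "\<rho> \<in> borel_measurable M" unfolding \<rho>_def[abs_def] by measurable
  have pos: "0 < \<rho> k" for k unfolding \<rho>_def using f(2) by (intro divide_pos_pos add_pos_nonneg) auto
  have le: "\<rho> k \<le> f k" for k unfolding \<rho>_def using f(2)[of k] by (simp add: divide_le_eq mult_le_cancel_left1)
  have ffin: "(\<integral>\<^sup>+ k. ennreal (f k) \<partial>M) < \<infinity>"
    using f(4) by (simp add: integrable_iff_bounded less_imp_le[OF f(2)])
  have le': "(\<integral>\<^sup>+ k. ennreal (\<rho> k) \<partial>M) \<le> (\<integral>\<^sup>+ k. ennreal (f k) \<partial>M)" by (intro nn_integral_mono ennreal_leI le)
  have fin: "finite_measure (density M \<rho>)"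
  proof (intro finite_measureI)
    have "emeasure (density M \<rho>) (space (density M \<rho>)) = (\<integral>\<^sup>+ k. ennreal (\<rho> k) \<partial>M)"
      by (subst emeasure_density) (auto intro!: nn_integral_cong)
    then show "emeasure (density M \<rho>) (space (density M \<rho>)) \<noteq> \<infinity>"
      using order.strict_trans1[OF le' ffin] by simp
  qed
  interpret D: finite_measure "density M \<rho>" by (rule fin)
  interpret PD: pair_sigma_finite \<mu> "density M \<rho>" ..
  have HD[measurable]: "H \<in> borel_measurable (\<mu> \<Otimes>\<^sub>M density M \<rho>)"
    using H by (simp cong: measurable_cong_sets)
  have "(\<integral>\<^sup>+ x. ennreal (norm (H x)) \<partial>(\<mu> \<Otimes>\<^sub>M density M \<rho>)) = (\<integral>\<^sup>+ k. I k \<partial>density M \<rho>)"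
    unfolding I_def using PD.nn_integral_snd[of "\<lambda>x. ennreal \<bar>H x\<bar>"] by simp
  also have "\<dots> = (\<integral>\<^sup>+ k. ennreal (\<rho> k) * I k \<partial>M)" by (rule nn_integral_density) measurable
  also have "\<dots> \<le> (\<integral>\<^sup>+ k. ennreal (f k) \<partial>M)"
  proof (rule nn_integral_mono_AE)
    show "AE k in M. ennreal (\<rho> k) * I k \<le> ennreal (f k)"
      using int
    proof eventually_elim
      fix k assume "integrable \<mu> (\<lambda>t. H (t, k))"
      then have "I k < \<infinity>" by (simp add: I_def integrable_iff_bounded)
      then obtain r where r: "I k = ennreal r" "0 \<le> r" by (cases "I k") auto
      have "\<rho> k * r \<le> f k" using r f(2)[of k] by (simp add: \<rho>_def field_simps)
      then show "ennreal (\<rho> k) * I k \<le> ennreal (f k)"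
        using r pos[of k] by (simp add: ennreal_leI flip: ennreal_mult)
    qed
  qed
  also have "\<dots> < \<infinity>" by (rule ffin)
  finally have "integrable (\<mu> \<Otimes>\<^sub>M density M \<rho>) H" by (intro integrableI_bounded) auto
  then show ?thesis using that[of \<rho>] pos fin by auto
qed

lemma AE_density_pos:
  assumes "\<rho> \<in> borel_measurable M" "\<And>k. 0 < \<rho> k" "AE k in density M (\<lambda>k. ennreal (\<rho> k)). P k"
  shows "AE k in M. P k"
  using assms(3) by (subst (asm) AE_density) (use assms in auto)

section \<open>The stochastic Fubini theorem\<close>

locale noise_field = pure_jump_noise M S \<nu> J X
  for M :: "'w measure" and S :: "'a::euclidean_space set" and \<nu> :: "real measure"
    and J :: "'w \<Rightarrow> ('a \<times> real) measure" and X :: "'a set \<Rightarrow> 'w \<Rightarrow> real" +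
  fixes f :: "'a \<Rightarrow> 'b::euclidean_space \<Rightarrow> real" and \<mu> :: "'b measure" and Y :: "'b \<Rightarrow> 'w \<Rightarrow> real"
  assumes f_meas: "(\<lambda>(s, t). f s t) \<in> borel_measurable (restrict_space borel S \<Otimes>\<^sub>M borel)"
    and f_L: "\<And>t. (\<lambda>s. f s t) \<in> noise_L S \<nu>"
    and \<mu>_finite: "finite_measure \<mu>" and sets_\<mu>: "sets \<mu> = sets borel"
    and Y_version: "measurable_version_noise_field M S X f Y"
    and Y_int: "AE \<omega> in M. (\<integral>\<^sup>+ t. ennreal \<bar>Y t \<omega>\<bar> \<partial>\<mu>) < \<infinity>"
begin

sublocale \<mu>: finite_measure \<mu> by (rule \<mu>_finite)

lemma space_\<mu>: "space \<mu> = UNIV"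
  using sets_eq_imp_space_eq[OF sets_\<mu>] by simp

lemma Y_joint [measurable]: "(\<lambda>x. Y (fst x) (snd x)) \<in> borel_measurable (\<mu> \<Otimes>\<^sub>M M)"
proof -
  have "(\<lambda>(t, \<omega>). Y t \<omega>) \<in> borel_measurable (borel \<Otimes>\<^sub>M M)"
    using Y_version unfolding measurable_version_noise_field_def by blast
  moreover have "sets (borel \<Otimes>\<^sub>M M) = sets (\<mu> \<Otimes>\<^sub>M M)"
    by (rule sets_pair_measure_cong) (simp_all add: sets_\<mu>)
  ultimately show ?thesis by (simp add: split_def cong: measurable_cong_sets)
qed

lemma f_joint [measurable]: "(\<lambda>x. f (snd x) (fst x)) \<in> borel_measurable (\<mu> \<Otimes>\<^sub>M Leb)"
proof -
  have "sets (restrict_space borel S \<Otimes>\<^sub>M borel) = sets (Leb \<Otimes>\<^sub>M \<mu>)"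
    by (rule sets_pair_measure_cong) (simp_all add: sets_\<mu> sets_Leb)
  then have "(\<lambda>(s, t). f s t) \<in> borel_measurable (Leb \<Otimes>\<^sub>M \<mu>)"
    using f_meas by (simp cong: measurable_cong_sets)
  from measurable_compose[OF measurable_pair_swap' this] show ?thesis by (simp add: split_def)
qed

lemma Y_measurable [measurable]: "Y t \<in> borel_measurable M"
  using measurable_compose[OF measurable_Pair1'[of t \<mu> M] Y_joint] by (simp add: space_\<mu>)

lemma f_t_measurable [measurable]: "(\<lambda>s. f s t) \<in> borel_measurable Leb"
  using f_L noise_L_iff by blast

lemma f_s_measurable: "s \<in> S \<Longrightarrow> (\<lambda>t. f s t) \<in> borel_measurable \<mu>"
  using measurable_compose[OF measurable_Pair2'[of s Leb \<mu>] f_joint] by simp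

lemma Y_\<omega>_measurable: "\<omega> \<in> space M \<Longrightarrow> (\<lambda>t. Y t \<omega>) \<in> borel_measurable \<mu>"
  using measurable_compose[OF measurable_Pair2'[of \<omega> M \<mu>] Y_joint] by simp

lemma pint_Y: "pint (jump_fun (\<lambda>s. f s t)) (Y t)"
proof (rule pint_cong_AE[OF pint_noise_integral[OF f_L]])
  have "AE \<omega> in M. Y t \<omega> = noise_integral M S X (\<lambda>s. f s t) \<omega>"
    using Y_version unfolding measurable_version_noise_field_def by blast
  then show "AE \<omega> in M. noise_integral M S X (\<lambda>s. f s t) \<omega> = Y t \<omega>" by eventually_elim simp
qed measurable

lemma Y_integrable: "AE \<omega> in M. integrable \<mu> (\<lambda>t. Y t \<omega>)"
  using Y_int AE_space by eventually_elim (simp add: integrable_iff_bounded Y_\<omega>_measurable)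

text \<open>The jump estimate is applied to sampled sums. As \<open>j\<close> grows, they diverge at
  almost every point of \<open>D\<close>, which removes the exceptional part of \<open>C\<close>;
  then \<open>L\<close> tends to infinity against the finite integral of
  \<open>\<bar>Y\<bar>\<close>. What survives is
  \<open>measure N C * exp (- measure N C) \<le> 0\<close>.\<close>

lemma bad_set_null:
  assumes D: "D \<in> sets Leb" and Dfin: "emeasure Leb D < \<infinity>"
    and bad: "\<And>s. s \<in> D \<Longrightarrow> (\<integral>\<^sup>+ t. ennreal \<bar>f s t\<bar> \<partial>\<mu>) = \<infinity>"
  shows "emeasure Leb D = 0"
proof -
  obtain e where e: "0 < e" "0 < emeasure \<nu> {z. e < \<bar>z\<bar>}" by (rule \<nu>_gt_pos)
  have DS: "D \<subseteq> S" using D by (simp add: sets_Leb_iff)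
  note [measurable] = D
  define C where "C = D \<times> {z. e < \<bar>z\<bar>}"
  have C[measurable]: "C \<in> sets N" unfolding sets_N C_def by (intro pair_measureI D) measurable
  have NC: "emeasure N C = emeasure Leb D * emeasure \<nu> {z. e < \<bar>z\<bar>}"
    unfolding jump_intensity_def C_def by (rule \<nu>.emeasure_pair_measure_Times) (auto simp: sets_\<nu>)
  have Cfin: "emeasure N C < \<infinity>" using Dfin \<nu>_gt_finite[OF e(1)] by (simp add: NC ennreal_mult_less_top)
  have Cinv: "r_invariant C" by (auto simp: r_invariant_def C_def)
  define H1 where "H1 = (\<lambda>x. \<bar>Y (fst x) (snd x)\<bar>)"
  have H1m: "H1 \<in> borel_measurable (\<mu> \<Otimes>\<^sub>M M)" unfolding H1_def by measurable
  have H1i: "AE \<omega> in M. integrable \<mu> (\<lambda>t. H1 (t, \<omega>))"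
    using Y_integrable by eventually_elim (simp add: H1_def)
  obtain \<rho> :: "'w \<Rightarrow> real" where \<rho>: "\<rho> \<in> borel_measurable M" "\<And>\<omega>. 0 < \<rho> \<omega>"
    "finite_measure (density M \<rho>)" "integrable (\<mu> \<Otimes>\<^sub>M density M \<rho>) H1"
    by (rule obtain_integrating_density[OF \<mu>_finite H1m H1i]) blast
  let ?K = "restrict_space Leb D"
  have K: "finite_measure ?K"
  proof (rule finite_measureI)
    have "space ?K = D" using DS by (auto simp: space_restrict_space)
    moreover have "emeasure ?K D = emeasure Leb D"
      by (rule emeasure_restrict_space) (use D DS in \<open>auto simp: Int_absorb2\<close>)
    ultimately show "emeasure ?K (space ?K) \<noteq> \<infinity>" using Dfin by simp
  qed
  \<comment> \<open>On \<open>D\<close> the function itself is not integrable in \<open>t\<close>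
    and could not be sampled. Its truncations are bounded, hence integrable over the finite product,
    and the level grows with the sampling index.\<close>
  define H2 where "H2 j x = min \<bar>f (snd x) (fst x)\<bar> (real j)" for j :: nat and x
  have H2: "integrable (\<mu> \<Otimes>\<^sub>M ?K) (H2 j)" for j
  proof -
    interpret K: finite_measure ?K by (rule K)
    interpret P: finite_measure "\<mu> \<Otimes>\<^sub>M ?K" by (rule finite_measure_pair_measure) (rule \<mu>_finite K)+
    have "(\<lambda>x. (fst x, snd x)) \<in> measurable (\<mu> \<Otimes>\<^sub>M ?K) (\<mu> \<Otimes>\<^sub>M Leb)"
      by (intro measurable_Pair measurable_fst) (rule measurable_compose[OF measurable_snd measurable_restrict_space1[OF measurable_ident_sets[OF refl]]])
    from measurable_compose[OF this f_joint]
    have [measurable]: "(\<lambda>x. f (snd x) (fst x)) \<in> borel_measurable (\<mu> \<Otimes>\<^sub>M ?K)" by simp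
    show ?thesis
      by (rule P.integrable_const_bound[of _ "real j"]) (auto simp: H2_def[abs_def])
  qed
  obtain n :: "nat \<Rightarrow> nat" and w t where w: "\<And>j i. 0 \<le> w j i"
    and lim1: "AE \<omega> in density M \<rho>. (\<lambda>j. \<Sum>i<n j. w j i * H1 (t j i, \<omega>)) \<longlonglongrightarrow> (\<integral>t. H1 (t, \<omega>) \<partial>\<mu>)"
    and lim2: "AE s in ?K. (\<lambda>j. (\<Sum>i<n j. w j i * H2 j (t j i, s)) - (\<integral>t. H2 j (t, s) \<partial>\<mu>)) \<longlonglongrightarrow> 0"
    by (rule sampling_sequence[where ?H2.0 = H2, OF \<mu>_finite \<rho>(3) K \<rho>(4) H2 space_\<mu>]) blast
  \<comment> \<open>As a Bochner integral this is a real number for every outcome, 0 where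
    \<open>\<bar>Y\<bar>\<close> is not integrable, so \<open>2 * Q / L\<close> tends to 0
    everywhere.\<close>
  define Q where "Q \<omega> = (\<integral>t. \<bar>Y t \<omega>\<bar> \<partial>\<mu>)" for \<omega>
  define Qj where "Qj j \<omega> = (\<Sum>i<n j. w j i * \<bar>Y (t j i) \<omega>\<bar>)" for j \<omega>
  have Qlim: "AE \<omega> in M. (\<lambda>j. Qj j \<omega>) \<longlonglongrightarrow> Q \<omega>"
    using AE_density_pos[OF \<rho>(1,2) lim1] by (simp add: H1_def Q_def Qj_def)
  have [measurable]: "Qj j \<in> borel_measurable M" for j unfolding Qj_def by measurable
  have [measurable]: "Q \<in> borel_measurable M"
    unfolding Q_def
    using \<mu>.borel_measurable_lebesgue_integral[of "\<lambda>\<omega> t. \<bar>Y t \<omega>\<bar>" M]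
      measurable_compose[OF measurable_pair_swap' Y_joint] by (simp add: split_def)
  have Q0: "0 \<le> Q \<omega>" for \<omega> unfolding Q_def by (rule Bochner_Integration.integral_nonneg) simp
  have Qj0: "0 \<le> Qj j \<omega>" for j \<omega> unfolding Qj_def by (intro sum_nonneg mult_nonneg_nonneg w) auto
  define a where "a j s = (\<Sum>i<n j. w j i * \<bar>f s (t j i)\<bar>)" for j s
  have a_inf: "AE s in Leb. s \<in> D \<longrightarrow> filterlim (\<lambda>j. a j s) at_top sequentially"
  proof -
    have "AE s in Leb. s \<in> D \<longrightarrow> (\<lambda>j. (\<Sum>i<n j. w j i * H2 j (t j i, s)) - (\<integral>t. H2 j (t, s) \<partial>\<mu>)) \<longlonglongrightarrow> 0"
      using lim2 by (subst (asm) AE_restrict_space_iff) (use D DS in \<open>auto simp: Int_absorb2\<close>)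
    then show ?thesis
    proof (eventually_elim, intro impI)
      fix s assume *: "s \<in> D \<longrightarrow> (\<lambda>j. (\<Sum>i<n j. w j i * H2 j (t j i, s)) - (\<integral>t. H2 j (t, s) \<partial>\<mu>)) \<longlonglongrightarrow> 0"
        and s: "s \<in> D"
      have sS: "s \<in> S" using s DS by auto
      note [measurable] = f_s_measurable[OF sS]
      have intH: "integrable \<mu> (\<lambda>t. H2 j (t, s))" for j
        by (rule \<mu>.integrable_const_bound[of _ "real j"]) (auto simp: H2_def)
      \<comment> \<open>Monotone convergence: the truncated integrals increase to the infinite
        integral of \<open>\<bar>f s t\<bar>\<close>. The sampled sums differ from them by a null
        sequence and lie below \<open>a j s\<close>, which therefore diverges as well.\<close>
      have "filterlim (\<lambda>j. \<integral>t. H2 j (t, s) \<partial>\<mu>) at_top sequentially"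
        unfolding filterlim_at_top
      proof
        fix Z :: real
        have "(\<integral>\<^sup>+ t. ennreal \<bar>f s t\<bar> \<partial>\<mu>) = (\<integral>\<^sup>+ t. (SUP j. ennreal (H2 j (t, s))) \<partial>\<mu>)"
        proof (rule nn_integral_cong)
          fix t
          have "(\<lambda>j. ennreal (H2 j (t, s))) \<longlonglongrightarrow> (SUP j. ennreal (H2 j (t, s)))"
            by (rule LIMSEQ_SUP) (auto simp: incseq_def H2_def intro!: ennreal_leI)
          moreover have "\<forall>\<^sub>F j in sequentially. ennreal (H2 j (t, s)) = ennreal \<bar>f s t\<bar>"
          proof -
            obtain m where "\<bar>f s t\<bar> \<le> real m" using real_arch_simple by blast
            then show ?thesis unfolding eventually_sequentially
              by (intro exI[of _ m]) (auto simp: H2_def)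
          qed
          then have "(\<lambda>j. ennreal (H2 j (t, s))) \<longlonglongrightarrow> ennreal \<bar>f s t\<bar>" by (rule tendsto_eventually)
          ultimately show "ennreal \<bar>f s t\<bar> = (SUP j. ennreal (H2 j (t, s)))" by (rule LIMSEQ_unique[symmetric])
        qed
        also have "\<dots> = (SUP j. \<integral>\<^sup>+ t. ennreal (H2 j (t, s)) \<partial>\<mu>)"
          by (rule nn_integral_monotone_convergence_SUP) (auto simp: incseq_def le_fun_def H2_def intro!: ennreal_leI)
        finally have "ennreal Z < (SUP j. \<integral>\<^sup>+ t. ennreal (H2 j (t, s)) \<partial>\<mu>)" using bad[OF s] by simp
        then obtain j where "ennreal Z < (\<integral>\<^sup>+ t. ennreal (H2 j (t, s)) \<partial>\<mu>)" unfolding less_SUP_iff by blast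
        also have "\<dots> = ennreal (\<integral>t. H2 j (t, s) \<partial>\<mu>)"
          by (rule nn_integral_eq_integral[OF intH]) (simp add: H2_def)
        finally have j: "Z \<le> (\<integral>t. H2 j (t, s) \<partial>\<mu>)"
          using ennreal_leI[of "\<integral>t. H2 j (t, s) \<partial>\<mu>" Z] by (meson leD le_cases)
        have "Z \<le> (\<integral>t. H2 i (t, s) \<partial>\<mu>)" if "j \<le> i" for i
        proof -
          have "(\<integral>t. H2 j (t, s) \<partial>\<mu>) \<le> (\<integral>t. H2 i (t, s) \<partial>\<mu>)"
            by (rule integral_mono[OF intH intH]) (use that in \<open>auto simp: H2_def\<close>)
          with j show ?thesis by simp
        qed
        then show "\<forall>\<^sub>F j in sequentially. Z \<le> (\<integral>t. H2 j (t, s) \<partial>\<mu>)"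
          unfolding eventually_sequentially by blast
      qed
      from filterlim_tendsto_add_at_top[OF *[rule_format, OF s] this]
      have "filterlim (\<lambda>j. \<Sum>i<n j. w j i * H2 j (t j i, s)) at_top sequentially" by simp
      then show "filterlim (\<lambda>j. a j s) at_top sequentially"
      proof (rule filterlim_at_top_mono)
        show "\<forall>\<^sub>F j in sequentially. (\<Sum>i<n j. w j i * H2 j (t j i, s)) \<le> a j s"
          unfolding a_def by (intro always_eventually allI sum_mono mult_left_mono w) (simp add: H2_def)
      qed
    qed
  qed
  let ?c = "measure N C * exp (- measure N C)" and ?b = "1 + exp (measure N C)"
  \<comment> \<open>The probability of \<open>L / 2 \<le> Qj\<close> is replaced by its Markov bound
    with \<open>min 1 (2 * Qj / L)\<close>, a bounded continuous expression to which dominated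
    convergence applies.\<close>
  have bound: "?c \<le> ?b * (\<integral>\<omega>. min 1 (2 * Q \<omega> / L) \<partial>M)" if L: "0 < L" for L
  proof -
    define B where "B j = {x \<in> C. (\<Sum>i<n j. w j i * \<bar>jump_fun (\<lambda>s. f s (t j i)) x\<bar>) \<le> 2 * L}" for j
    have CN: "C \<subseteq> space N" by (rule sets.sets_into_space) fact
    have [measurable]: "B j \<in> sets N" for j
    proof -
      have "B j = {x \<in> space N. x \<in> C \<and> (\<Sum>i<n j. w j i * \<bar>jump_fun (\<lambda>s. f s (t j i)) x\<bar>) \<le> 2 * L}"
        using CN by (auto simp: B_def)
      also have "\<dots> \<in> sets N" by measurable
      finally show ?thesis .
    qed
    have Cint: "integrable N (indicator C :: _ \<Rightarrow> real)" using Cfin by simp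
    have "(\<lambda>j. \<integral>x. indicator (B j) x \<partial>N) \<longlonglongrightarrow> (\<integral>x. (0::real) \<partial>N)"
    proof (rule integral_dominated_convergence[where w = "indicator C"])
      show "AE x in N. (\<lambda>j. indicator (B j) x :: real) \<longlonglongrightarrow> 0"
        using AE_N_fst[OF a_inf]
      proof eventually_elim
        fix x :: "'a \<times> real" assume x: "fst x \<in> D \<longrightarrow> filterlim (\<lambda>j. a j (fst x)) at_top sequentially"
        show "(\<lambda>j. indicator (B j) x :: real) \<longlonglongrightarrow> 0"
        proof (cases "x \<in> C")
          case True
          then have "fst x \<in> D" "e < \<bar>snd x\<bar>" by (auto simp: C_def)
          with x have "\<forall>\<^sub>F j in sequentially. 2 * L / e < a j (fst x)"
            by (simp add: filterlim_at_top_dense)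
          then have "\<forall>\<^sub>F j in sequentially. indicator (B j) x = (0::real)"
          proof eventually_elim
            fix j assume "2 * L / e < a j (fst x)"
            \<comment> \<open>On \<open>C\<close> the jump size exceeds \<open>e\<close>, which
              turns divergence of \<open>a j\<close> in \<open>s\<close> into divergence of the
              weighted sums in \<open>(s, z)\<close>.\<close>
            then have "2 * L < a j (fst x) * e" using e by (simp add: field_simps)
            also have "\<dots> \<le> a j (fst x) * \<bar>snd x\<bar>"
              using \<open>e < \<bar>snd x\<bar>\<close> unfolding a_def by (intro mult_left_mono sum_nonneg mult_nonneg_nonneg w) auto
            also have "\<dots> = (\<Sum>i<n j. w j i * \<bar>jump_fun (\<lambda>s. f s (t j i)) x\<bar>)"
              by (simp add: a_def jump_fun_def sum_distrib_right abs_mult mult.assoc)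
            finally show "indicator (B j) x = (0::real)" by (simp add: B_def)
          qed
          then show ?thesis by (rule tendsto_eventually)
        qed (simp add: B_def)
      qed
      show "AE x in N. norm (indicator (B j) x :: real) \<le> indicator C x" for j
        by (rule AE_I2) (auto simp: B_def indicator_def)
    qed (use Cint in auto)
    then have lim_B: "(\<lambda>j. measure N (B j)) \<longlonglongrightarrow> 0" by (simp add: Int_absorb2 sets.sets_into_space)
    have lim_Q: "(\<lambda>j. \<integral>\<omega>. min 1 (2 * Qj j \<omega> / L) \<partial>M) \<longlonglongrightarrow> (\<integral>\<omega>. min 1 (2 * Q \<omega> / L) \<partial>M)"
    proof (rule integral_dominated_convergence[where w = "\<lambda>_. 1"])
      show "AE \<omega> in M. (\<lambda>j. min 1 (2 * Qj j \<omega> / L)) \<longlonglongrightarrow> min 1 (2 * Q \<omega> / L)"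
        using Qlim by eventually_elim (use L in \<open>auto intro!: tendsto_intros\<close>)
      show "AE \<omega> in M. norm (min 1 (2 * Qj j \<omega> / L)) \<le> 1" for j
        using L Qj0 by (intro AE_I2) (auto simp: min_def abs_le_iff intro: order.trans[of _ 0])
    qed auto
    have "?c \<le> measure N (B j) + ?b * (\<integral>\<omega>. min 1 (2 * Qj j \<omega> / L) \<partial>M)" for j
    proof -
      have "?c \<le> measure N (B j) + ?b * measure M {\<omega> \<in> space M. L / 2 \<le> Qj j \<omega>}"
        unfolding B_def Qj_def by (rule jump_bound[OF C Cfin Cinv pint_Y w L])
      also have "measure M {\<omega> \<in> space M. L / 2 \<le> Qj j \<omega>} \<le> (\<integral>\<omega>. min 1 (2 * Qj j \<omega> / L) \<partial>M)"
      proof -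
        have "measure M {\<omega> \<in> space M. L / 2 \<le> Qj j \<omega>} = (\<integral>\<omega>. indicator {\<omega> \<in> space M. L / 2 \<le> Qj j \<omega>} \<omega> \<partial>M)" by simp
        also have "\<dots> \<le> (\<integral>\<omega>. min 1 (2 * Qj j \<omega> / L) \<partial>M)"
        proof (rule integral_mono)
          show "integrable M (\<lambda>\<omega>. min 1 (2 * Qj j \<omega> / L))"
            by (rule integrable_const_bound[of _ 1]) (use L Qj0 in \<open>auto simp: min_def abs_le_iff intro: order.trans[of _ 0]\<close>)
          show "indicator {\<omega> \<in> space M. L / 2 \<le> Qj j \<omega>} \<omega> \<le> min 1 (2 * Qj j \<omega> / L)" for \<omega>
            using L Qj0[of j \<omega>] by (auto simp: indicator_def field_simps)
        qed (auto simp: less_top[symmetric])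
        finally show ?thesis .
      qed
      finally show ?thesis by (simp add: add_pos_pos mult_left_mono)
    qed
    moreover have "(\<lambda>j. measure N (B j) + ?b * (\<integral>\<omega>. min 1 (2 * Qj j \<omega> / L) \<partial>M)) \<longlonglongrightarrow> 0 + ?b * (\<integral>\<omega>. min 1 (2 * Q \<omega> / L) \<partial>M)"
      by (intro tendsto_add tendsto_mult lim_B lim_Q tendsto_const)
    ultimately show ?thesis using LIMSEQ_le_const by fastforce
  qed
  have "(\<lambda>L::nat. \<integral>\<omega>. min 1 (2 * Q \<omega> / real (Suc L)) \<partial>M) \<longlonglongrightarrow> (\<integral>\<omega>. (0::real) \<partial>M)"
  proof (rule integral_dominated_convergence[where w = "\<lambda>_. 1"])
    have "(\<lambda>L::nat. min 1 (2 * Q \<omega> / real (Suc L))) \<longlonglongrightarrow> 0" for \<omega>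
    proof -
      have "(\<lambda>L::nat. min 1 (2 * Q \<omega> * (1 / real (Suc L)))) \<longlonglongrightarrow> min 1 (2 * Q \<omega> * 0)"
        by (intro tendsto_min tendsto_mult tendsto_const LIMSEQ_Suc[OF lim_1_over_n])
      then show ?thesis by simp
    qed
    then show "AE \<omega> in M. (\<lambda>L::nat. min 1 (2 * Q \<omega> / real (Suc L))) \<longlonglongrightarrow> 0" by simp
    show "AE \<omega> in M. norm (min 1 (2 * Q \<omega> / real (Suc L))) \<le> 1" for L :: nat
      using Q0 by (intro AE_I2) (auto simp: min_def abs_le_iff intro: order.trans[of _ 0])
  qed auto
  then have "(\<lambda>L::nat. ?b * (\<integral>\<omega>. min 1 (2 * Q \<omega> / real (Suc L)) \<partial>M)) \<longlonglongrightarrow> ?b * 0"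
    by (intro tendsto_mult tendsto_const) simp
  then have "?c \<le> ?b * 0"
    by (rule LIMSEQ_le_const) (use bound in auto)
  then have "measure N C = 0" using measure_nonneg[of N C] by (simp add: mult_le_0_iff)
  then have "emeasure N C = 0" using Cfin emeasure_eq_ennreal_measure[of N C] by (simp add: less_top)
  then show ?thesis using e by (auto simp: NC)
qed

text \<open>Balls exhaust the set of bad \<open>s\<close> by sets of finite measure, for which the
  jump argument is available.\<close>

lemma AE_integrable_f: "AE s in Leb. integrable \<mu> (\<lambda>t. f s t)"
proof -
  have [measurable]: "(\<lambda>s. \<integral>\<^sup>+ t. ennreal \<bar>f s t\<bar> \<partial>\<mu>) \<in> borel_measurable Leb"
    using \<mu>.borel_measurable_nn_integral_fst[of "\<lambda>x. ennreal \<bar>f (fst x) (snd x)\<bar>" Leb]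
      measurable_compose[OF measurable_pair_swap' f_joint] by (simp add: split_def)
  define D where "D k = {s \<in> space Leb. (\<integral>\<^sup>+ t. ennreal \<bar>f s t\<bar> \<partial>\<mu>) = \<infinity>} \<inter> ball 0 (real k)" for k :: nat
  have D: "D k \<in> sets Leb" for k
  proof -
    have "{s \<in> space Leb. (\<integral>\<^sup>+ t. ennreal \<bar>f s t\<bar> \<partial>\<mu>) = \<infinity>} \<in> sets Leb" by measurable
    then show ?thesis by (auto simp: D_def sets_Leb_iff)
  qed
  have "D k \<in> null_sets Leb" for k
  proof -
    have "emeasure Leb (D k) = emeasure lborel (D k)" using D[of k] by (intro emeasure_Leb) (auto simp: sets_Leb_iff)
    also have "\<dots> \<le> emeasure lborel (ball 0 (real k) :: 'a set)" by (rule emeasure_mono) (auto simp: D_def)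
    also have "\<dots> < \<infinity>" by (rule emeasure_bounded_finite) simp
    finally have "emeasure Leb (D k) = 0" by (intro bad_set_null D) (auto simp: D_def)
    then show ?thesis using D by (simp add: null_sets_def)
  qed
  then have "(\<Union>k. D k) \<in> null_sets Leb" by (rule null_sets_UN)
  then have "AE s in Leb. s \<notin> (\<Union>k. D k)" by (rule AE_not_in)
  then show ?thesis
    using AE_space
  proof eventually_elim
    fix s assume s: "s \<notin> (\<Union>k. D k)" "s \<in> space Leb"
    obtain k :: nat where "norm s < real k" using reals_Archimedean2 by blast
    then have "(\<integral>\<^sup>+ t. ennreal \<bar>f s t\<bar> \<partial>\<mu>) \<noteq> \<infinity>" using s by (auto simp: D_def)
    then show "integrable \<mu> (\<lambda>t. f s t)"
      using s f_s_measurable by (simp add: integrable_iff_bounded less_top)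
  qed
qed

text \<open>Common sample points give sums that converge almost surely for the field and almost
  everywhere for \<open>f\<close>, and each sum is a finite linear combination of integrals; the
  closed graph property then applies. With integrability of \<open>f\<close> in \<open>t\<close>
  established, \<open>f\<close> is sampled without truncation, under a finite measure equivalent to
  \<open>Leb\<close>.\<close>

lemma pint_mean: "pint (jump_fun (\<lambda>s. \<integral>t. f s t \<partial>\<mu>)) (\<lambda>\<omega>. \<integral>t. Y t \<omega> \<partial>\<mu>)"
proof -
  define H1 where "H1 = (\<lambda>x. Y (fst x) (snd x))"
  define H2 where "H2 = (\<lambda>x. f (snd x) (fst x))"
  have H1m: "H1 \<in> borel_measurable (\<mu> \<Otimes>\<^sub>M M)" unfolding H1_def by measurable
  have H2m: "H2 \<in> borel_measurable (\<mu> \<Otimes>\<^sub>M Leb)" unfolding H2_def by (rule f_joint)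
  have H1i: "AE \<omega> in M. integrable \<mu> (\<lambda>t. H1 (t, \<omega>))" using Y_integrable by (simp add: H1_def)
  have H2i: "AE s in Leb. integrable \<mu> (\<lambda>t. H2 (t, s))" using AE_integrable_f by (simp add: H2_def)
  obtain \<rho>1 :: "'w \<Rightarrow> real" where \<rho>1: "\<rho>1 \<in> borel_measurable M" "\<And>\<omega>. 0 < \<rho>1 \<omega>"
    "finite_measure (density M \<rho>1)" "integrable (\<mu> \<Otimes>\<^sub>M density M \<rho>1) H1"
    by (rule obtain_integrating_density[OF \<mu>_finite H1m H1i]) blast
  obtain \<rho>2 :: "'a \<Rightarrow> real" where \<rho>2: "\<rho>2 \<in> borel_measurable Leb" "\<And>s. 0 < \<rho>2 s"
    "finite_measure (density Leb \<rho>2)" "integrable (\<mu> \<Otimes>\<^sub>M density Leb \<rho>2) H2"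
    by (rule Leb.obtain_integrating_density[OF \<mu>_finite H2m H2i]) blast
  obtain n :: "nat \<Rightarrow> nat" and w t where
    lim1: "AE \<omega> in density M \<rho>1. (\<lambda>j. \<Sum>i<n j. w j i * H1 (t j i, \<omega>)) \<longlonglongrightarrow> (\<integral>t. H1 (t, \<omega>) \<partial>\<mu>)"
    and lim2: "AE s in density Leb \<rho>2. (\<lambda>j. (\<Sum>i<n j. w j i * H2 (t j i, s)) - (\<integral>t. H2 (t, s) \<partial>\<mu>)) \<longlonglongrightarrow> 0"
    by (rule sampling_sequence[where ?H2.0 = "\<lambda>_. H2", OF \<mu>_finite \<rho>1(3) \<rho>2(3) \<rho>1(4) \<rho>2(4) space_\<mu>]) blast
  have V[measurable]: "(\<lambda>\<omega>. \<integral>t. Y t \<omega> \<partial>\<mu>) \<in> borel_measurable M"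
    using \<mu>.borel_measurable_lebesgue_integral[of "\<lambda>\<omega> t. Y t \<omega>" M]
      measurable_compose[OF measurable_pair_swap' Y_joint] by (simp add: split_def)
  have g[measurable]: "(\<lambda>s. \<integral>t. f s t \<partial>\<mu>) \<in> borel_measurable Leb"
    using \<mu>.borel_measurable_lebesgue_integral[of f Leb]
      measurable_compose[OF measurable_pair_swap' f_joint] by (simp add: split_def)
  have p: "pint (jump_fun (\<lambda>s. \<Sum>i<n j. w j i * f s (t j i))) (\<lambda>\<omega>. \<Sum>i<n j. w j i * Y (t j i) \<omega>)" for j
  proof -
    have "pint (\<lambda>x. \<Sum>i<n j. w j i * jump_fun (\<lambda>s. f s (t j i)) x) (\<lambda>\<omega>. \<Sum>i<n j. w j i * Y (t j i) \<omega>)"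
      by (intro pint_sum pint_cmult pint_Y)
    then show ?thesis by (simp add: jump_fun_def[abs_def] sum_distrib_right mult.assoc)
  qed
  show ?thesis
  proof (rule pint_closed[OF p jump_fun_measurable[OF g] antisym_jump_fun _ V])
    have "AE s in Leb. (\<lambda>j. \<Sum>i<n j. w j i * f s (t j i)) \<longlonglongrightarrow> (\<integral>t. f s t \<partial>\<mu>)"
      using AE_density_pos[OF \<rho>2(1,2) lim2] by eventually_elim (auto simp: H2_def intro: LIM_zero_cancel)
    from AE_N_fst[OF this]
    show "AE x in N. (\<lambda>j. jump_fun (\<lambda>s. \<Sum>i<n j. w j i * f s (t j i)) x) \<longlonglongrightarrow> jump_fun (\<lambda>s. \<integral>t. f s t \<partial>\<mu>) x"
      by eventually_elim (auto simp: jump_fun_def intro!: tendsto_intros)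
    show "(\<lambda>j. tmom M (\<lambda>\<omega>. (\<Sum>i<n j. w j i * Y (t j i) \<omega>) - (\<integral>t. Y t \<omega> \<partial>\<mu>))) \<longlonglongrightarrow> 0"
    proof (rule tmom_tendsto_AE)
      show "AE \<omega> in M. (\<lambda>j. \<Sum>i<n j. w j i * Y (t j i) \<omega>) \<longlonglongrightarrow> (\<integral>t. Y t \<omega> \<partial>\<mu>)"
        using AE_density_pos[OF \<rho>1(1,2) lim1] by (simp add: H1_def)
    qed measurable
  qed
qed

text \<open>No bound on the mean of \<open>f\<close> is estimated: having an integral at all forces
  a finite truncated second moment.\<close>

lemma mean_noise_L: "(\<lambda>s. \<integral>t. f s t \<partial>\<mu>) \<in> noise_L S \<nu>"
proof -
  have "(\<lambda>s. \<integral>t. f s t \<partial>\<mu>) \<in> borel_measurable Leb"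
    using \<mu>.borel_measurable_lebesgue_integral[of f Leb]
      measurable_compose[OF measurable_pair_swap' f_joint] by (simp add: split_def)
  then show ?thesis unfolding noise_L_iff using pint_tmom_finite[OF pint_mean] by blast
qed

lemma stochastic_Fubini:
  "AE \<omega> in M. (\<integral>t. Y t \<omega> \<partial>\<mu>) = noise_integral M S X (\<lambda>s. \<integral>t. f s t \<partial>\<mu>) \<omega>"
  by (rule pint_unique[OF pint_mean pint_noise_integral[OF mean_noise_L]]) simp

end

theorem theorem4p3:
  fixes M :: "'w measure"
    and S :: "'a::euclidean_space set"
    and \<nu> :: "real measure"
    and J :: "'w \<Rightarrow> ('a \<times> real) measure"
    and X :: "'a set \<Rightarrow> 'w \<Rightarrow> real"
    and f :: "'a \<Rightarrow> 'b::euclidean_space \<Rightarrow> real"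
    and \<mu> :: "'b measure"
    and Y :: "'b \<Rightarrow> 'w \<Rightarrow> real"
  assumes noise: "symmetric_pure_jump_noise M S \<nu> J X"
    and f_meas: "(\<lambda>(s, t). f s t) \<in> borel_measurable (restrict_space borel S \<Otimes>\<^sub>M borel)"
    and f_L: "\<And>t. (\<lambda>s. f s t) \<in> noise_L S \<nu>"
    and \<mu>: "finite_measure \<mu>" "sets \<mu> = sets borel"
    and Y: "measurable_version_noise_field M S X f Y"
    and Y_int: "AE \<omega> in M. (\<integral>\<^sup>+ t. ennreal \<bar>Y t \<omega>\<bar> \<partial>\<mu>) < \<infinity>"
  shows "(AE s in restrict_space lborel S. integrable \<mu> (\<lambda>t. f s t)) \<and>
    (\<lambda>s. \<integral>t. f s t \<partial>\<mu>) \<in> noise_L S \<nu> \<and>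
    (AE \<omega> in M. (\<integral>t. Y t \<omega> \<partial>\<mu>) = noise_integral M S X (\<lambda>s. \<integral>t. f s t \<partial>\<mu>) \<omega>)"
proof -
  interpret noise_field M S \<nu> J X f \<mu> Y
    by (intro noise_field.intro pure_jump_noise.intro noise_field_axioms.intro assms)
  show ?thesis using AE_integrable_f mean_noise_L stochastic_Fubini by blast
qed

end
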